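(* Let $d\in\mathbb{N}$, $0<p\le u<\infty$ and $1<q\le\infty$, and let $q'$ be the conjugate exponent of $q$, i.e. $\frac1q+\frac1{q'}=1$ (with $q'=1$ if $q=\infty$). Then $$\mathcal{N}^{\frac du}_{u,p,q}(\mathbb{R}^d)\hookrightarrow \mathcal{M}_{\frac up,\Phi_{p,q'}}(\mathbb{R}^d),$$ where $\Phi_{p,q'}(t)=t^p\exp(t^{q'})$, $t\ge0$.
   Context: Dyadic cubes: $\mathcal{Q}=\{Q_{j,k}=2^{-j}([0,1)^d+k): j\in\mathbb{Z},\ k\in\mathbb{Z}^d\}$; $|\cdot|$ is Lebesgue measure. Morrey space: for $0<p\le u<\infty$, $\mathcal{M}_{u,p}(\mathbb{R}^d)$ is the set of all $f\in L_p^{\mathrm{loc}}(\mathbb{R}^d)$ with $\|f|\mathcal{M}_{u,p}(\mathbb{R}^d)\|=\sup_{Q\in\mathcal{Q}}|Q|^{\frac1u-\frac1p}\left(\int_Q|f(y)|^p\,dy\right)^{1/p}<\infty$. Resolution of unity: $\varphi_0=\varphi\in\mathcal{S}(\mathbb{R}^d)$ with $\operatorname{supp}\varphi\subset\{|x|\le 2\}$ and $\varphi(x)=1$ for $|x|\le1$; $\varphi_j(x)=\varphi(2^{-j}x)-\varphi(2^{-j+1}x)$ for $j\in\mathbb{N}$. $\mathcal{F}$ is the Fourier transform on $\mathcal{S}'(\mathbb{R}^d)$. Besov-Morrey space: for $0<p\le u<\infty$, $0<q\le\infty$, $s\in\mathbb{R}$, $\mathcal{N}^s_{u,p,q}(\mathbb{R}^d)$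 is the set of all $f\in\mathcal{S}'(\mathbb{R}^d)$ with $\|f|\mathcal{N}^s_{u,p,q}(\mathbb{R}^d)\|=\left(\sum_{j=0}^\infty 2^{jsq}\|\mathcal{F}^{-1}(\varphi_j\mathcal{F}f)|\mathcal{M}_{u,p}(\mathbb{R}^d)\|^q\right)^{1/q}<\infty$ (usual modification if $q=\infty$). Orlicz-Morrey space: for $1\le r<\infty$, a function $\Phi:[0,\infty)\to[0,\infty)$ and a cube $Q$, put $\|f\|_{(r,\Phi);Q}=\inf\left\{\lambda>0:\ |Q|^{\frac1r-1}\int_Q\Phi\left(\frac{|f(x)|}{\lambda}\right)dx\le1\right\}$. Then $\mathcal{M}_{r,\Phi}(\mathbb{R}^d)$ is the set of all measurable $f$ with $\|f|\mathcal{M}_{r,\Phi}(\mathbb{R}^d)\|=\sup_{Q\in\mathcal{Q}}\|f\|_{(r,\Phi);Q}<\infty$. This is applied with $\Phi=\Phi_{p,q}$, $\Phi_{p,q}(t)=t^p\exp(t^q)$, for all $p>0$. $X\hookrightarrow Y$ means $X\subset Y$ and the natural embedding is continuous, i.e. $\|f|Y\|\le C\|f|X\|$ for all $f\in X$ with $C$ independent of $f$ (distributions given by locally integrable functions are identified with those functions). *)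

theory Defs
  imports "HOL-Analysis.Analysis"
begin

section \<open>Smooth functions, Schwartz functions, tempered distributions\<close>

text \<open>Functions on \<open>\<real>\<^sup>d\<close> are functions on \<^typ>\<open>real ^ 'n\<close>, where \<open>d = CARD('n)\<close>.
  A list of indices plays the role of a multi-index.\<close>

definition partial_deriv :: "'n::finite \<Rightarrow> (real ^ 'n \<Rightarrow> complex) \<Rightarrow> real ^ 'n \<Rightarrow> complex" where
  "partial_deriv i f x = frechet_derivative f (at x) (axis i 1)"

fun iter_partial_deriv ::
    "'n::finite list \<Rightarrow> (real ^ 'n \<Rightarrow> complex) \<Rightarrow> real ^ 'n \<Rightarrow> complex" where
  "iter_partial_deriv [] f = f"
| "iter_partial_deriv (i # is) f = partial_deriv i (iter_partial_deriv is f)"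

definition smooth :: "(real ^ 'n::finite \<Rightarrow> complex) \<Rightarrow> bool" where
  "smooth f \<longleftrightarrow> (\<forall>is x. iter_partial_deriv is f differentiable (at x))"

definition supp :: "(real ^ 'n::finite \<Rightarrow> complex) \<Rightarrow> (real ^ 'n) set" where
  "supp f = closure {x. f x \<noteq> 0}"

definition test_functions :: "(real ^ 'n::finite \<Rightarrow> complex) set" where
  "test_functions = {f. smooth f \<and> compact (supp f)}"

definition schwartz :: "(real ^ 'n::finite \<Rightarrow> complex) set" where
  "schwartz = {f. smooth f \<and>
     (\<forall>N is. bounded (range (\<lambda>x. (1 + norm x) ^ N * norm (iter_partial_deriv is f x))))}"

text \<open>An increasing sequence of norms generating the topology of the Schwartz space.\<close>

definition schwartz_norm :: "nat \<Rightarrow> (real ^ 'n::finite \<Rightarrow> complex) \<Rightarrow> real" where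
  "schwartz_norm N f =
     (\<Sum>is | length is \<le> N. SUP x. (1 + norm x) ^ N * norm (iter_partial_deriv is f x))"

text \<open>A tempered distribution is a continuous linear functional on \<^const>\<open>schwartz\<close>. It is
  represented by a HOL function on all functions; the values outside \<^const>\<open>schwartz\<close>
  are irrelevant and are never used below.\<close>

definition tempered_distributions ::
    "((real ^ 'n::finite \<Rightarrow> complex) \<Rightarrow> complex) set" where
  "tempered_distributions = {T.
     (\<forall>\<eta>\<in>schwartz. \<forall>\<psi>\<in>schwartz. T (\<lambda>x. \<eta> x + \<psi> x) = T \<eta> + T \<psi>) \<and>
     (\<forall>c. \<forall>\<eta>\<in>schwartz. T (\<lambda>x. c * \<eta> x) = c * T \<eta>) \<and>
     (\<exists>C N. \<forall>\<eta>\<in>schwartz. norm (T \<eta>) \<le> C * schwartz_norm N \<eta>)}"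

text \<open>The identification of a locally integrable function \<open>g\<close> with a distribution \<open>T\<close>.\<close>

definition distribution_given_by ::
    "((real ^ 'n::finite \<Rightarrow> complex) \<Rightarrow> complex) \<Rightarrow> (real ^ 'n \<Rightarrow> complex) \<Rightarrow> bool" where
  "distribution_given_by T g \<longleftrightarrow>
     (\<forall>K. compact K \<longrightarrow> set_integrable lebesgue K g) \<and>
     (\<forall>\<eta>\<in>test_functions. T \<eta> = (LINT x|lebesgue. g x * \<eta> x))"

section \<open>Fourier transform\<close>

definition fourier :: "(real ^ 'n::finite \<Rightarrow> complex) \<Rightarrow> real ^ 'n \<Rightarrow> complex" where
  "fourier f \<xi> =
     of_real ((2 * pi) powr (- real CARD('n) / 2)) * (LINT x|lebesgue. cis (- (x \<bullet> \<xi>)) * f x)"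

definition inv_fourier :: "(real ^ 'n::finite \<Rightarrow> complex) \<Rightarrow> real ^ 'n \<Rightarrow> complex" where
  "inv_fourier f x =
     of_real ((2 * pi) powr (- real CARD('n) / 2)) * (LINT \<xi>|lebesgue. cis (x \<bullet> \<xi>) * f \<xi>)"

text \<open>On tempered distributions, the Fourier transform, its inverse, and multiplication by a
  Schwartz function are defined by duality.\<close>

definition fourier_dist ::
    "((real ^ 'n::finite \<Rightarrow> complex) \<Rightarrow> complex) \<Rightarrow> (real ^ 'n \<Rightarrow> complex) \<Rightarrow> complex" where
  "fourier_dist T \<eta> = T (fourier \<eta>)"

definition inv_fourier_dist ::
    "((real ^ 'n::finite \<Rightarrow> complex) \<Rightarrow> complex) \<Rightarrow> (real ^ 'n \<Rightarrow> complex) \<Rightarrow> complex" where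
  "inv_fourier_dist T \<eta> = T (inv_fourier \<eta>)"

definition mult_dist ::
    "(real ^ 'n::finite \<Rightarrow> complex) \<Rightarrow> ((real ^ 'n \<Rightarrow> complex) \<Rightarrow> complex)
      \<Rightarrow> (real ^ 'n \<Rightarrow> complex) \<Rightarrow> complex" where
  "mult_dist \<psi> T \<eta> = T (\<lambda>x. \<psi> x * \<eta> x)"

section \<open>Morrey spaces\<close>

text \<open>Powers of extended nonnegative reals, for exponents \<open>a > 0\<close>.\<close>

definition epowr :: "ennreal \<Rightarrow> real \<Rightarrow> ennreal" where
  "epowr x a = (if x = \<infinity> then \<infinity> else ennreal (enn2real x powr a))"

definition dyadic_cube :: "int \<Rightarrow> int ^ 'n \<Rightarrow> (real ^ 'n::finite) set" where
  "dyadic_cube j k =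
     (\<lambda>x. 2 powi (- j) *\<^sub>R (x + (\<chi> i. of_int (k $ i)))) ` {x. \<forall>i. 0 \<le> x $ i \<and> x $ i < 1}"

definition dyadic_cubes :: "(real ^ 'n::finite) set set" where
  "dyadic_cubes = {dyadic_cube j k | j k. True}"

definition morrey_norm :: "real \<Rightarrow> real \<Rightarrow> (real ^ 'n::finite \<Rightarrow> complex) \<Rightarrow> ennreal" where
  "morrey_norm u p f =
     (SUP Q\<in>dyadic_cubes. ennreal (measure lebesgue Q powr (1 / u - 1 / p)) *
        epowr (\<integral>\<^sup>+y\<in>Q. ennreal (norm (f y) powr p) \<partial>lebesgue) (1 / p))"

definition morrey_space :: "real \<Rightarrow> real \<Rightarrow> (real ^ 'n::finite \<Rightarrow> complex) set" where
  "morrey_space u p = {f \<in> borel_measurable lebesgue.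
     (\<forall>K. compact K \<longrightarrow> (\<integral>\<^sup>+y\<in>K. ennreal (norm (f y) powr p) \<partial>lebesgue) < \<infinity>) \<and>
     morrey_norm u p f < \<infinity>}"

text \<open>The Morrey norm of a distribution is that of the (almost everywhere unique) function in
  the Morrey space that it is given by; it is \<open>\<infinity>\<close> if there is no such function.\<close>

definition morrey_norm_dist ::
    "real \<Rightarrow> real \<Rightarrow> ((real ^ 'n::finite \<Rightarrow> complex) \<Rightarrow> complex) \<Rightarrow> ennreal" where
  "morrey_norm_dist u p T =
     (INF g \<in> {g \<in> morrey_space u p. distribution_given_by T g}. morrey_norm u p g)"

section \<open>Besov-Morrey spaces\<close>

definition resolution_generator :: "(real ^ 'n::finite \<Rightarrow> complex) \<Rightarrow> bool" where
  "resolution_generator \<phi> \<longleftrightarrow>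
     \<phi> \<in> schwartz \<and> supp \<phi> \<subseteq> {x. norm x \<le> 2} \<and> (\<forall>x. norm x \<le> 1 \<longrightarrow> \<phi> x = 1)"

definition resolution ::
    "(real ^ 'n::finite \<Rightarrow> complex) \<Rightarrow> nat \<Rightarrow> real ^ 'n \<Rightarrow> complex" where
  "resolution \<phi> j x =
     (if j = 0 then \<phi> x
      else \<phi> (2 powi (- int j) *\<^sub>R x) - \<phi> (2 powi (- int j + 1) *\<^sub>R x))"

definition besov_morrey_norm ::
    "(real ^ 'n::finite \<Rightarrow> complex) \<Rightarrow> real \<Rightarrow> real \<Rightarrow> real \<Rightarrow> ennreal
      \<Rightarrow> ((real ^ 'n \<Rightarrow> complex) \<Rightarrow> complex) \<Rightarrow> ennreal" where
  "besov_morrey_norm \<phi> s u p q T =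
     (let A = (\<lambda>j. morrey_norm_dist u p
                     (inv_fourier_dist (mult_dist (resolution \<phi> j) (fourier_dist T))))
      in if q = \<infinity> then (SUP j. ennreal (2 powr (real j * s)) * A j)
         else epowr (\<Sum>j. ennreal (2 powr (real j * s * enn2real q)) * epowr (A j) (enn2real q))
                (1 / enn2real q))"

definition besov_morrey_space ::
    "(real ^ 'n::finite \<Rightarrow> complex) \<Rightarrow> real \<Rightarrow> real \<Rightarrow> real \<Rightarrow> ennreal
      \<Rightarrow> ((real ^ 'n \<Rightarrow> complex) \<Rightarrow> complex) set" where
  "besov_morrey_space \<phi> s u p q =
     {T \<in> tempered_distributions. besov_morrey_norm \<phi> s u p q T < \<infinity>}"

section \<open>Orlicz-Morrey spaces\<close>

definition orlicz_cube_norm ::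
    "real \<Rightarrow> (real \<Rightarrow> real) \<Rightarrow> (real ^ 'n::finite) set \<Rightarrow> (real ^ 'n \<Rightarrow> complex) \<Rightarrow> ennreal" where
  "orlicz_cube_norm r \<Phi> Q f =
     (INF l \<in> {l::real. l > 0 \<and> ennreal (measure lebesgue Q powr (1 / r - 1)) *
                 (\<integral>\<^sup>+x\<in>Q. ennreal (\<Phi> (norm (f x) / l)) \<partial>lebesgue) \<le> 1}. ennreal l)"

definition orlicz_morrey_norm ::
    "real \<Rightarrow> (real \<Rightarrow> real) \<Rightarrow> (real ^ 'n::finite \<Rightarrow> complex) \<Rightarrow> ennreal" where
  "orlicz_morrey_norm r \<Phi> f = (SUP Q\<in>dyadic_cubes. orlicz_cube_norm r \<Phi> Q f)"

definition orlicz_morrey_space ::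
    "real \<Rightarrow> (real \<Rightarrow> real) \<Rightarrow> (real ^ 'n::finite \<Rightarrow> complex) set" where
  "orlicz_morrey_space r \<Phi> =
     {f \<in> borel_measurable lebesgue. orlicz_morrey_norm r \<Phi> f < \<infinity>}"

definition Phi_exp :: "real \<Rightarrow> real \<Rightarrow> real \<Rightarrow> real" where
  "Phi_exp p q t = t powr p * exp (t powr q)"

section \<open>Continuous embedding of a space of distributions into a space of functions\<close>

definition continuously_embedded ::
    "((real ^ 'n::finite \<Rightarrow> complex) \<Rightarrow> complex) set
      \<Rightarrow> (((real ^ 'n \<Rightarrow> complex) \<Rightarrow> complex) \<Rightarrow> ennreal)
      \<Rightarrow> (real ^ 'n \<Rightarrow> complex) set \<Rightarrow> ((real ^ 'n \<Rightarrow> complex) \<Rightarrow> ennreal) \<Rightarrow> bool" where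
  "continuously_embedded X norm_X Y norm_Y \<longleftrightarrow>
     (\<exists>C::real. \<forall>T\<in>X. \<exists>g\<in>Y. distribution_given_by T g \<and> norm_Y g \<le> ennreal C * norm_X T)"

end

(* Let T_j be the dyadic blocks of T. Each T_j is a continuous function G_j of polynomial growth,
   and G_j is reproduced by convolution with a dilate of one Schwartz kernel. Summing |G_j|^p over
   the cubes of side 2^-j gives the Nikolskii inequality |G_j| <= C a_j, a_j = 2^(jd/u) |G_j|_{M_{u,p}};
   for p < 1 one writes |G_j| = |G_j|^p |G_j|^(1-p) and first removes the polynomial growth with
   a weight (1 + e|y|)^-M, e -> 0.

   Normalise |(a_j)|_q = 1. Put theta = 2^(dp/(2u)) and S = sum_j theta^j |G_j|^p. Up to a constant,
   the integral of S over a cube Q is at most |Q|^(1-p/u), since theta^j 2^(-jdp/u) = theta^-j is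
   summable. Pointwise, Phi_{p,q'}(sum_j |G_j| / l) <= eps S for l large: Hoelder bounds the first
   N terms of the sum by N^(1/q'), the rest is a geometric tail of size S^(1/p) theta^(-N/p), and
   N ~ log S makes the exponential a small power of S. Integrating over Q gives the theorem for
   g = sum_j G_j; no power series of the exponential and no Minkowski inequality are needed, so all
   p > 0 are treated alike.

   The Fourier inversion formula is only needed, and only proved, up to a nonzero constant: it comes
   from regularising with the generator of the resolution of unity instead of a Gaussian. *)

theory Submission
  imports Defs
begin

section \<open>Smooth functions and Schwartz functions\<close>

text \<open>A tempered distribution is known only through its values on Schwartz functions, so the
  analysis rests on one exchange: T of an integral of translates is the integral of T of the
  translates. It shows both that the blocks are given by functions and that these reproduce
  themselves. The Morrey norm of a distribution is an infimum over representing functions;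
  uniqueness almost everywhere transfers it to the continuous one. The factor \<theta> serves two
  opposite ends: \<theta> > 1 makes a finite value of S force geometric decay of |G_j|, while
  \<theta> < 2^(dp/u) keeps the integral of S over a cube finite; the chosen value is the geometric
  mean of the two limits. The set where S is infinite is null, and off it the series converges
  absolutely. That the blocks add up to T, up to the constant, comes from telescoping: the pieces up
  to N sum to \<phi>(2^-N x), so the partial sums act on a test function as an approximate identity.
  The constant is carried along as a divisor of g; by the exact inversion formula its value is
  1.\<close>

lemma iter_partial_deriv_append:
  "iter_partial_deriv (is @ js) f = iter_partial_deriv is (iter_partial_deriv js f)"
  by (induction "is") auto

lemma smooth_iter: "smooth f \<Longrightarrow> smooth (iter_partial_deriv js f)"
  unfolding smooth_def by (metis iter_partial_deriv_append)

lemma smooth_partial: "smooth f \<Longrightarrow> smooth (partial_deriv i f)"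
  using smooth_iter[of f "[i]"] by simp

lemma smooth_differentiable: "smooth f \<Longrightarrow> f differentiable (at x)"
  unfolding smooth_def by (metis iter_partial_deriv.simps(1))

lemma partial_deriv_eqI:
  "(f has_derivative D) (at x) \<Longrightarrow> partial_deriv i f x = D (axis i 1)"
  unfolding partial_deriv_def using frechet_derivative_at by metis

lemma differentiable_has_derivative_partials:
  fixes f :: "real ^ 'n::finite \<Rightarrow> complex"
  assumes "f differentiable (at x)"
  shows "(f has_derivative (\<lambda>h. \<Sum>i\<in>UNIV. h $ i *\<^sub>R partial_deriv i f x)) (at x)"
proof -
  let ?D = "frechet_derivative f (at x)"
  have D: "(f has_derivative ?D) (at x)"
    using assms frechet_derivative_works by blast
  then interpret linear ?D by (rule has_derivative_linear)
  have "?D h = (\<Sum>i\<in>UNIV. h $ i *\<^sub>R partial_deriv i f x)" for h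
  proof -
    have "h = (\<Sum>i\<in>UNIV. h $ i *\<^sub>R axis i 1)"
      by (subst basis_expansion[symmetric]) (simp add: scalar_mult_eq_scaleR)
    then have "?D h = ?D (\<Sum>i\<in>UNIV. h $ i *\<^sub>R axis i 1)" by simp
    then show ?thesis by (simp add: sum scaleR partial_deriv_def)
  qed
  then have "?D = (\<lambda>h. \<Sum>i\<in>UNIV. h $ i *\<^sub>R partial_deriv i f x)" by (rule ext)
  with D show ?thesis by simp
qed

lemma sum_axis_scaleR: "(\<Sum>j\<in>UNIV. axis i (1::real) $ j *\<^sub>R c j) = (c i :: 'a::real_vector)"
proof -
  have "(\<Sum>j\<in>UNIV. axis i (1::real) $ j *\<^sub>R c j) = (\<Sum>j\<in>UNIV. if j = i then c j else 0)"
    by (rule sum.cong) (auto simp: axis_def)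
  then show ?thesis by simp
qed

text \<open>An integral can be differentiated by integrating a second-order pointwise estimate. This
  criterion replaces differentiation under the integral sign, both for superpositions of translates
  and for the Fourier transform.\<close>

lemma has_derivative_if_quadratic_remainder:
  fixes F :: "'a::real_normed_vector \<Rightarrow> 'b::real_normed_vector"
  assumes "bounded_linear D" "\<And>h. norm (F (x + h) - F x - D h) \<le> C * (norm h)\<^sup>2"
  shows "(F has_derivative D) (at x)"
proof (rule has_derivativeI_sandwich[of 1 _ _ _ _ "\<lambda>y. C * norm (y - x)"])
  show "norm (F y - F x - D (y - x)) / norm (y - x) \<le> C * norm (y - x)" if "y \<noteq> x" for y
    using assms(2)[of "y - x"] that by (simp add: field_simps power2_eq_square)
  show "((\<lambda>y. C * norm (y - x)) \<longlongrightarrow> 0) (at x)"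
    by (rule tendsto_eq_intros refl | simp)+
qed (simp_all add: assms(1))

lemma smooth_has_derivative:
  fixes f :: "real ^ 'n::finite \<Rightarrow> complex"
  assumes "smooth f"
  shows "(f has_derivative (\<lambda>h. \<Sum>i\<in>UNIV. h $ i *\<^sub>R partial_deriv i f x)) (at x within S)"
  using differentiable_has_derivative_partials[OF smooth_differentiable[OF assms]]
    has_derivative_at_withinI by blast

lemma smooth_continuous: "smooth f \<Longrightarrow> continuous_on S f"
  by (meson continuous_at_imp_continuous_on differentiable_imp_continuous_within
      smooth_differentiable)

lemma smooth_borel: "smooth f \<Longrightarrow> f \<in> borel_measurable borel"
  using borel_measurable_continuous_onI smooth_continuous by blast

text \<open>Smooth functions form the largest class of differentiable functions closed under partial
  derivatives. Smoothness can thus be shown by exhibiting an invariant class, without a formula for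
  the iterated derivatives.\<close>

lemma smooth_coinduct:
  assumes "P f" "\<And>f x. P f \<Longrightarrow> f differentiable (at x)" "\<And>f i. P f \<Longrightarrow> P (partial_deriv i f)"
  shows "smooth f"
proof -
  have "P (iter_partial_deriv is f)" for "is"
    by (induction "is") (auto simp: assms)
  then show ?thesis unfolding smooth_def using assms(2) by blast
qed

lemma partial_deriv_lincomb:
  assumes "f differentiable (at x)" "g differentiable (at x)"
  shows "partial_deriv i (\<lambda>x. a * f x + b * g x) x = a * partial_deriv i f x + b * partial_deriv i g x"
  using assms[unfolded frechet_derivative_works]
  by (subst partial_deriv_eqI) (auto intro!: derivative_eq_intros simp: partial_deriv_def)

lemma iter_partial_deriv_lincomb:
  assumes "smooth f" "smooth g"
  shows "iter_partial_deriv is (\<lambda>x. a * f x + b * g x) =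
    (\<lambda>x. a * iter_partial_deriv is f x + b * iter_partial_deriv is g x)"
proof (induction "is")
  case (Cons i "is")
  show ?case
    by (simp add: Cons fun_eq_iff
        partial_deriv_lincomb[OF assms[THEN smooth_iter, THEN smooth_differentiable]])
qed auto

lemma smooth_lincomb:
  assumes "smooth f" "smooth g"
  shows "smooth (\<lambda>x. a * f x + b * g x)"
  unfolding smooth_def iter_partial_deriv_lincomb[OF assms]
  using assms[THEN smooth_iter, THEN smooth_differentiable]
  by (auto intro!: derivative_intros)

lemma iter_partial_deriv_affine:
  fixes f :: "real ^ 'n::finite \<Rightarrow> complex"
  assumes "smooth f"
  shows "iter_partial_deriv is (\<lambda>x. f (a *\<^sub>R x - z)) =
    (\<lambda>x. of_real (a ^ length is) * iter_partial_deriv is f (a *\<^sub>R x - z))"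
proof (induction "is")
  case (Cons i "is")
  let ?g = "iter_partial_deriv is f"
  have g: "(?g has_derivative (\<lambda>h. \<Sum>i\<in>UNIV. h $ i *\<^sub>R partial_deriv i ?g y)) (at y)" for y
    by (rule smooth_has_derivative) (rule smooth_iter[OF assms])
  have d: "((\<lambda>x. of_real (a ^ length is) * ?g (a *\<^sub>R x - z)) has_derivative
      (\<lambda>h. of_real (a ^ length is) * (\<Sum>i\<in>UNIV. (a *\<^sub>R h) $ i *\<^sub>R partial_deriv i ?g (a *\<^sub>R x - z)))) (at x)" for x
    by (rule has_derivative_compose[OF _ g, of "\<lambda>x. a *\<^sub>R x - z" "\<lambda>h. a *\<^sub>R h", THEN has_derivative_mult_right])
      (auto intro!: derivative_eq_intros)
  have "partial_deriv i (\<lambda>x. of_real (a ^ length is) * ?g (a *\<^sub>R x - z)) x =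
      of_real (a ^ Suc (length is)) * partial_deriv i ?g (a *\<^sub>R x - z)" for x
  proof -
    have "(\<Sum>j\<in>UNIV. (a *\<^sub>R axis i (1::real)) $ j *\<^sub>R partial_deriv j ?g (a *\<^sub>R x - z))
       = (\<Sum>j\<in>UNIV. if j = i then a *\<^sub>R partial_deriv j ?g (a *\<^sub>R x - z) else 0)"
      by (rule sum.cong) (auto simp: axis_def)
    then show ?thesis
      by (subst partial_deriv_eqI[OF d]) (simp add: scaleR_conv_of_real mult_ac)
  qed
  then show ?case by (simp add: Cons fun_eq_iff)
qed auto

lemma smooth_affine:
  fixes f :: "real ^ 'n::finite \<Rightarrow> complex"
  assumes "smooth f"
  shows "smooth (\<lambda>x. f (a *\<^sub>R x - z))"
  unfolding smooth_def iter_partial_deriv_affine[OF assms]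
proof (intro allI)
  fix "is" x
  have "(\<lambda>x. iter_partial_deriv is f (a *\<^sub>R x - z)) differentiable at x"
    using differentiable_compose[of "iter_partial_deriv is f" "\<lambda>x. a *\<^sub>R x - z"]
      smooth_differentiable[OF smooth_iter[OF assms]] by simp
  then show "(\<lambda>x. of_real (a ^ length is) * iter_partial_deriv is f (a *\<^sub>R x - z)) differentiable at x"
    by simp
qed

lemma iter_partial_deriv_cnj:
  assumes "smooth f"
  shows "iter_partial_deriv is (\<lambda>x. cnj (f x)) = (\<lambda>x. cnj (iter_partial_deriv is f x))"
proof (induction "is")
  case (Cons i "is")
  have "partial_deriv i (\<lambda>x. cnj (iter_partial_deriv is f x)) x = cnj (partial_deriv i (iter_partial_deriv is f) x)" for x
    using smooth_differentiable[OF smooth_iter[OF assms], of "is" x]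
    unfolding frechet_derivative_works partial_deriv_def[of i "iter_partial_deriv is f"]
    by (intro partial_deriv_eqI[OF has_derivative_cnj])
  with Cons show ?case by auto
qed auto

lemma smooth_cnj:
  assumes "smooth f"
  shows "smooth (\<lambda>x. cnj (f x))"
proof -
  have "(\<lambda>x. cnj (iter_partial_deriv is f x)) differentiable at x" for "is" x
    using smooth_differentiable[OF smooth_iter[OF assms], of "is" x] has_derivative_cnj
    unfolding differentiable_def by blast
  then show ?thesis unfolding smooth_def iter_partial_deriv_cnj[OF assms] by blast
qed

lemma smooth_const: "smooth (\<lambda>x. c)"
proof (rule smooth_coinduct[of "\<lambda>f. \<exists>c. f = (\<lambda>x. c)"])
  fix f :: "real^'n \<Rightarrow> complex" and i assume "\<exists>c. f = (\<lambda>x. c)"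
  then have "partial_deriv i f = (\<lambda>x. 0)"
    by (auto simp: fun_eq_iff intro!: partial_deriv_eqI)
  then show "\<exists>c. partial_deriv i f = (\<lambda>x. c)" by blast
qed auto

lemma smooth_coordinate:
  fixes i :: "'n::finite"
  shows "smooth (\<lambda>x. of_real (x $ i))"
\<comment> \<open>Coinduction up to smoothness: one differentiation turns the coordinate into a
  constant, already known to be smooth.\<close>
proof (rule smooth_coinduct[of "\<lambda>f. f = (\<lambda>x. of_real (x $ i)) \<or> smooth f"])
  have d: "((\<lambda>x. of_real (x $ i)) has_derivative (\<lambda>h. of_real (h $ i))) (at x)" for x :: "real^'n"
    by (intro bounded_linear.has_derivative[OF bounded_linear_of_real]
        bounded_linear.has_derivative[OF bounded_linear_vec_nth] has_derivative_ident)
  show "f differentiable at x" if "f = (\<lambda>x. of_real (x $ i)) \<or> smooth f" for f :: "real^'n \<Rightarrow> complex" and x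
    using that d smooth_differentiable unfolding differentiable_def by metis
  show "partial_deriv j f = (\<lambda>x. of_real (x $ i)) \<or> smooth (partial_deriv j f)"
    if "f = (\<lambda>x. of_real (x $ i)) \<or> smooth f" for f :: "real^'n \<Rightarrow> complex" and j
  proof (cases "smooth f")
    case False
    with that have "partial_deriv j f = (\<lambda>x. of_real (axis j 1 $ i))"
      using partial_deriv_eqI[OF d] by auto
    then show ?thesis using smooth_const by metis
  qed (simp add: smooth_partial)
qed auto

text \<open>The invariant class for products. The product rule leads from one product to a sum of
  two, so sums must belong to the class as well; its closure under differentiation is then a single
  use of the Leibniz rule.\<close>

inductive smooth_ring :: "(real ^ 'n::finite \<Rightarrow> complex) \<Rightarrow> bool" where
  base: "smooth f \<Longrightarrow> smooth_ring f"
| add: "smooth_ring f \<Longrightarrow> smooth_ring g \<Longrightarrow> smooth_ring (\<lambda>x. f x + g x)"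
| mult: "smooth_ring f \<Longrightarrow> smooth_ring g \<Longrightarrow> smooth_ring (\<lambda>x. f x * g x)"

lemma smooth_ring_deriv:
  "smooth_ring f \<Longrightarrow> (\<forall>x. f differentiable (at x)) \<and> (\<forall>i. smooth_ring (partial_deriv i f))"
proof (induction rule: smooth_ring.induct)
  case (base f)
  then show ?case by (simp add: smooth_differentiable smooth_partial smooth_ring.base)
next
  case (add f g)
  then have "partial_deriv i (\<lambda>x. f x + g x) = (\<lambda>x. partial_deriv i f x + partial_deriv i g x)" for i
    using partial_deriv_lincomb[of f _ g i 1 1] by auto
  with add show ?case by (auto intro: smooth_ring.intros)
next
  case (mult f g)
  have "partial_deriv i (\<lambda>x. f x * g x) x = f x * partial_deriv i g x + partial_deriv i f x * g x" for i x
    unfolding partial_deriv_def[of i f] partial_deriv_def[of i g]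
    using mult[unfolded frechet_derivative_works]
    by (intro partial_deriv_eqI[OF has_derivative_mult]) auto
  then have "partial_deriv i (\<lambda>x. f x * g x) = (\<lambda>x. f x * partial_deriv i g x + partial_deriv i f x * g x)" for i
    by auto
  moreover have "smooth_ring (\<lambda>x. f x * partial_deriv i g x + partial_deriv i f x * g x)" for i
    by (rule smooth_ring.add; rule smooth_ring.mult) (use mult in auto)
  ultimately show ?case using mult by auto
qed

lemma smooth_mult: "smooth f \<Longrightarrow> smooth g \<Longrightarrow> smooth (\<lambda>x. f x * g x)"
  by (rule smooth_coinduct[of smooth_ring]) (auto intro: smooth_ring.intros dest: smooth_ring_deriv)

section \<open>Supports and test functions\<close>

lemma zero_outside_supp: "x \<notin> supp f \<Longrightarrow> f x = 0"
  using closure_subset[of "{x. f x \<noteq> 0}"] by (auto simp: supp_def)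

lemma supp_partial: "supp (partial_deriv i f) \<subseteq> supp f"
proof -
  have "partial_deriv i f x = 0" if "x \<notin> supp f" for x
  proof -
    have o: "open (- supp f)" by (simp add: supp_def open_closed)
    have "(f has_derivative (\<lambda>h. 0)) (at x)"
      by (rule has_derivative_transform_within_open[OF has_derivative_const o])
        (use that zero_outside_supp[of _ f] in auto)
    from partial_deriv_eqI[OF this] show ?thesis .
  qed
  then have "{x. partial_deriv i f x \<noteq> 0} \<subseteq> supp f" by blast
  then show ?thesis unfolding supp_def[of "partial_deriv i f"]
    by (rule closure_minimal) (simp add: supp_def)
qed

lemma compact_supp_subset:
  assumes "compact (supp f)" "{x. g x \<noteq> 0} \<subseteq> supp f"
  shows "compact (supp g)"
proof -
  have "supp g \<subseteq> supp f"
    unfolding supp_def[of g] using assms(2) by (rule closure_minimal) (simp add: supp_def)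
  moreover have "closed (supp g)" by (simp add: supp_def)
  ultimately show ?thesis using assms(1) compact_Int_closed[of "supp f" "supp g"] by (simp add: Int_absorb1)
qed

lemma test_smooth: "f \<in> test_functions \<Longrightarrow> smooth f"
  by (simp add: test_functions_def)

lemma test_partial: "f \<in> test_functions \<Longrightarrow> partial_deriv i f \<in> test_functions"
  using supp_partial[of i f] closure_subset[of "{x. partial_deriv i f x \<noteq> 0}"]
    compact_supp_subset[of f "partial_deriv i f"]
  unfolding test_functions_def supp_def[of "partial_deriv i f"]
  by (simp add: smooth_partial subset_trans supp_def)

lemma test_iter: "f \<in> test_functions \<Longrightarrow> iter_partial_deriv is f \<in> test_functions"
  by (induction "is") (auto simp: test_partial)

lemma test_mult: "smooth g \<Longrightarrow> f \<in> test_functions \<Longrightarrow> (\<lambda>x. g x * f x) \<in> test_functions"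
  using compact_supp_subset[of f "\<lambda>x. g x * f x"] zero_outside_supp[of _ f]
  by (auto simp: test_functions_def smooth_mult)

lemma test_vanish:
  assumes "f \<in> test_functions"
  obtains R where "R > 0" "\<And>x. norm x > R \<Longrightarrow> f x = 0"
proof -
  have "bounded (supp f)" using assms by (simp add: test_functions_def compact_imp_bounded)
  then obtain R where "R > 0" "\<And>x. x \<in> supp f \<Longrightarrow> norm x \<le> R" unfolding bounded_pos by blast
  then show ?thesis using that[of R] zero_outside_supp[of _ f] by (meson not_less)
qed

lemma testI:
  assumes "smooth f" "\<And>x. norm x > R \<Longrightarrow> f x = 0"
  shows "f \<in> test_functions"
proof -
  have "supp f \<subseteq> cball 0 R"
    unfolding supp_def using assms(2) by (intro closure_minimal subsetI) (auto intro: leI)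
  then have "compact (supp f)"
    by (metis bounded_cball bounded_subset closed_closure compact_eq_bounded_closed supp_def)
  with assms show ?thesis by (simp add: test_functions_def)
qed

lemma test_bounded:
  assumes "f \<in> test_functions"
  shows "bounded (range (\<lambda>x. (1 + norm x) ^ N * norm (f x)))"
proof -
  let ?g = "\<lambda>x. (1 + norm x) ^ N * norm (f x)"
  obtain R where R: "\<And>x. norm x > R \<Longrightarrow> f x = 0" using test_vanish[OF assms] by metis
  have "compact (?g ` cball 0 R)"
    by (intro compact_continuous_image continuous_intros smooth_continuous test_smooth[OF assms]) simp
  then have "bounded (insert 0 (?g ` cball 0 R))" by (simp add: compact_imp_bounded)
  moreover have "?g x \<in> insert 0 (?g ` cball 0 R)" for x
    using R[of x] by (cases "norm x > R") auto
  ultimately show ?thesis by (rule bounded_subset[OF _ image_subsetI])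
qed

lemma test_schwartz: "f \<in> test_functions \<Longrightarrow> f \<in> schwartz"
  unfolding schwartz_def using test_iter test_bounded test_smooth by blast

section \<open>Schwartz functions and polynomial weights\<close>

lemma schwartz_smooth: "f \<in> schwartz \<Longrightarrow> smooth f"
  by (simp add: schwartz_def)

lemma schwartz_bound:
  assumes "f \<in> schwartz"
  obtains C where "C \<ge> 0" "\<And>x. (1 + norm x) ^ N * norm (iter_partial_deriv is f x) \<le> C"
proof -
  have "bounded (range (\<lambda>x. (1 + norm x) ^ N * norm (iter_partial_deriv is f x)))"
    using assms by (simp add: schwartz_def)
  then obtain C where C: "\<And>x. norm ((1 + norm x) ^ N * norm (iter_partial_deriv is f x)) \<le> C"
    unfolding bounded_iff by blast
  have "(1 + norm x) ^ N * norm (iter_partial_deriv is f x) \<le> C" for x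
    using C[of x] by simp
  moreover from C[of 0] have "C \<ge> 0" by (meson norm_ge_zero order_trans)
  ultimately show ?thesis using that by blast
qed

lemma schwartz_bound0:
  assumes "f \<in> schwartz"
  obtains C where "C \<ge> 0" "\<And>x. (1 + norm x) ^ N * norm (f x) \<le> C"
  using schwartz_bound[OF assms, of N "[]"] by auto

lemma schwartzI:
  assumes "smooth f" "\<And>N is. \<exists>C. \<forall>x. (1 + norm x) ^ N * norm (iter_partial_deriv is f x) \<le> C"
  shows "f \<in> schwartz"
proof -
  have "bounded (range (\<lambda>x. (1 + norm x) ^ N * norm (iter_partial_deriv is f x)))" for N "is"
  proof -
    obtain C where "\<forall>x. (1 + norm x) ^ N * norm (iter_partial_deriv is f x) \<le> C"
      using assms(2) by metis
    then show ?thesis by (intro boundedI[of _ C]) (auto simp: abs_mult)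
  qed
  with assms(1) show ?thesis by (simp add: schwartz_def)
qed

lemma schwartz_iter: "f \<in> schwartz \<Longrightarrow> iter_partial_deriv is f \<in> schwartz"
  unfolding schwartz_def by (simp add: smooth_iter iter_partial_deriv_append[symmetric])

lemma schwartz_partial: "f \<in> schwartz \<Longrightarrow> partial_deriv i f \<in> schwartz"
  using schwartz_iter[of f "[i]"] by simp

lemma schwartz_lincomb:
  assumes "f \<in> schwartz" "g \<in> schwartz"
  shows "(\<lambda>x. a * f x + b * g x) \<in> schwartz"
proof (rule schwartzI)
  show "smooth (\<lambda>x. a * f x + b * g x)" using assms by (simp add: schwartz_smooth smooth_lincomb)
  fix N "is"
  obtain C where C: "\<And>x. (1 + norm x) ^ N * norm (iter_partial_deriv is f x) \<le> C" using schwartz_bound[OF assms(1)] by metis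
  obtain D where D: "\<And>x. (1 + norm x) ^ N * norm (iter_partial_deriv is g x) \<le> D" using schwartz_bound[OF assms(2)] by metis
  have "(1 + norm x) ^ N * norm (iter_partial_deriv is (\<lambda>x. a * f x + b * g x) x) \<le> norm a * C + norm b * D" for x
  proof -
    have "norm (iter_partial_deriv is (\<lambda>x. a * f x + b * g x) x) \<le>
      norm a * norm (iter_partial_deriv is f x) + norm b * norm (iter_partial_deriv is g x)"
      unfolding iter_partial_deriv_lincomb[OF assms[THEN schwartz_smooth]]
      by (metis norm_mult norm_triangle_ineq)
    then have "(1 + norm x) ^ N * norm (iter_partial_deriv is (\<lambda>x. a * f x + b * g x) x) \<le>
      (1 + norm x) ^ N * (norm a * norm (iter_partial_deriv is f x) + norm b * norm (iter_partial_deriv is g x))"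
      by (intro mult_left_mono) auto
    also have "\<dots> = norm a * ((1 + norm x) ^ N * norm (iter_partial_deriv is f x)) + norm b * ((1 + norm x) ^ N * norm (iter_partial_deriv is g x))"
      by (simp add: algebra_simps)
    also have "\<dots> \<le> norm a * C + norm b * D"
      using C D by (intro add_mono mult_left_mono) auto
    finally show ?thesis .
  qed
  then show "\<exists>C. \<forall>x. (1 + norm x) ^ N * norm (iter_partial_deriv is (\<lambda>x. a * f x + b * g x) x) \<le> C" by blast
qed

lemma schwartz_cmult: "f \<in> schwartz \<Longrightarrow> (\<lambda>x. a * f x) \<in> schwartz"
  using schwartz_lincomb[of f f a 0] by simp

lemma schwartz_add: "f \<in> schwartz \<Longrightarrow> g \<in> schwartz \<Longrightarrow> (\<lambda>x. f x + g x) \<in> schwartz"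
  using schwartz_lincomb[of f g 1 1] by simp

lemma schwartz_diff: "f \<in> schwartz \<Longrightarrow> g \<in> schwartz \<Longrightarrow> (\<lambda>x. f x - g x) \<in> schwartz"
  using schwartz_lincomb[of f g 1 "-1"] by simp

text \<open>Peetre's inequality for the weight 1 + |x|. Its submultiplicativity moves a polynomial
  weight from the argument of a translate to the translation vector in all later estimates of
  convolutions.\<close>

lemma one_plus_norm_triangle:
  fixes x y :: "'a::real_normed_vector"
  shows "1 + norm x \<le> (1 + norm (x - y)) * (1 + norm y)"
proof -
  have "norm x \<le> norm (x - y) + norm y" using norm_triangle_ineq[of "x - y" y] by simp
  moreover have "0 \<le> norm (x - y) * norm y" by simp
  ultimately show ?thesis unfolding distrib_left distrib_right by linarith
qed

lemma one_plus_norm_triangle_power: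
  fixes x y :: "'a::real_normed_vector"
  shows "(1 + norm x) ^ N \<le> (1 + norm (x - y)) ^ N * (1 + norm y) ^ N"
  using power_mono[OF one_plus_norm_triangle[of x y], of N] by (simp add: power_mult_distrib)

lemma schwartz_affine:
  fixes f :: "real ^ 'n::finite \<Rightarrow> complex"
  assumes "f \<in> schwartz" "a \<noteq> 0"
  shows "(\<lambda>x. f (a *\<^sub>R x - z)) \<in> schwartz"
proof (rule schwartzI)
  show "smooth (\<lambda>x. f (a *\<^sub>R x - z))" using assms by (simp add: schwartz_smooth smooth_affine)
  fix N "is"
  obtain C where C: "\<And>x. (1 + norm x) ^ N * norm (iter_partial_deriv is f x) \<le> C"
    using schwartz_bound[OF assms(1)] by metis
  \<comment> \<open>The first factor pays for the dilation, the second for the translation.\<close>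
  define B where "B = (1 + 1 / \<bar>a\<bar>) ^ N * (1 + norm z) ^ N"
  have B: "B \<ge> 0" unfolding B_def by simp
  have "(1 + norm x) ^ N * norm (iter_partial_deriv is (\<lambda>x. f (a *\<^sub>R x - z)) x)
      \<le> \<bar>a ^ length is\<bar> * (B * C)" for x
  proof -
    have "1 + norm x \<le> (1 + 1 / \<bar>a\<bar>) * (1 + norm (a *\<^sub>R x))"
      using assms(2) by (simp add: field_simps)
    then have "(1 + norm x) ^ N \<le> ((1 + 1 / \<bar>a\<bar>) * (1 + norm (a *\<^sub>R x))) ^ N"
      by (rule power_mono) simp
    also have "\<dots> = (1 + 1 / \<bar>a\<bar>) ^ N * (1 + norm (a *\<^sub>R x)) ^ N" by (simp add: power_mult_distrib)
    also have "\<dots> \<le> (1 + 1 / \<bar>a\<bar>) ^ N * ((1 + norm (a *\<^sub>R x - z)) ^ N * (1 + norm z) ^ N)"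
      by (intro mult_left_mono one_plus_norm_triangle_power) simp
    finally have "(1 + norm x) ^ N \<le> B * (1 + norm (a *\<^sub>R x - z)) ^ N"
      unfolding B_def by (simp add: mult_ac)
    then have "(1 + norm x) ^ N * norm (iter_partial_deriv is f (a *\<^sub>R x - z)) \<le>
       B * (1 + norm (a *\<^sub>R x - z)) ^ N * norm (iter_partial_deriv is f (a *\<^sub>R x - z))"
      by (rule mult_right_mono) simp
    also have "\<dots> \<le> B * C" using C B by (simp add: mult.assoc mult_left_mono)
    finally have "\<bar>a ^ length is\<bar> * ((1 + norm x) ^ N * norm (iter_partial_deriv is f (a *\<^sub>R x - z)))
        \<le> \<bar>a ^ length is\<bar> * (B * C)" by (rule mult_left_mono) simp
    then show ?thesis
      unfolding iter_partial_deriv_affine[OF schwartz_smooth[OF assms(1)]]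
      by (simp add: norm_mult mult_ac norm_power power_abs)
  qed
  then show "\<exists>C. \<forall>x. (1 + norm x) ^ N * norm (iter_partial_deriv is (\<lambda>x. f (a *\<^sub>R x - z)) x) \<le> C" by blast
qed

lemma schwartz_translate: "f \<in> schwartz \<Longrightarrow> (\<lambda>x. f (x - z)) \<in> schwartz"
  using schwartz_affine[of f 1 z] by simp

lemma iter_partial_deriv_translate:
  "smooth f \<Longrightarrow> iter_partial_deriv is (\<lambda>x. f (x - z)) = (\<lambda>x. iter_partial_deriv is f (x - z))"
  using iter_partial_deriv_affine[of f "is" 1 z] by simp

lemma test_affine:
  fixes f :: "real ^ 'n::finite \<Rightarrow> complex"
  assumes "f \<in> test_functions" "a \<noteq> 0"
  shows "(\<lambda>x. f (a *\<^sub>R x - z)) \<in> test_functions"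
proof -
  obtain R where R: "\<And>x. norm x > R \<Longrightarrow> f x = 0" using test_vanish[OF assms(1)] by metis
  show ?thesis
  proof (rule testI)
    show "smooth (\<lambda>x. f (a *\<^sub>R x - z))" using assms by (simp add: test_smooth smooth_affine)
    fix x :: "real ^ 'n" assume "norm x > (R + norm z) / \<bar>a\<bar>"
    then have "norm (a *\<^sub>R x) > R + norm z" using assms(2) by (simp add: field_simps)
    then have "norm (a *\<^sub>R x - z) > R" using norm_triangle_ineq2[of "a *\<^sub>R x" z] by simp
    then show "f (a *\<^sub>R x - z) = 0" by (rule R)
  qed
qed

section \<open>Superpositions of translates\<close>

lemma onorm_partials_le:
  fixes c :: "'n::finite \<Rightarrow> complex"
  shows "onorm (\<lambda>h :: real ^ 'n. \<Sum>i\<in>UNIV. h $ i *\<^sub>R c i) \<le> (\<Sum>i\<in>UNIV. norm (c i))"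
proof (rule onorm_le)
  fix h :: "real ^ 'n"
  have "norm (\<Sum>i\<in>UNIV. h $ i *\<^sub>R c i) \<le> (\<Sum>i\<in>UNIV. norm h * norm (c i))"
    by (rule order_trans[OF norm_sum sum_mono]) (simp add: component_le_norm_cart mult_right_mono)
  also have "\<dots> = (\<Sum>i\<in>UNIV. norm (c i)) * norm h"
    by (simp add: sum_distrib_left[symmetric] mult.commute)
  finally show "norm (\<Sum>i\<in>UNIV. h $ i *\<^sub>R c i) \<le> (\<Sum>i\<in>UNIV. norm (c i)) * norm h" .
qed

text \<open>Mean value theorem on the segment from x - z to x - z'. A point y of the segment
  satisfies |x - y| \<le> |z| + |z'|, so the weight at x is at most the weight at y, absorbed by the
  decay of the gradient, times a power of 1 + |z| + |z'|. Uniformity in x makes translation locally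
  Lipschitz in every Schwartz norm.\<close>

lemma schwartz_translate_lipschitz:
  fixes \<kappa> :: "real ^ 'n::finite \<Rightarrow> complex"
  assumes "\<kappa> \<in> schwartz"
  shows "\<exists>C\<ge>0. \<forall>x z z'. (1 + norm x) ^ N * norm (\<kappa> (x - z) - \<kappa> (x - z')) \<le>
     C * (norm (z - z') * (1 + norm z + norm z') ^ N)"
proof -
  have "\<forall>i. \<exists>C. C \<ge> 0 \<and> (\<forall>x. (1 + norm x) ^ N * norm (partial_deriv i \<kappa> x) \<le> C)"
    using schwartz_bound0[OF schwartz_partial[OF assms]] by metis
  then obtain c where c: "\<And>i. c i \<ge> 0" "\<And>i x. (1 + norm x) ^ N * norm (partial_deriv i \<kappa> x) \<le> c i"
    by metis
  define C where "C = (\<Sum>i\<in>UNIV. c i)"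
  have C0: "C \<ge> 0" unfolding C_def using c by (simp add: sum_nonneg)
  have C: "(1 + norm x) ^ N * (\<Sum>i\<in>UNIV. norm (partial_deriv i \<kappa> x)) \<le> C" for x
    unfolding C_def sum_distrib_left using c by (simp add: sum_mono)
  have "(1 + norm x) ^ N * norm (\<kappa> (x - z) - \<kappa> (x - z')) \<le>
     C * (norm (z - z') * (1 + norm z + norm z') ^ N)" for x z z'
  proof -
    define S where "S = closed_segment (x - z) (x - z')"
    define B where "B = C * (1 + norm z + norm z') ^ N / (1 + norm x) ^ N"
    have pos: "(1 + norm y) ^ N > 0" for y :: "real ^ 'n"
      using norm_ge_zero[of y] by (simp add: add_pos_nonneg)
    have "norm (\<kappa> (x - z) - \<kappa> (x - z')) \<le> B * norm ((x - z) - (x - z'))"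
    proof (rule differentiable_bound)
      show "convex S" by (simp add: S_def)
      show "x - z \<in> S" "x - z' \<in> S" by (auto simp: S_def)
      show "(\<kappa> has_derivative (\<lambda>h. \<Sum>i\<in>UNIV. h $ i *\<^sub>R partial_deriv i \<kappa> y)) (at y within S)" for y
        by (rule smooth_has_derivative[OF schwartz_smooth[OF assms]])
      fix y assume "y \<in> S"
      then obtain t where t: "0 \<le> t" "t \<le> 1" "y = (1 - t) *\<^sub>R (x - z) + t *\<^sub>R (x - z')"
        unfolding S_def closed_segment_def by auto
      have "x - y = (1 - t) *\<^sub>R z + t *\<^sub>R z'" unfolding t by (simp add: algebra_simps)
      then have "norm (x - y) \<le> (1 - t) * norm z + t * norm z'"
        using t norm_triangle_ineq[of "(1 - t) *\<^sub>R z" "t *\<^sub>R z'"] by simp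
      also have "\<dots> \<le> 1 * norm z + 1 * norm z'"
        using t by (intro add_mono mult_right_mono) auto
      finally have "(1 + norm (x - y)) ^ N \<le> (1 + norm z + norm z') ^ N"
        by (intro power_mono) auto
      then have "(1 + norm x) ^ N \<le> (1 + norm z + norm z') ^ N * (1 + norm y) ^ N"
        using one_plus_norm_triangle_power[of x N y] pos[of y]
        by (meson less_imp_le mult_right_mono order_trans)
      then have "(1 + norm x) ^ N * (\<Sum>i\<in>UNIV. norm (partial_deriv i \<kappa> y)) \<le>
         (1 + norm z + norm z') ^ N * (1 + norm y) ^ N * (\<Sum>i\<in>UNIV. norm (partial_deriv i \<kappa> y))"
        by (rule mult_right_mono) (simp add: sum_nonneg)
      also have "\<dots> \<le> (1 + norm z + norm z') ^ N * C"
        unfolding mult.assoc by (rule mult_left_mono[OF C]) simp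
      finally have "(\<Sum>i\<in>UNIV. norm (partial_deriv i \<kappa> y)) \<le> B"
        unfolding B_def using pos[of x] by (simp add: field_simps)
      with onorm_partials_le[of "\<lambda>i. partial_deriv i \<kappa> y"]
      show "onorm (\<lambda>h. \<Sum>i\<in>UNIV. h $ i *\<^sub>R partial_deriv i \<kappa> y) \<le> B" by linarith
    qed
    then have "norm (\<kappa> (x - z) - \<kappa> (x - z')) \<le> B * norm (z - z')"
      by (simp add: norm_minus_commute)
    then have "(1 + norm x) ^ N * norm (\<kappa> (x - z) - \<kappa> (x - z')) \<le> (1 + norm x) ^ N * (B * norm (z - z'))"
      by (intro mult_left_mono) auto
    also have "\<dots> = C * (norm (z - z') * (1 + norm z + norm z') ^ N)"
    proof -
      have "(1 + norm x) ^ N \<noteq> 0" using pos[of x] by linarith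
      moreover have "a * (C * b / a * d) = C * (d * b)" if "a \<noteq> 0" for a b d :: real
        using that by simp
      ultimately show ?thesis unfolding B_def by blast
    qed
    finally show ?thesis .
  qed
  with C0 show ?thesis by blast
qed

text \<open>The partial derivatives are again Schwartz functions and hence globally Lipschitz, so
  the Taylor remainder is quadratic with one constant for all base points. This uniformity allows it
  to be integrated over all shifts.\<close>

lemma schwartz_second_order:
  fixes \<kappa> :: "real ^ 'n::finite \<Rightarrow> complex"
  assumes "\<kappa> \<in> schwartz"
  shows "\<exists>C\<ge>0. \<forall>x h. norm (\<kappa> (x + h) - \<kappa> x - (\<Sum>i\<in>UNIV. h $ i *\<^sub>R partial_deriv i \<kappa> x)) \<le> C * (norm h)\<^sup>2"
proof -
  have "\<forall>i. \<exists>C. C \<ge> 0 \<and> (\<forall>x y. norm (partial_deriv i \<kappa> x - partial_deriv i \<kappa> y) \<le> C * norm (x - y))"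
  proof
    fix i
    obtain C where "C \<ge> 0" and C: "\<And>x z z'. norm (partial_deriv i \<kappa> (x - z) - partial_deriv i \<kappa> (x - z')) \<le> C * norm (z - z')"
      using schwartz_translate_lipschitz[OF schwartz_partial[OF assms], of 0 i] by auto
    have "norm (partial_deriv i \<kappa> x - partial_deriv i \<kappa> y) \<le> C * norm (x - y)" for x y
      using C[of 0 "-x" "-y"] by (simp add: norm_minus_commute)
    with \<open>C \<ge> 0\<close> show "\<exists>C. C \<ge> 0 \<and> (\<forall>x y. norm (partial_deriv i \<kappa> x - partial_deriv i \<kappa> y) \<le> C * norm (x - y))" by blast
  qed
  then obtain c where c: "\<And>i. c i \<ge> 0" "\<And>i x y. norm (partial_deriv i \<kappa> x - partial_deriv i \<kappa> y) \<le> c i * norm (x - y)"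
    by metis
  define C where "C = (\<Sum>i\<in>UNIV. c i)"
  have C0: "C \<ge> 0" unfolding C_def using c by (simp add: sum_nonneg)
  let ?D = "\<lambda>y h. \<Sum>i\<in>UNIV. h $ i *\<^sub>R partial_deriv i \<kappa> y"
  have "norm (\<kappa> (x + h) - \<kappa> x - ?D x h) \<le> C * (norm h)\<^sup>2" for x h
  proof -
    have "norm (\<kappa> (x + h) - \<kappa> x - ?D x ((x + h) - x)) \<le> norm ((x + h) - x) * (C * norm h)"
    proof (rule differentiable_bound_linearization[where S = "closed_segment x (x + h)"])
      show "x + t *\<^sub>R ((x + h) - x) \<in> closed_segment x (x + h)" if "t \<in> {0..1}" for t
        using that by (auto simp: closed_segment_def algebra_simps intro!: exI[of _ t])
      show "(\<kappa> has_derivative ?D y) (at y within closed_segment x (x + h))" for y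
        by (rule smooth_has_derivative[OF schwartz_smooth[OF assms]])
      show "x \<in> closed_segment x (x + h)" by simp
      fix y assume "y \<in> closed_segment x (x + h)"
      then have "norm (y - x) \<le> norm h"
        using segment_bound1[of y x "x + h"] by simp
      have "?D y - ?D x = (\<lambda>k. \<Sum>i\<in>UNIV. k $ i *\<^sub>R (partial_deriv i \<kappa> y - partial_deriv i \<kappa> x))"
        by (auto simp: fun_eq_iff scaleR_diff_right sum_subtractf)
      then have "onorm (?D y - ?D x) \<le> (\<Sum>i\<in>UNIV. norm (partial_deriv i \<kappa> y - partial_deriv i \<kappa> x))"
        using onorm_partials_le by simp
      also have "\<dots> \<le> (\<Sum>i\<in>UNIV. c i * norm h)"
      proof (rule sum_mono)
        fix i
        have "c i * norm (y - x) \<le> c i * norm h"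
          using c(1) \<open>norm (y - x) \<le> norm h\<close> by (rule mult_left_mono[rotated])
        with c(2)[of i y x] show "norm (partial_deriv i \<kappa> y - partial_deriv i \<kappa> x) \<le> c i * norm h"
          by linarith
      qed
      finally show "onorm (?D y - ?D x) \<le> C * norm h" by (simp add: C_def sum_distrib_right)
    qed
    then show ?thesis by (simp add: power2_eq_square mult_ac)
  qed
  with C0 show ?thesis by blast
qed

lemma schwartz_borel: "f \<in> schwartz \<Longrightarrow> f \<in> borel_measurable borel"
  by (simp add: schwartz_smooth smooth_borel)

text \<open>Works from the majorant alone: a non-integrable f has integral 0 by convention, and the
  majorant is nonnegative.\<close>

lemma integral_norm_le:
  fixes f :: "'a \<Rightarrow> 'b::{banach, second_countable_topology}"
  assumes "integrable M g" "\<And>x. norm (f x) \<le> g x"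
  shows "norm (LINT x|M. f x) \<le> (LINT x|M. g x)"
proof (cases "integrable M f")
  case True
  have "norm (LINT x|M. f x) \<le> (LINT x|M. norm (f x))" by (rule integral_norm_bound)
  also have "\<dots> \<le> (LINT x|M. g x)" using assms True by (intro integral_mono) auto
  finally show ?thesis .
next
  case False
  have "g x \<ge> 0" for x using assms(2)[of x] norm_ge_zero order_trans by blast
  with False show ?thesis by (simp add: not_integrable_integral_eq)
qed

text \<open>The shift is a measurable map s so that one family of lemmas covers three cases: the
  convolution itself (s z = z), its approximation by simple functions, and the shrinking shifts a_n
  z of an approximate identity.\<close>

lemma superposition_integrable:
  fixes \<kappa> :: "real ^ 'n::finite \<Rightarrow> complex" and s :: "real ^ 'n \<Rightarrow> real ^ 'n"
  assumes "\<kappa> \<in> schwartz" "integrable lebesgue \<eta>" "s \<in> borel_measurable lebesgue"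
  shows "integrable lebesgue (\<lambda>z. \<eta> z * \<kappa> (x - s z))"
proof -
  obtain C where C: "\<And>x. norm (\<kappa> x) \<le> C"
    using schwartz_bound0[OF assms(1), of 0] by auto
  have m: "(\<lambda>z. \<kappa> (x - s z)) \<in> borel_measurable lebesgue"
    by (rule measurable_compose[OF _ schwartz_borel[OF assms(1)]]) (use assms(3) in simp)
  show ?thesis
  proof (rule Bochner_Integration.integrable_bound[of _ "\<lambda>z. C * norm (\<eta> z)"])
    show "integrable lebesgue (\<lambda>z. C * norm (\<eta> z))" using assms(2) by simp
    show "(\<lambda>z. \<eta> z * \<kappa> (x - s z)) \<in> borel_measurable lebesgue"
      using m assms(2) by (auto intro: borel_measurable_times dest: borel_measurable_integrable)
    show "AE z in lebesgue. norm (\<eta> z * \<kappa> (x - s z)) \<le> norm (C * norm (\<eta> z))"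
    proof (rule AE_I2)
      fix z
      have "norm (\<eta> z) * norm (\<kappa> (x - s z)) \<le> norm (\<eta> z) * C" using C by (intro mult_left_mono) auto
      then show "norm (\<eta> z * \<kappa> (x - s z)) \<le> norm (C * norm (\<eta> z))"
        by (simp add: norm_mult mult.commute)
    qed
  qed
qed

text \<open>The uniform second-order estimate of the kernel is multiplied by \<eta> and integrated;
  its constant gains the L1 norm of \<eta> as a factor.\<close>

lemma superposition_has_derivative:
  fixes \<kappa> :: "real ^ 'n::finite \<Rightarrow> complex" and s :: "real ^ 'n \<Rightarrow> real ^ 'n"
  assumes "\<kappa> \<in> schwartz" "integrable lebesgue \<eta>" "s \<in> borel_measurable lebesgue"
  shows "((\<lambda>x. LINT z|lebesgue. \<eta> z * \<kappa> (x - s z)) has_derivative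
     (\<lambda>h. \<Sum>i\<in>UNIV. h $ i *\<^sub>R (LINT z|lebesgue. \<eta> z * partial_deriv i \<kappa> (x - s z)))) (at x)"
    (is "(?F has_derivative ?D) _")
proof -
  obtain C where C0: "C \<ge> 0" and C: "\<And>x h. norm (\<kappa> (x + h) - \<kappa> x - (\<Sum>i\<in>UNIV. h $ i *\<^sub>R partial_deriv i \<kappa> x)) \<le> C * (norm h)\<^sup>2"
    using schwartz_second_order[OF assms(1)] by auto
  define A where "A = (LINT z|lebesgue. norm (\<eta> z))"
  note int = superposition_integrable[OF assms]
  note int' = superposition_integrable[OF schwartz_partial[OF assms(1)] assms(2,3)]
  have est: "norm (?F (x + h) - ?F x - ?D h) \<le> C * A * (norm h)\<^sup>2" for h
  proof -
    let ?R = "\<lambda>z. \<eta> z * \<kappa> (x + h - s z) - \<eta> z * \<kappa> (x - s z) - (\<Sum>i\<in>UNIV. h $ i *\<^sub>R (\<eta> z * partial_deriv i \<kappa> (x - s z)))"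
    have "?F (x + h) - ?F x - ?D h = (LINT z|lebesgue. ?R z)"
      by (simp add: int int' Bochner_Integration.integral_diff Bochner_Integration.integral_sum)
    also have "norm \<dots> \<le> (LINT z|lebesgue. C * (norm h)\<^sup>2 * norm (\<eta> z))"
    proof (rule integral_norm_le)
      show "integrable lebesgue (\<lambda>z. C * (norm h)\<^sup>2 * norm (\<eta> z))" using assms(2) by simp
      fix z
      have "?R z = \<eta> z * (\<kappa> ((x - s z) + h) - \<kappa> (x - s z) - (\<Sum>i\<in>UNIV. h $ i *\<^sub>R partial_deriv i \<kappa> (x - s z)))"
        by (simp only: right_diff_distrib sum_distrib_left mult_scaleR_right add_diff_eq diff_add_eq)
      then have "norm (?R z) = norm (\<eta> z) * norm (\<kappa> ((x - s z) + h) - \<kappa> (x - s z) - (\<Sum>i\<in>UNIV. h $ i *\<^sub>R partial_deriv i \<kappa> (x - s z)))"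
        by (simp only: norm_mult)
      also have "\<dots> \<le> norm (\<eta> z) * (C * (norm h)\<^sup>2)" by (intro mult_left_mono C) auto
      finally show "norm (?R z) \<le> C * (norm h)\<^sup>2 * norm (\<eta> z)" by (simp add: mult_ac)
    qed
    also have "\<dots> = C * A * (norm h)\<^sup>2" by (simp add: A_def)
    finally show ?thesis .
  qed
  show ?thesis
    by (rule has_derivative_if_quadratic_remainder[OF _ est])
      (intro bounded_linear_sum bounded_linear_scaleR_const bounded_linear_vec_nth)
qed

lemma superposition_iter_partial_deriv:
  fixes \<kappa> :: "real ^ 'n::finite \<Rightarrow> complex" and s :: "real ^ 'n \<Rightarrow> real ^ 'n"
  assumes "\<kappa> \<in> schwartz" "integrable lebesgue \<eta>" "s \<in> borel_measurable lebesgue"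
  shows "iter_partial_deriv is (\<lambda>x. LINT z|lebesgue. \<eta> z * \<kappa> (x - s z)) =
    (\<lambda>x. LINT z|lebesgue. \<eta> z * iter_partial_deriv is \<kappa> (x - s z))"
proof (induction "is")
  case (Cons i "is")
  then show ?case
    using partial_deriv_eqI[OF superposition_has_derivative[OF schwartz_iter[OF assms(1), of "is"] assms(2,3)]]
    by (simp add: Cons fun_eq_iff sum_axis_scaleR)
qed auto

lemma superposition_smooth:
  fixes \<kappa> :: "real ^ 'n::finite \<Rightarrow> complex" and s :: "real ^ 'n \<Rightarrow> real ^ 'n"
  assumes "\<kappa> \<in> schwartz" "integrable lebesgue \<eta>" "s \<in> borel_measurable lebesgue"
  shows "smooth (\<lambda>x. LINT z|lebesgue. \<eta> z * \<kappa> (x - s z))"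
  unfolding smooth_def superposition_iter_partial_deriv[OF assms] differentiable_def
  using superposition_has_derivative[OF schwartz_iter[OF assms(1)] assms(2,3)] by blast

text \<open>The weight at x splits into a weight at x - s z, absorbed by the kernel, and a weight at
  s z, absorbed by the moment hypothesis \<open>dec\<close>.\<close>

lemma superposition_schwartz:
  fixes \<kappa> :: "real ^ 'n::finite \<Rightarrow> complex" and s :: "real ^ 'n \<Rightarrow> real ^ 'n"
  assumes "\<kappa> \<in> schwartz" "integrable lebesgue \<eta>" "s \<in> borel_measurable lebesgue"
    and dec: "\<And>N. integrable lebesgue (\<lambda>z. (1 + norm (s z)) ^ N * norm (\<eta> z))"
  shows "(\<lambda>x. LINT z|lebesgue. \<eta> z * \<kappa> (x - s z)) \<in> schwartz"
proof (rule schwartzI)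
  show "smooth (\<lambda>x. LINT z|lebesgue. \<eta> z * \<kappa> (x - s z))"
    by (rule superposition_smooth[OF assms(1-3)])
  fix N "is"
  obtain C where C: "\<And>x. (1 + norm x) ^ N * norm (iter_partial_deriv is \<kappa> x) \<le> C"
    using schwartz_bound[OF assms(1)] by metis
  have "(1 + norm x) ^ N * norm (iter_partial_deriv is (\<lambda>x. LINT z|lebesgue. \<eta> z * \<kappa> (x - s z)) x) \<le>
    (LINT z|lebesgue. C * ((1 + norm (s z)) ^ N * norm (\<eta> z)))" for x
  proof -
    have "norm (LINT z|lebesgue. of_real ((1 + norm x) ^ N) * (\<eta> z * iter_partial_deriv is \<kappa> (x - s z)))
      \<le> (LINT z|lebesgue. C * ((1 + norm (s z)) ^ N * norm (\<eta> z)))"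
    proof (rule integral_norm_le)
      show "integrable lebesgue (\<lambda>z. C * ((1 + norm (s z)) ^ N * norm (\<eta> z)))"
        using dec by simp
      fix z
      have "(1 + norm x) ^ N * norm (iter_partial_deriv is \<kappa> (x - s z)) \<le>
        ((1 + norm (x - s z)) ^ N * (1 + norm (s z)) ^ N) * norm (iter_partial_deriv is \<kappa> (x - s z))"
        by (intro mult_right_mono one_plus_norm_triangle_power) simp
      also have "\<dots> = (1 + norm (s z)) ^ N * ((1 + norm (x - s z)) ^ N * norm (iter_partial_deriv is \<kappa> (x - s z)))"
        by (simp add: mult_ac)
      also have "\<dots> \<le> (1 + norm (s z)) ^ N * C" by (intro mult_left_mono C) simp
      finally have "norm (\<eta> z) * ((1 + norm x) ^ N * norm (iter_partial_deriv is \<kappa> (x - s z))) \<le> norm (\<eta> z) * ((1 + norm (s z)) ^ N * C)"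
        by (rule mult_left_mono) simp
      moreover have "norm (of_real ((1 + norm x) ^ N) * (\<eta> z * iter_partial_deriv is \<kappa> (x - s z))) =
          norm (\<eta> z) * ((1 + norm x) ^ N * norm (iter_partial_deriv is \<kappa> (x - s z)))"
        by (simp only: norm_mult norm_of_real) (simp add: power_abs)
      ultimately show "norm (of_real ((1 + norm x) ^ N) * (\<eta> z * iter_partial_deriv is \<kappa> (x - s z))) \<le>
         C * ((1 + norm (s z)) ^ N * norm (\<eta> z))" by (simp add: mult_ac)
    qed
    moreover have "norm (LINT z|lebesgue. of_real ((1 + norm x) ^ N) * (\<eta> z * iter_partial_deriv is \<kappa> (x - s z)))
        = (1 + norm x) ^ N * norm (LINT z|lebesgue. \<eta> z * iter_partial_deriv is \<kappa> (x - s z))"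
      by (simp only: integral_mult_right_zero norm_mult norm_of_real) (simp add: power_abs)
    ultimately show ?thesis
      by (simp only: superposition_iter_partial_deriv[OF assms(1-3)])
  qed
  then show "\<exists>C. \<forall>x. (1 + norm x) ^ N * norm (iter_partial_deriv is (\<lambda>x. LINT z|lebesgue. \<eta> z * \<kappa> (x - s z)) x) \<le> C" by blast
qed

lemma schwartz_norm_le:
  assumes "\<And>is x. length is \<le> N \<Longrightarrow> (1 + norm x) ^ N * norm (iter_partial_deriv is f x) \<le> B is"
  shows "schwartz_norm N f \<le> (\<Sum>is | length is \<le> N. B is)"
  unfolding schwartz_norm_def by (rule sum_mono) (use assms in \<open>auto intro!: cSUP_least\<close>)

lemma schwartz_norm_translate_diff:
  fixes \<kappa> :: "real ^ 'n::finite \<Rightarrow> complex"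
  assumes "\<kappa> \<in> schwartz"
  shows "\<exists>C\<ge>0. \<forall>z z'. schwartz_norm N (\<lambda>x. \<kappa> (x - z) - \<kappa> (x - z')) \<le> C * (norm (z - z') * (1 + norm z + norm z') ^ N)"
proof -
  obtain c where c: "\<And>is. c is \<ge> 0" "\<And>is x z z'. (1 + norm x) ^ N * norm (iter_partial_deriv is \<kappa> (x - z) - iter_partial_deriv is \<kappa> (x - z')) \<le>
     c is * (norm (z - z') * (1 + norm z + norm z') ^ N)"
    using schwartz_translate_lipschitz[OF schwartz_iter[OF assms], of N] by metis
  have "schwartz_norm N (\<lambda>x. \<kappa> (x - z) - \<kappa> (x - z')) \<le> (\<Sum>is | length is \<le> N. c is * (norm (z - z') * (1 + norm z + norm z') ^ N))" for z z'
  proof (rule schwartz_norm_le)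
    fix "is" x
    note s = schwartz_smooth[OF schwartz_translate[OF assms]]
    show "(1 + norm x) ^ N * norm (iter_partial_deriv is (\<lambda>x. \<kappa> (x - z) - \<kappa> (x - z')) x) \<le> c is * (norm (z - z') * (1 + norm z + norm z') ^ N)"
      using c(2)[of x "is" z z'] iter_partial_deriv_lincomb[OF s[of z] s[of z'], of "is" 1 "-1"]
      by (simp add: iter_partial_deriv_translate[OF schwartz_smooth[OF assms]])
  qed
  then show ?thesis
    using c by (intro exI[of _ "\<Sum>is | length is \<le> N. c is"]) (simp add: sum_nonneg sum_distrib_right)
qed

text \<open>The constant depends on the kernel and N alone and is fixed before \<eta>, s and t.
  Convergence in the Schwartz topology, as s approaches t, is thereby reduced to the convergence of
  one weighted integral to 0.\<close>

lemma schwartz_norm_superposition_diff: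
  fixes \<kappa> :: "real ^ 'n::finite \<Rightarrow> complex"
  assumes "\<kappa> \<in> schwartz"
  shows "\<exists>C\<ge>0. \<forall>(\<eta> :: real ^ 'n \<Rightarrow> complex) (s :: real ^ 'n \<Rightarrow> real ^ 'n) t. integrable lebesgue \<eta> \<longrightarrow> s \<in> borel_measurable lebesgue \<longrightarrow> t \<in> borel_measurable lebesgue \<longrightarrow>
      integrable lebesgue (\<lambda>z. norm (\<eta> z) * (norm (s z - t z) * (1 + norm (s z) + norm (t z)) ^ N)) \<longrightarrow>
      schwartz_norm N (\<lambda>x. (LINT z|lebesgue. \<eta> z * \<kappa> (x - s z)) - (LINT z|lebesgue. \<eta> z * \<kappa> (x - t z)))
      \<le> C * (LINT z|lebesgue. norm (\<eta> z) * (norm (s z - t z) * (1 + norm (s z) + norm (t z)) ^ N))"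
proof -
  obtain c where c: "\<And>is. c is \<ge> 0" "\<And>is x z z'. (1 + norm x) ^ N * norm (iter_partial_deriv is \<kappa> (x - z) - iter_partial_deriv is \<kappa> (x - z')) \<le>
     c is * (norm (z - z') * (1 + norm z + norm z') ^ N)"
    using schwartz_translate_lipschitz[OF schwartz_iter[OF assms], of N] by metis
  have "schwartz_norm N (\<lambda>x. (LINT z|lebesgue. \<eta> z * \<kappa> (x - s z)) - (LINT z|lebesgue. \<eta> z * \<kappa> (x - t z)))
      \<le> (\<Sum>is | length is \<le> N. c is * (LINT z|lebesgue. norm (\<eta> z) * (norm (s z - t z) * (1 + norm (s z) + norm (t z)) ^ N)))"
    if \<eta>: "integrable lebesgue \<eta>" and s: "s \<in> borel_measurable lebesgue" and t: "t \<in> borel_measurable lebesgue"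
      and w: "integrable lebesgue (\<lambda>z. norm (\<eta> z) * (norm (s z - t z) * (1 + norm (s z) + norm (t z)) ^ N))"
    for \<eta> :: "real ^ 'n \<Rightarrow> complex" and s t :: "real ^ 'n \<Rightarrow> real ^ 'n"
  proof (rule schwartz_norm_le)
    fix "is" x
    let ?k = "iter_partial_deriv is \<kappa>"
    have i: "integrable lebesgue (\<lambda>z. \<eta> z * ?k (x - s z))" "integrable lebesgue (\<lambda>z. \<eta> z * ?k (x - t z))"
      using superposition_integrable[OF schwartz_iter[OF assms] \<eta>] s t by blast+
    have "iter_partial_deriv is (\<lambda>x. (LINT z|lebesgue. \<eta> z * \<kappa> (x - s z)) - (LINT z|lebesgue. \<eta> z * \<kappa> (x - t z))) x
        = (LINT z|lebesgue. \<eta> z * ?k (x - s z)) - (LINT z|lebesgue. \<eta> z * ?k (x - t z))"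
      using iter_partial_deriv_lincomb[OF superposition_smooth[OF assms \<eta> s] superposition_smooth[OF assms \<eta> t], of "is" 1 "-1"]
      by (simp add: superposition_iter_partial_deriv[OF assms \<eta>] s t)
    also have "\<dots> = (LINT z|lebesgue. \<eta> z * (?k (x - s z) - ?k (x - t z)))"
      using i by (simp add: right_diff_distrib Bochner_Integration.integral_diff)
    finally have "(1 + norm x) ^ N * norm (iter_partial_deriv is (\<lambda>x. (LINT z|lebesgue. \<eta> z * \<kappa> (x - s z)) - (LINT z|lebesgue. \<eta> z * \<kappa> (x - t z))) x)
       = norm (LINT z|lebesgue. of_real ((1 + norm x) ^ N) * (\<eta> z * (?k (x - s z) - ?k (x - t z))))"
      by (simp only: integral_mult_right_zero norm_mult norm_of_real) (simp add: power_abs)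
    also have "\<dots> \<le> (LINT z|lebesgue. c is * (norm (\<eta> z) * (norm (s z - t z) * (1 + norm (s z) + norm (t z)) ^ N)))"
    proof (rule integral_norm_le)
      show "integrable lebesgue (\<lambda>z. c is * (norm (\<eta> z) * (norm (s z - t z) * (1 + norm (s z) + norm (t z)) ^ N)))"
        using w by simp
      fix z
      have "norm (of_real ((1 + norm x) ^ N) * (\<eta> z * (?k (x - s z) - ?k (x - t z)))) =
        norm (\<eta> z) * ((1 + norm x) ^ N * norm (?k (x - s z) - ?k (x - t z)))"
        by (simp only: norm_mult norm_of_real) (simp add: power_abs)
      also have "\<dots> \<le> norm (\<eta> z) * (c is * (norm (s z - t z) * (1 + norm (s z) + norm (t z)) ^ N))"
        by (intro mult_left_mono c) simp
      finally show "norm (of_real ((1 + norm x) ^ N) * (\<eta> z * (?k (x - s z) - ?k (x - t z)))) \<le>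
         c is * (norm (\<eta> z) * (norm (s z - t z) * (1 + norm (s z) + norm (t z)) ^ N))"
        by (simp add: mult_ac)
    qed
    finally show "(1 + norm x) ^ N * norm (iter_partial_deriv is (\<lambda>x. (LINT z|lebesgue. \<eta> z * \<kappa> (x - s z)) - (LINT z|lebesgue. \<eta> z * \<kappa> (x - t z))) x)
      \<le> c is * (LINT z|lebesgue. norm (\<eta> z) * (norm (s z - t z) * (1 + norm (s z) + norm (t z)) ^ N))"
      by simp
  qed
  then show ?thesis
    using c by (intro exI[of _ "\<Sum>is | length is \<le> N. c is"]) (simp add: sum_nonneg sum_distrib_right)
qed

section \<open>Tempered distributions and convolutions\<close>

lemma integrable_lebesgue_if_borel:
  fixes f :: "'a::euclidean_space \<Rightarrow> 'b::{banach, second_countable_topology}"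
  assumes "f \<in> borel_measurable borel" "(\<integral>\<^sup>+x. ennreal (norm (f x)) \<partial>lborel) < \<infinity>"
  shows "integrable lebesgue f"
proof -
  have "integrable lborel f" using assms by (intro integrableI_bounded) auto
  then show ?thesis by (simp add: integrable_completion assms(1))
qed

text \<open>Comparison with balls: where n \<le> |x| \<le> n + 1 the function is at most 1 / (n +
  1)^(d + 2), and the ball of radius n + 1 has volume of order (n + 1)^d. Replacing each shell by
  the entire ball costs one power of n, whence d + 2 in place of d + 1, and the convergent sum of 1
  / (n + 1)^2.\<close>

lemma integrable_inverse_one_plus_norm_power:
  "integrable lebesgue (\<lambda>x :: 'a::euclidean_space. 1 / (1 + norm x) ^ (DIM('a) + 2))"
proof (rule integrable_lebesgue_if_borel)
  let ?d = "DIM('a)"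
  define f where "f n x = ennreal (1 / (1 + real n) ^ (?d + 2)) * indicator (cball 0 (real n + 1)) x" for n and x :: 'a
  have "ennreal (norm (1 / (1 + norm x) ^ (?d + 2))) \<le> (\<Sum>n. f n x)" for x :: 'a
  proof -
    define n where "n = nat \<lfloor>norm x\<rfloor>"
    have n: "real n \<le> norm x" "norm x \<le> real n + 1" unfolding n_def using norm_ge_zero[of x] by linarith+
    have "1 / (1 + norm x) ^ (?d + 2) \<le> 1 / (1 + real n) ^ (?d + 2)"
      using n by (intro divide_left_mono power_mono mult_pos_pos) (auto intro!: zero_less_power add_pos_nonneg)
    then have "ennreal (norm (1 / (1 + norm x) ^ (?d + 2))) \<le> f n x"
      using n by (simp add: f_def ennreal_leI)
    also have "\<dots> \<le> (\<Sum>n. f n x)" using sum_le_suminf[of "\<lambda>n. f n x" "{n}"] by simp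
    finally show ?thesis .
  qed
  then have "(\<integral>\<^sup>+(x::'a). ennreal (norm (1 / (1 + norm x) ^ (?d + 2))) \<partial>lborel) \<le> (\<integral>\<^sup>+x. (\<Sum>n. f n x) \<partial>lborel)"
    by (intro nn_integral_mono) auto
  also have "\<dots> = (\<Sum>n. \<integral>\<^sup>+x. f n x \<partial>lborel)"
    unfolding f_def by (intro nn_integral_suminf borel_measurable_times_ennreal borel_measurable_indicator) auto
  also have "\<dots> = (\<Sum>n. ennreal (unit_ball_vol (real ?d) * inverse (real (Suc n) ^ 2)))"
  proof (rule arg_cong[where f = suminf], rule ext)
    fix n
    have "(\<integral>\<^sup>+x. f n x \<partial>lborel) = ennreal (1 / (1 + real n) ^ (?d + 2)) * ennreal (unit_ball_vol (real ?d) * (real n + 1) ^ ?d)"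
      unfolding f_def by (subst nn_integral_cmult_indicator) (auto simp: emeasure_cball)
    also have "\<dots> = ennreal (1 / (1 + real n) ^ (?d + 2) * (unit_ball_vol (real ?d) * (real n + 1) ^ ?d))"
      by (rule ennreal_mult[symmetric]) auto
    also have "1 / (1 + real n) ^ (?d + 2) * (unit_ball_vol (real ?d) * (real n + 1) ^ ?d) = unit_ball_vol (real ?d) * inverse (real (Suc n) ^ 2)"
    proof -
      have *: "1 / (a ^ ?d * b) * (c * a ^ ?d) = c * inverse b" if "a > 0" for a b c :: real
        using that by (simp add: divide_simps)
      show ?thesis
        using *[of "1 + real n" "(1 + real n) ^ 2" "unit_ball_vol (real ?d)"] by (simp add: power_add add.commute power2_eq_square divide_inverse)
    qed
    finally show "(\<integral>\<^sup>+x. f n x \<partial>lborel) = ennreal (unit_ball_vol (real ?d) * inverse (real (Suc n) ^ 2))" .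
  qed
  also have "\<dots> < \<infinity>"
  proof -
    have "summable (\<lambda>n. inverse (real n ^ 2))" by (rule inverse_power_summable) simp
    then have "summable (\<lambda>n. unit_ball_vol (real ?d) * inverse (real (Suc n) ^ 2))"
      by (intro summable_mult) (rule summable_Suc_iff[THEN iffD2])
    then have "(\<Sum>n. ennreal (unit_ball_vol (real ?d) * inverse (real (Suc n) ^ 2))) \<noteq> top"
      by (rule ennreal_suminf_neq_top) simp
    then show ?thesis by (simp add: top.not_eq_extremum)
  qed
  finally show "(\<integral>\<^sup>+(x::'a). ennreal (norm (1 / (1 + norm x) ^ (?d + 2))) \<partial>lborel) < \<infinity>" .
qed auto

text \<open>What a density must satisfy for its convolution with a Schwartz function to be a
  Schwartz function: all absolute moments are finite. Regularity is left to the other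
  factor.\<close>

definition rapidly_decreasing :: "(real ^ 'n::finite \<Rightarrow> complex) \<Rightarrow> bool" where
  "rapidly_decreasing \<eta> \<longleftrightarrow> \<eta> \<in> borel_measurable lebesgue \<and>
     (\<forall>N. integrable lebesgue (\<lambda>z. (1 + norm z) ^ N * norm (\<eta> z)))"

lemma rapidly_decreasingD:
  assumes "rapidly_decreasing \<eta>"
  shows "\<eta> \<in> borel_measurable lebesgue" "integrable lebesgue (\<lambda>z. (1 + norm z) ^ N * norm (\<eta> z))"
    "integrable lebesgue \<eta>"
proof -
  show m: "\<eta> \<in> borel_measurable lebesgue" and i: "integrable lebesgue (\<lambda>z. (1 + norm z) ^ N * norm (\<eta> z))" for N
    using assms by (auto simp: rapidly_decreasing_def)
  show "integrable lebesgue \<eta>" using i[of 0] m by (simp add: integrable_norm_iff)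
qed

lemma borel_measurable_lebesgueI: "f \<in> borel_measurable borel \<Longrightarrow> f \<in> borel_measurable lebesgue"
  by (simp add: measurable_completion)

lemma schwartz_rapidly_decreasing:
  fixes f :: "real ^ 'n::finite \<Rightarrow> complex"
  assumes "f \<in> schwartz"
  shows "rapidly_decreasing f"
  unfolding rapidly_decreasing_def
proof (intro conjI allI)
  show m: "f \<in> borel_measurable lebesgue" by (intro borel_measurable_lebesgueI schwartz_borel assms)
  fix N
  let ?d = "DIM(real ^ 'n) + 2"
  obtain C where C: "\<And>x. (1 + norm x) ^ (N + ?d) * norm (f x) \<le> C" using schwartz_bound0[OF assms] by metis
  show "integrable lebesgue (\<lambda>z. (1 + norm z) ^ N * norm (f z))"
  proof (rule Bochner_Integration.integrable_bound)
    show "integrable lebesgue (\<lambda>x :: real ^ 'n. C * (1 / (1 + norm x) ^ ?d))"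
      by (intro integrable_mult_right integrable_inverse_one_plus_norm_power)
    show "(\<lambda>z. (1 + norm z) ^ N * norm (f z)) \<in> borel_measurable lebesgue"
      using schwartz_borel[OF assms] by (intro borel_measurable_lebesgueI) measurable
    show "AE z in lebesgue. norm ((1 + norm z) ^ N * norm (f z)) \<le> norm (C * (1 / (1 + norm z) ^ ?d))"
    proof (rule AE_I2)
      fix z :: "real ^ 'n"
      have pos: "(1 + norm z) ^ ?d > 0" by (intro zero_less_power add_pos_nonneg) auto
      have "C \<ge> 0" using C[of 0] by (smt (verit) norm_ge_zero mult_nonneg_nonneg zero_le_power)
      have "((1 + norm z) ^ N * norm (f z)) * (1 + norm z) ^ ?d \<le> C"
        using C[of z] by (simp add: power_add mult_ac)
      then have "(1 + norm z) ^ N * norm (f z) \<le> C / (1 + norm z) ^ ?d"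
        using pos by (simp add: pos_le_divide_eq)
      then show "norm ((1 + norm z) ^ N * norm (f z)) \<le> norm (C * (1 / (1 + norm z) ^ ?d))"
        using \<open>C \<ge> 0\<close> pos by (simp add: abs_mult)
    qed
  qed
qed

lemma schwartz_integrable: "f \<in> schwartz \<Longrightarrow> integrable lebesgue f"
  by (rule rapidly_decreasingD(3)[OF schwartz_rapidly_decreasing])

lemma convolution_schwartz:
  assumes "\<kappa> \<in> schwartz" "rapidly_decreasing \<eta>"
  shows "(\<lambda>x. LINT z|lebesgue. \<eta> z * \<kappa> (x - z)) \<in> schwartz"
  using superposition_schwartz[OF assms(1), of \<eta> "\<lambda>z. z"] rapidly_decreasingD[OF assms(2)]
    borel_measurable_lebesgueI[of "\<lambda>z. z"]
  by simp

lemma schwartz_norm_nonneg: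
  assumes "f \<in> schwartz"
  shows "schwartz_norm N f \<ge> 0"
  unfolding schwartz_norm_def
proof (rule sum_nonneg)
  fix "is" :: "'a list"
  obtain C where "\<And>x. (1 + norm x) ^ N * norm (iter_partial_deriv is f x) \<le> C"
    using schwartz_bound[OF assms] by metis
  then have "bdd_above (range (\<lambda>x. (1 + norm x) ^ N * norm (iter_partial_deriv is f x)))" by (rule bdd_aboveI2)
  then show "0 \<le> (SUP x. (1 + norm x) ^ N * norm (iter_partial_deriv is f x))"
    by (rule cSUP_upper2[of _ _ 0]) auto
qed

text \<open>Phrased with an arbitrary upper bound B of the seminorm, so that estimates can be fed in
  directly; the absolute value of the original constant makes the passage to a larger B
  monotone.\<close>

lemma tempered_bound:
  assumes "T \<in> tempered_distributions"
  obtains C N where "C \<ge> 0" "\<And>\<eta> B. \<eta> \<in> schwartz \<Longrightarrow> schwartz_norm N \<eta> \<le> B \<Longrightarrow> norm (T \<eta>) \<le> C * B"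
proof -
  obtain C N where C: "\<And>\<eta>. \<eta> \<in> schwartz \<Longrightarrow> norm (T \<eta>) \<le> C * schwartz_norm N \<eta>"
    using assms unfolding tempered_distributions_def by blast
  have "norm (T \<eta>) \<le> \<bar>C\<bar> * B" if "\<eta> \<in> schwartz" "schwartz_norm N \<eta> \<le> B" for \<eta> B
  proof -
    have "norm (T \<eta>) \<le> C * schwartz_norm N \<eta>" by (rule C[OF that(1)])
    also have "\<dots> \<le> \<bar>C\<bar> * B"
      using that schwartz_norm_nonneg[OF that(1)] by (intro mult_mono) auto
    finally show ?thesis .
  qed
  then show ?thesis using that[of "\<bar>C\<bar>" N] by auto
qed

lemma tempered_add: "T \<in> tempered_distributions \<Longrightarrow> f \<in> schwartz \<Longrightarrow> g \<in> schwartz \<Longrightarrow> T (\<lambda>x. f x + g x) = T f + T g"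
  unfolding tempered_distributions_def by blast

lemma tempered_cmult: "T \<in> tempered_distributions \<Longrightarrow> f \<in> schwartz \<Longrightarrow> T (\<lambda>x. c * f x) = c * T f"
  unfolding tempered_distributions_def by blast

lemma tempered_diff:
  assumes "T \<in> tempered_distributions" "f \<in> schwartz" "g \<in> schwartz"
  shows "T (\<lambda>x. f x - g x) = T f - T g"
  using tempered_add[OF assms(1,2) schwartz_cmult[OF assms(3), of "-1"]]
    tempered_cmult[OF assms(1,3), of "-1"] by simp

lemma schwartz_zero: "(\<lambda>x. 0) \<in> schwartz"
  by (rule test_schwartz, rule testI[of _ 0]) (auto simp: smooth_const)

lemma tempered_sum:
  assumes "T \<in> tempered_distributions" "finite V" "\<And>v. f v \<in> schwartz"
  shows "(\<lambda>x. \<Sum>v\<in>V. c v * f v x) \<in> schwartz \<and> T (\<lambda>x. \<Sum>v\<in>V. c v * f v x) = (\<Sum>v\<in>V. c v * T (f v))"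
  using assms(2)
proof (induction V rule: finite_induct)
  case empty
  then show ?case using tempered_cmult[OF assms(1) schwartz_zero, of 0] schwartz_zero by simp
next
  case (insert v V)
  then show ?case
    using schwartz_add[OF schwartz_cmult[OF assms(3)[of v], of "c v"]]
      tempered_add[OF assms(1) schwartz_cmult[OF assms(3)[of v], of "c v"]]
    by (simp add: tempered_cmult[OF assms(1,3)])
qed

text \<open>Composition with a simple function turns the integral into a finite linear combination,
  on which a linear functional can be evaluated without continuity.\<close>

lemma integral_simple_compose:
  fixes \<eta> g :: "_ \<Rightarrow> complex"
  assumes "integrable M \<eta>" "simple_function M s"
  shows "(LINT z|M. \<eta> z * g (s z)) = (\<Sum>v\<in>s ` space M. (LINT z|M. \<eta> z * indicator (s -` {v} \<inter> space M) z) * g v)"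
    and "integrable M (\<lambda>z. \<eta> z * g (s z))"
proof -
  have fin: "finite (s ` space M)" using assms(2) by (simp add: simple_function_def)
  have eq: "\<eta> z * g (s z) = (\<Sum>v\<in>s ` space M. \<eta> z * indicator (s -` {v} \<inter> space M) z * g v)" if "z \<in> space M" for z
  proof -
    have "(\<Sum>v\<in>s ` space M. \<eta> z * indicator (s -` {v} \<inter> space M) z * g v)
      = (\<Sum>v\<in>s ` space M. if v = s z then \<eta> z * g v else 0)"
      by (rule sum.cong) (use that in \<open>auto simp: indicator_def\<close>)
    then show ?thesis using fin that by simp
  qed
  have int: "integrable M (\<lambda>z. \<eta> z * indicator (s -` {v} \<inter> space M) z * g v)" if "v \<in> s ` space M" for v
  proof -
    have "s -` {v} \<inter> space M \<in> sets M" using assms(2) that by (auto simp: simple_function_def)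
    then have "integrable M (\<lambda>z. indicator (s -` {v} \<inter> space M) z *\<^sub>R \<eta> z)"
      using assms(1) by (rule integrable_mult_indicator)
    moreover have "(\<lambda>z. indicator (s -` {v} \<inter> space M) z *\<^sub>R \<eta> z) = (\<lambda>z. \<eta> z * indicator (s -` {v} \<inter> space M) z)"
      by (auto simp: indicator_def fun_eq_iff)
    ultimately show ?thesis by simp
  qed
  have "(LINT z|M. \<eta> z * g (s z)) = (LINT z|M. (\<Sum>v\<in>s ` space M. \<eta> z * indicator (s -` {v} \<inter> space M) z * g v))"
    by (rule Bochner_Integration.integral_cong) (use eq in auto)
  also have "\<dots> = (\<Sum>v\<in>s ` space M. (LINT z|M. \<eta> z * indicator (s -` {v} \<inter> space M) z * g v))"
    by (rule Bochner_Integration.integral_sum) (rule int)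
  finally show "(LINT z|M. \<eta> z * g (s z)) = (\<Sum>v\<in>s ` space M. (LINT z|M. \<eta> z * indicator (s -` {v} \<inter> space M) z) * g v)" by simp
  show "integrable M (\<lambda>z. \<eta> z * g (s z))"
    by (subst Bochner_Integration.integrable_cong[OF refl eq]) (auto intro!: Bochner_Integration.integrable_sum int)
qed

section \<open>Translates of a kernel under a tempered distribution\<close>

lemma tempered_translate_lipschitz:
  fixes \<kappa> :: "real ^ 'n::finite \<Rightarrow> complex"
  assumes "T \<in> tempered_distributions" "\<kappa> \<in> schwartz"
  shows "\<exists>C\<ge>0. \<exists>N. \<forall>z z'. norm (T (\<lambda>x. \<kappa> (x - z)) - T (\<lambda>x. \<kappa> (x - z'))) \<le> C * (norm (z - z') * (1 + norm z + norm z') ^ N)"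
proof -
  obtain C N where C: "C \<ge> 0" "\<And>\<eta> B. \<eta> \<in> schwartz \<Longrightarrow> schwartz_norm N \<eta> \<le> B \<Longrightarrow> norm (T \<eta>) \<le> C * B"
    using tempered_bound[OF assms(1)] by metis
  obtain D where D: "D \<ge> 0" "\<And>z z'. schwartz_norm N (\<lambda>x. \<kappa> (x - z) - \<kappa> (x - z')) \<le> D * (norm (z - z') * (1 + norm z + norm z') ^ N)"
    using schwartz_norm_translate_diff[OF assms(2), of N] by auto
  have "norm (T (\<lambda>x. \<kappa> (x - z)) - T (\<lambda>x. \<kappa> (x - z'))) \<le> C * (D * (norm (z - z') * (1 + norm z + norm z') ^ N))" for z z'
    using C(2)[OF schwartz_diff[OF schwartz_translate[OF assms(2)] schwartz_translate[OF assms(2)]] D(2)[of z z']]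
      tempered_diff[OF assms(1) schwartz_translate[OF assms(2)] schwartz_translate[OF assms(2)]] by simp
  then show ?thesis using C D by (intro exI[of _ "C * D"] conjI exI[of _ N]) (auto simp: mult.assoc)
qed

text \<open>The Lipschitz estimate is compared with z = 0; the factor |z| in it accounts for the
  additional power of the weight.\<close>

lemma tempered_translate_growth:
  fixes \<kappa> :: "real ^ 'n::finite \<Rightarrow> complex"
  assumes "T \<in> tempered_distributions" "\<kappa> \<in> schwartz"
  shows "\<exists>C\<ge>0. \<exists>N. \<forall>z. norm (T (\<lambda>x. \<kappa> (x - z))) \<le> C * (1 + norm z) ^ N"
proof -
  let ?P = "\<lambda>z. T (\<lambda>x. \<kappa> (x - z))"
  obtain C N where C: "C \<ge> 0" "\<And>z z'. norm (?P z - ?P z') \<le> C * (norm (z - z') * (1 + norm z + norm z') ^ N)"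
    using tempered_translate_lipschitz[OF assms] by metis
  have "norm (?P z) \<le> (norm (?P 0) + C) * (1 + norm z) ^ Suc N" for z
  proof -
    have "norm (?P z) \<le> norm (?P 0) + norm (?P z - ?P 0)" by (rule norm_triangle_sub)
    also have "\<dots> \<le> norm (?P 0) * 1 + C * (norm z * (1 + norm z) ^ N)" using C(2)[of z 0] by simp
    also have "\<dots> \<le> norm (?P 0) * (1 + norm z) ^ Suc N + C * ((1 + norm z) * (1 + norm z) ^ N)"
      by (intro add_mono mult_left_mono mult_right_mono C(1) one_le_power) auto
    finally show ?thesis by (simp add: algebra_simps)
  qed
  then show ?thesis using C(1) by (intro exI[of _ "norm (?P 0) + C"] conjI exI[of _ "Suc N"]) auto
qed

lemma tempered_translate_continuous:
  fixes \<kappa> :: "real ^ 'n::finite \<Rightarrow> complex"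
  assumes "T \<in> tempered_distributions" "\<kappa> \<in> schwartz"
  shows "continuous_on S (\<lambda>z. T (\<lambda>x. \<kappa> (x - z)))"
proof -
  let ?P = "\<lambda>z. T (\<lambda>x. \<kappa> (x - z))"
  obtain C N where C: "C \<ge> 0" "\<And>z z'. norm (?P z - ?P z') \<le> C * (norm (z - z') * (1 + norm z + norm z') ^ N)"
    using tempered_translate_lipschitz[OF assms] by metis
  have "isCont ?P z" for z
    unfolding isCont_def
  proof (rule LIM_zero_cancel, rule Lim_null_comparison)
    show "\<forall>\<^sub>F y in at z. norm (?P y - ?P z) \<le> C * (norm (y - z) * (1 + norm y + norm z) ^ N)"
      using C(2) by simp
    show "((\<lambda>y. C * (norm (y - z) * (1 + norm y + norm z) ^ N)) \<longlongrightarrow> 0) (at z)"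
      by (rule tendsto_eq_intros refl | simp)+
  qed
  then show ?thesis by (simp add: continuous_at_imp_continuous_on)
qed

lemma integrable_polynomial_growth:
  fixes \<eta> P :: "real ^ 'n::finite \<Rightarrow> complex"
  assumes "rapidly_decreasing \<eta>" "P \<in> borel_measurable lebesgue" "\<And>z. norm (P z) \<le> C * (1 + norm z) ^ N"
  shows "integrable lebesgue (\<lambda>z. \<eta> z * P z)"
proof (rule Bochner_Integration.integrable_bound)
  show "integrable lebesgue (\<lambda>z. C * ((1 + norm z) ^ N * norm (\<eta> z)))"
    using rapidly_decreasingD(2)[OF assms(1)] by simp
  show "(\<lambda>z. \<eta> z * P z) \<in> borel_measurable lebesgue"
    using rapidly_decreasingD(1)[OF assms(1)] assms(2) by (rule borel_measurable_times)
  show "AE z in lebesgue. norm (\<eta> z * P z) \<le> norm (C * ((1 + norm z) ^ N * norm (\<eta> z)))"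
  proof (rule AE_I2)
    fix z
    have "norm (\<eta> z) * norm (P z) \<le> norm (\<eta> z) * (C * (1 + norm z) ^ N)"
      by (rule mult_left_mono[OF assms(3)]) simp
    also have "\<dots> \<le> norm (C * ((1 + norm z) ^ N * norm (\<eta> z)))" by (simp add: mult_ac)
    finally show "norm (\<eta> z * P z) \<le> norm (C * ((1 + norm z) ^ N * norm (\<eta> z)))" by (simp only: norm_mult)
  qed
qed

text \<open>By linearity the identity holds with \<open>z\<close> replaced by a simple function \<open>s i z\<close> inside
  \<open>\<kappa>\<close>; let \<open>s i z\<close> tend to \<open>z\<close>.\<close>

theorem tempered_interchange:
  fixes \<kappa> \<eta> :: "real ^ 'n::finite \<Rightarrow> complex"
  assumes T: "T \<in> tempered_distributions" and \<kappa>: "\<kappa> \<in> schwartz" and \<eta>: "rapidly_decreasing \<eta>"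
  shows "integrable lebesgue (\<lambda>z. \<eta> z * T (\<lambda>x. \<kappa> (x - z)))"
    and "T (\<lambda>x. LINT z|lebesgue. \<eta> z * \<kappa> (x - z)) = (LINT z|lebesgue. \<eta> z * T (\<lambda>x. \<kappa> (x - z)))"
proof -
  define P where "P z = T (\<lambda>x. \<kappa> (x - z))" for z
  have Pm: "P \<in> borel_measurable lebesgue"
    unfolding P_def using tempered_translate_continuous[OF T \<kappa>]
    by (intro borel_measurable_lebesgueI borel_measurable_continuous_onI)
  obtain N0 C0 where "\<And>z. norm (P z) \<le> C0 * (1 + norm z) ^ N0"
    using tempered_translate_growth[OF T \<kappa>] unfolding P_def by metis
  from integrable_polynomial_growth[OF \<eta> Pm this]
  have iP: "integrable lebesgue (\<lambda>z. \<eta> z * P z)" .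
  then show "integrable lebesgue (\<lambda>z. \<eta> z * T (\<lambda>x. \<kappa> (x - z)))" by (simp add: P_def)
  obtain C1 N1 where C1: "C1 \<ge> 0" "\<And>z z'. norm (P z - P z') \<le> C1 * (norm (z - z') * (1 + norm z + norm z') ^ N1)"
    using tempered_translate_lipschitz[OF T \<kappa>] unfolding P_def by metis
  obtain C2 N2 where C2: "C2 \<ge> 0" "\<And>\<eta> B. \<eta> \<in> schwartz \<Longrightarrow> schwartz_norm N2 \<eta> \<le> B \<Longrightarrow> norm (T \<eta>) \<le> C2 * B"
    using tempered_bound[OF T] by metis
  note \<eta>D = rapidly_decreasingD[OF \<eta>]
  have idm: "(\<lambda>z :: real ^ 'n. z) \<in> borel_measurable lebesgue"
    by (rule borel_measurable_lebesgueI) simp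
  \<comment> \<open>Simple functions tending to the identity. The bound |s_i z| \<le> 2 |z| is what
    makes dominated convergence with polynomial weights possible.\<close>
  obtain s :: "nat \<Rightarrow> real ^ 'n \<Rightarrow> real ^ 'n" where s: "\<And>i. simple_function lebesgue (s i)"
      "\<And>z. (\<lambda>i. s i z) \<longlonglongrightarrow> z" "\<And>i z. norm (s i z) \<le> 2 * norm z"
    using borel_measurable_implies_sequence_metric[OF idm, of 0] by auto
  have sm: "s i \<in> borel_measurable lebesgue" for i
    using s(1) by (rule borel_measurable_simple_function)
  \<comment> \<open>Measures the distance of s_i from the identity with the polynomial weight of the
    Lipschitz estimates. It is dominated because |z| + |s_i z| \<le> 3 |z|, and it controls both
    limits below.\<close>
  define w where "w N i z = norm (\<eta> z) * (norm (z - s i z) * (1 + norm z + norm (s i z)) ^ N)" for N i z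
  have wm: "w N i \<in> borel_measurable lebesgue" for N i
    unfolding w_def using \<eta>D(1) sm idm
    by (intro borel_measurable_times borel_measurable_norm borel_measurable_power borel_measurable_add borel_measurable_diff) auto
  have wb: "norm (w N i z) \<le> 3 ^ Suc N * ((1 + norm z) ^ Suc N * norm (\<eta> z))" for N i z
  proof -
    have a: "norm (z - s i z) \<le> 3 * (1 + norm z)"
      using norm_triangle_ineq4[of z "s i z"] s(3)[of i z] by simp
    have b: "(1 + norm z + norm (s i z)) ^ N \<le> (3 * (1 + norm z)) ^ N"
      using s(3)[of i z] norm_ge_zero[of z] by (intro power_mono) (auto intro!: add_nonneg_nonneg simp del: norm_ge_zero simp: norm_ge_zero)
    have "norm (z - s i z) * (1 + norm z + norm (s i z)) ^ N \<le> (3 * (1 + norm z)) * (3 * (1 + norm z)) ^ N"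
      by (rule mult_mono[OF a b]) auto
    then have "norm (\<eta> z) * (norm (z - s i z) * (1 + norm z + norm (s i z)) ^ N) \<le> norm (\<eta> z) * ((3 * (1 + norm z)) * (3 * (1 + norm z)) ^ N)"
      by (rule mult_left_mono) simp
    then show ?thesis unfolding w_def power_mult_distrib power_Suc by (simp add: abs_mult mult_ac algebra_simps)
  qed
  have wi: "integrable lebesgue (w N i)" for N i
    using wb[of N i] \<eta>D(2)[of "Suc N"]
    by (intro Bochner_Integration.integrable_bound[OF _ wm, of "\<lambda>z. 3 ^ Suc N * ((1 + norm z) ^ Suc N * norm (\<eta> z))"] AE_I2)
       (auto intro: order_trans)
  have wlim: "(\<lambda>i. LINT z|lebesgue. w N i z) \<longlonglongrightarrow> 0" for N
  proof -
    have "(\<lambda>i. LINT z|lebesgue. w N i z) \<longlonglongrightarrow> (LINT z|(lebesgue :: (real ^ 'n) measure). 0)"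
    proof (rule integral_dominated_convergence)
      show "integrable lebesgue (\<lambda>z. 3 ^ Suc N * ((1 + norm z) ^ Suc N * norm (\<eta> z)))"
        using \<eta>D(2)[of "Suc N"] by simp
      show "AE z in lebesgue. (\<lambda>i. w N i z) \<longlonglongrightarrow> 0"
      proof (rule AE_I2)
        fix z
        have "(\<lambda>i. w N i z) \<longlonglongrightarrow> norm (\<eta> z) * (norm (z - z) * (1 + norm z + norm z) ^ N)"
          unfolding w_def by (intro tendsto_intros s(2))
        then show "(\<lambda>i. w N i z) \<longlonglongrightarrow> 0" by simp
      qed
    qed (use wm wb in auto)
    then show ?thesis by simp
  qed
  define F where "F i x = (LINT z|lebesgue. \<eta> z * \<kappa> (x - s i z))" for i x
  define G where "G x = (LINT z|lebesgue. \<eta> z * \<kappa> (x - z))" for x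
  have GS: "G \<in> schwartz" unfolding G_def by (rule convolution_schwartz[OF \<kappa> \<eta>])
  have FS: "F i \<in> schwartz" and TF: "T (F i) = (LINT z|lebesgue. \<eta> z * P (s i z))" for i
  proof -
    let ?c = "\<lambda>v. LINT z|lebesgue. \<eta> z * indicator (s i -` {v}) z"
    have "F i x = (\<Sum>v\<in>range (s i). ?c v * \<kappa> (x - v))" for x
      using integral_simple_compose(1)[OF \<eta>D(3) s(1)[of i], of "\<lambda>v. \<kappa> (x - v)"] by (simp add: F_def)
    then have F: "F i = (\<lambda>x. \<Sum>v\<in>range (s i). ?c v * \<kappa> (x - v))" by (rule ext)
    have fin: "finite (range (s i))" using s(1)[of i] by (simp add: simple_function_def)
    note ts = tempered_sum[OF T fin, of "\<lambda>v x. \<kappa> (x - v)" ?c, OF schwartz_translate[OF \<kappa>]]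
    show "F i \<in> schwartz" unfolding F using ts by blast
    have "T (F i) = (\<Sum>v\<in>range (s i). ?c v * P v)" unfolding F P_def using ts by blast
    also have "\<dots> = (LINT z|lebesgue. \<eta> z * P (s i z))"
      using integral_simple_compose(1)[OF \<eta>D(3) s(1)[of i], of P] by simp
    finally show "T (F i) = (LINT z|lebesgue. \<eta> z * P (s i z))" .
  qed
  obtain D where D: "D \<ge> 0" "\<And>i. schwartz_norm N2 (\<lambda>x. G x - F i x) \<le> D * (LINT z|lebesgue. w N2 i z)"
  proof -
    obtain D where D: "D \<ge> 0" "\<And>(\<eta> :: real ^ 'n \<Rightarrow> complex) (s :: real ^ 'n \<Rightarrow> real ^ 'n) t. integrable lebesgue \<eta> \<longrightarrow> s \<in> borel_measurable lebesgue \<longrightarrow> t \<in> borel_measurable lebesgue \<longrightarrow>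
      integrable lebesgue (\<lambda>z. norm (\<eta> z) * (norm (s z - t z) * (1 + norm (s z) + norm (t z)) ^ N2)) \<longrightarrow>
      schwartz_norm N2 (\<lambda>x. (LINT z|lebesgue. \<eta> z * \<kappa> (x - s z)) - (LINT z|lebesgue. \<eta> z * \<kappa> (x - t z)))
      \<le> D * (LINT z|lebesgue. norm (\<eta> z) * (norm (s z - t z) * (1 + norm (s z) + norm (t z)) ^ N2))"
      using schwartz_norm_superposition_diff[OF \<kappa>, of N2] by blast
    have "schwartz_norm N2 (\<lambda>x. G x - F i x) \<le> D * (LINT z|lebesgue. w N2 i z)" for i
      using D(2)[of \<eta> "\<lambda>z. z" "s i"] \<eta>D(3) sm[of i] idm wi[of N2 i] unfolding G_def F_def w_def by blast
    with D(1) show ?thesis using that by blast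
  qed
  \<comment> \<open>Continuity of T: F i tends to G in the Schwartz norm that bounds T.\<close>
  have "(\<lambda>i. T (F i)) \<longlonglongrightarrow> T G"
  proof (rule LIM_zero_cancel, rule Lim_null_comparison)
    show "\<forall>\<^sub>F i in sequentially. norm (T (F i) - T G) \<le> C2 * (D * (LINT z|lebesgue. w N2 i z))"
    proof (rule always_eventually, rule allI)
      fix i
      have "norm (T (\<lambda>x. G x - F i x)) \<le> C2 * (D * (LINT z|lebesgue. w N2 i z))"
        by (rule C2(2)[OF schwartz_diff[OF GS FS] D(2)])
      then show "norm (T (F i) - T G) \<le> C2 * (D * (LINT z|lebesgue. w N2 i z))"
        by (simp add: tempered_diff[OF T GS FS] norm_minus_commute)
    qed
    show "(\<lambda>i. C2 * (D * (LINT z|lebesgue. w N2 i z))) \<longlonglongrightarrow> 0"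
      using tendsto_mult_right_zero[OF tendsto_mult_right_zero[OF wlim]] .
  qed
  \<comment> \<open>The same numbers as integrals of P (s i z), with P locally Lipschitz and of
    polynomial growth.\<close>
  moreover have "(\<lambda>i. T (F i)) \<longlonglongrightarrow> (LINT z|lebesgue. \<eta> z * P z)"
  proof (rule LIM_zero_cancel, rule Lim_null_comparison)
    show "\<forall>\<^sub>F i in sequentially. norm (T (F i) - (LINT z|lebesgue. \<eta> z * P z)) \<le> C1 * (LINT z|lebesgue. w N1 i z)"
    proof (rule always_eventually, rule allI)
      fix i
      have "T (F i) - (LINT z|lebesgue. \<eta> z * P z) = (LINT z|lebesgue. \<eta> z * P (s i z) - \<eta> z * P z)"
        unfolding TF by (rule Bochner_Integration.integral_diff[symmetric])
          (rule integral_simple_compose(2)[OF \<eta>D(3) s(1)] iP)+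
      also have "norm \<dots> \<le> (LINT z|lebesgue. C1 * w N1 i z)"
      proof (rule integral_norm_le)
        show "integrable lebesgue (\<lambda>z. C1 * w N1 i z)" using wi by simp
        fix z
        have "norm (\<eta> z * P (s i z) - \<eta> z * P z) = norm (\<eta> z) * norm (P z - P (s i z))"
          by (simp add: right_diff_distrib[symmetric] norm_mult norm_minus_commute)
        also have "\<dots> \<le> norm (\<eta> z) * (C1 * (norm (z - s i z) * (1 + norm z + norm (s i z)) ^ N1))"
          by (intro mult_left_mono C1(2)) simp
        finally show "norm (\<eta> z * P (s i z) - \<eta> z * P z) \<le> C1 * w N1 i z" by (simp add: w_def mult_ac)
      qed
      finally show "norm (T (F i) - (LINT z|lebesgue. \<eta> z * P z)) \<le> C1 * (LINT z|lebesgue. w N1 i z)" by simp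
    qed
    show "(\<lambda>i. C1 * (LINT z|lebesgue. w N1 i z)) \<longlonglongrightarrow> 0" using tendsto_mult_right_zero[OF wlim] .
  qed
  ultimately have "T G = (LINT z|lebesgue. \<eta> z * P z)" by (rule LIMSEQ_unique)
  then show "T (\<lambda>x. LINT z|lebesgue. \<eta> z * \<kappa> (x - z)) = (LINT z|lebesgue. \<eta> z * T (\<lambda>x. \<kappa> (x - z)))"
    by (simp add: G_def[abs_def] P_def)
qed

section \<open>The Fourier transform of test functions\<close>

lemma integral_affine:
  fixes f :: "'a::euclidean_space \<Rightarrow> complex"
  assumes "f \<in> borel_measurable borel" "c \<noteq> 0"
  shows "(LINT x|lebesgue. f x) = of_real (\<bar>c\<bar> ^ DIM('a)) * (LINT x|lebesgue. f (t + c *\<^sub>R x))"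
proof -
  have f: "f \<in> borel_measurable lborel" using assms(1) by simp
  have "(LINT x|lebesgue. f x) = (LINT x|lborel. f x)" by (rule integral_completion[OF f])
  also have "\<dots> = (LINT x|density (distr lborel borel (\<lambda>x. t + c *\<^sub>R x)) (\<lambda>_. \<bar>c\<bar> ^ DIM('a)). f x)"
    by (subst lborel_affine[OF assms(2), of t]) rule
  also have "\<dots> = (LINT x|distr lborel borel (\<lambda>x. t + c *\<^sub>R x). (\<bar>c\<bar> ^ DIM('a)) *\<^sub>R f x)"
    using assms(1) by (intro integral_density) auto
  also have "\<dots> = (LINT x|lborel. (\<bar>c\<bar> ^ DIM('a)) *\<^sub>R f (t + c *\<^sub>R x))"
    using assms(1) by (intro integral_distr) auto
  also have "\<dots> = of_real (\<bar>c\<bar> ^ DIM('a)) * (LINT x|lborel. f (t + c *\<^sub>R x))"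
    by (simp add: scaleR_conv_of_real)
  also have "(LINT x|lborel. f (t + c *\<^sub>R x)) = (LINT x|lebesgue. f (t + c *\<^sub>R x))"
    by (rule integral_completion[symmetric])
      (use measurable_compose[OF _ assms(1), of "\<lambda>x. t + c *\<^sub>R x" lborel] in auto)
  finally show ?thesis .
qed

text \<open>The exchange is used for the exponential kernel, of modulus 1, so |f x| |g y| is an
  integrable majorant. Fubini's theorem is applied on \<open>lborel\<close>, to which Borel
  measurability of the data reduces all the integrals.\<close>

lemma kernel_Fubini:
  fixes f g :: "'a::euclidean_space \<Rightarrow> complex" and k :: "'a \<Rightarrow> 'a \<Rightarrow> complex"
  assumes f: "f \<in> borel_measurable borel" "integrable lebesgue f"
    and g: "g \<in> borel_measurable borel" "integrable lebesgue g"
    and k: "case_prod k \<in> borel_measurable borel" "\<And>x y. norm (k x y) \<le> 1"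
  shows "(LINT x|lebesgue. f x * (LINT y|lebesgue. k x y * g y)) = (LINT y|lebesgue. g y * (LINT x|lebesgue. k x y * f x))"
proof -
  let ?P = "lborel \<Otimes>\<^sub>M lborel :: ('a \<times> 'a) measure"
  have k': "case_prod k \<in> borel_measurable ?P"
    using k(1) by (subst measurable_cong_sets[OF sets_pair_measure_cong refl]) (auto simp: borel_prod)
  have kP: "(\<lambda>p. k (fst p) (snd p)) \<in> borel_measurable ?P" using k' by (simp add: case_prod_unfold)
  have kP': "(\<lambda>p. k (snd p) (fst p)) \<in> borel_measurable ?P"
    using measurable_compose[OF measurable_pair_swap' k'] by (simp add: case_prod_unfold)
  have fP: "(\<lambda>p. f (fst p)) \<in> borel_measurable ?P" "(\<lambda>p. f (snd p)) \<in> borel_measurable ?P"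
    using f(1) measurable_compose[OF measurable_fst] measurable_compose[OF measurable_snd] by fastforce+
  have gP: "(\<lambda>p. g (snd p)) \<in> borel_measurable ?P"
    using g(1) measurable_compose[OF measurable_snd] by fastforce
  have kx: "k x \<in> borel_measurable borel" and ky: "(\<lambda>x. k x y) \<in> borel_measurable borel" for x y
    using measurable_compose[OF measurable_Pair1' kP] measurable_compose[OF measurable_Pair2' kP] by simp_all
  have f': "integrable lborel f" and g': "integrable lborel g"
    using f g by (simp_all add: integrable_completion)
  have mx: "(\<lambda>y. k x y * g y) \<in> borel_measurable lborel" for x using kx g by simp
  have my: "(\<lambda>x. k x y * f x) \<in> borel_measurable lborel" for y using ky f by simp
  have ifg: "integrable lborel (\<lambda>y. k x y * g y)" for x
    by (rule Bochner_Integration.integrable_bound[OF g' mx], rule AE_I2)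
      (simp add: k(2) norm_mult mult_left_le_one_le)
  have m: "(\<lambda>p. f (fst p) * (k (fst p) (snd p) * g (snd p))) \<in> borel_measurable ?P"
    by (intro borel_measurable_times fP kP gP)
  have int: "integrable ?P (\<lambda>(x, y). f x * (k x y * g y))"
  proof (rule lborel_pair.Fubini_integrable)
    show "(\<lambda>(x, y). f x * (k x y * g y)) \<in> borel_measurable ?P"
      using m by (simp add: case_prod_unfold)
    show "AE x in lborel. integrable lborel (\<lambda>y. case (x, y) of (x, y) \<Rightarrow> f x * (k x y * g y))"
      using ifg by simp
    show "integrable lborel (\<lambda>x. LINT y|lborel. norm (case (x, y) of (x, y) \<Rightarrow> f x * (k x y * g y)))"
    proof (rule Bochner_Integration.integrable_bound)
      show "integrable lborel (\<lambda>x. norm (f x) * (LINT y|lborel. norm (g y)))" using f' by simp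
      have "(\<lambda>(x, y). norm (f x * (k x y * g y))) \<in> borel_measurable ?P"
        unfolding case_prod_unfold by (rule measurable_compose[OF m borel_measurable_norm])
      from lborel.borel_measurable_lebesgue_integral[OF this]
      show "(\<lambda>x. LINT y|lborel. norm (case (x, y) of (x, y) \<Rightarrow> f x * (k x y * g y))) \<in> borel_measurable lborel"
        by simp
      show "AE x in lborel. norm (LINT y|lborel. norm (case (x, y) of (x, y) \<Rightarrow> f x * (k x y * g y))) \<le> norm (norm (f x) * (LINT y|lborel. norm (g y)))"
      proof (rule AE_I2)
        fix x
        have "(LINT y|lborel. norm (f x * (k x y * g y))) \<le> (LINT y|lborel. norm (f x) * norm (g y))"
        proof (rule integral_mono)
          show "integrable lborel (\<lambda>y. norm (f x * (k x y * g y)))" using ifg by simp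
          show "integrable lborel (\<lambda>y. norm (f x) * norm (g y))" using g' by simp
          show "norm (f x * (k x y * g y)) \<le> norm (f x) * norm (g y)" for y
            using k(2)[of x y] by (simp add: norm_mult mult_left_mono mult_left_le_one_le)
        qed
        moreover have "(LINT y|lborel. norm (f x * (k x y * g y))) \<ge> 0" by simp
        moreover have "(LINT y|lborel. norm (g y)) \<ge> 0" by simp
        ultimately show "norm (LINT y|lborel. norm (case (x, y) of (x, y) \<Rightarrow> f x * (k x y * g y))) \<le> norm (norm (f x) * (LINT y|lborel. norm (g y)))"
          by (simp add: abs_mult)
      qed
    qed
  qed
  have "(\<lambda>(x, y). k x y * g y) \<in> borel_measurable ?P" "(\<lambda>(y, x). k x y * f x) \<in> borel_measurable ?P"
    unfolding case_prod_unfold by (intro borel_measurable_times kP kP' fP gP)+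
  from this[THEN lborel.borel_measurable_lebesgue_integral]
  have mf: "(\<lambda>x. f x * (LINT y|lborel. k x y * g y)) \<in> borel_measurable lborel"
    and mg: "(\<lambda>y. g y * (LINT x|lborel. k x y * f x)) \<in> borel_measurable lborel"
    using f g by simp_all
  have "(LINT x|lebesgue. f x * (LINT y|lebesgue. k x y * g y)) = (LINT x|lborel. f x * (LINT y|lborel. k x y * g y))"
    unfolding integral_completion[OF mx] by (rule integral_completion[OF mf])
  also have "\<dots> = (LINT x|lborel. (LINT y|lborel. f x * (k x y * g y)))" by simp
  also have "\<dots> = (LINT y|lborel. (LINT x|lborel. f x * (k x y * g y)))"
    by (rule lborel_pair.Fubini_integral[OF int, symmetric])
  also have "\<dots> = (LINT y|lborel. g y * (LINT x|lborel. k x y * f x))"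
    by (simp only: integral_mult_right_zero[symmetric] mult_ac)
  also have "\<dots> = (LINT y|lebesgue. g y * (LINT x|lebesgue. k x y * f x))"
    unfolding integral_completion[OF my] by (rule integral_completion[OF mg, symmetric])
  finally show ?thesis .
qed

text \<open>The Fourier transform without the factor (2 pi)^(-d/2), so that dilation,
  differentiation and convolution carry no powers of it; the two factors reappear as one in
  \<open>fourier_mult_inv_fourier\<close>.\<close>

definition ft :: "(real ^ 'n::finite \<Rightarrow> complex) \<Rightarrow> real ^ 'n \<Rightarrow> complex" where
  "ft f x = (LINT \<xi>|lebesgue. cis (- (x \<bullet> \<xi>)) * f \<xi>)"

lemma cis_borel: "g \<in> borel_measurable borel \<Longrightarrow> (\<lambda>x. cis (g x)) \<in> borel_measurable borel"
  by (rule borel_measurable_continuous_on[of cis]) (auto intro: continuous_intros)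

lemma integrable_cis_mult:
  fixes f :: "'a::euclidean_space \<Rightarrow> complex"
  assumes "integrable lebesgue f" "g \<in> borel_measurable borel"
  shows "integrable lebesgue (\<lambda>\<xi>. cis (g \<xi>) * f \<xi>)"
proof (rule Bochner_Integration.integrable_bound[OF assms(1)])
  show "(\<lambda>\<xi>. cis (g \<xi>) * f \<xi>) \<in> borel_measurable lebesgue"
    by (intro borel_measurable_times borel_measurable_lebesgueI cis_borel assms(2)
        borel_measurable_integrable[OF assms(1)])
qed (simp add: norm_mult)

lemma cis_second_order: "norm (cis t - 1 - \<i> * of_real t) \<le> t\<^sup>2"
  using Taylor_exp[of "\<i> * of_real t" 1] by (simp add: cis_conv_exp norm_mult power2_eq_square diff_diff_eq)

lemma test_integrable: "f \<in> test_functions \<Longrightarrow> integrable lebesgue f"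
  by (simp add: schwartz_integrable test_schwartz)

lemma test_borel: "f \<in> test_functions \<Longrightarrow> f \<in> borel_measurable borel"
  by (simp add: schwartz_borel test_schwartz)

lemma test_coordinate_mult:
  "\<psi> \<in> test_functions \<Longrightarrow> (\<lambda>\<xi>. c * of_real (\<xi> $ i) * \<psi> \<xi>) \<in> test_functions"
  by (intro test_mult smooth_mult smooth_const smooth_coordinate)

text \<open>The second-order expansion of the exponential at the increment -(h \<bullet> \<xi>) is
  integrated against \<psi>, whose second moment is finite.\<close>

lemma ft_has_derivative:
  fixes \<psi> :: "real ^ 'n::finite \<Rightarrow> complex"
  assumes "\<psi> \<in> test_functions"
  shows "(ft \<psi> has_derivative (\<lambda>h. \<Sum>i\<in>UNIV. h $ i *\<^sub>R ft (\<lambda>\<xi>. - \<i> * of_real (\<xi> $ i) * \<psi> \<xi>) x)) (at x)"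
    (is "(_ has_derivative ?D) _")
proof -
  let ?e = "\<lambda>x \<xi>. cis (- (x \<bullet> \<xi>))"
  have int: "integrable lebesgue (\<lambda>\<xi>. ?e x \<xi> * f \<xi>)" if "f \<in> test_functions" for f x
    by (rule integrable_cis_mult[OF test_integrable[OF that]]) simp
  note int' = int[OF test_coordinate_mult[OF assms, of "- \<i>"]]
  have iw: "integrable lebesgue (\<lambda>\<xi>. (1 + norm \<xi>) ^ 2 * norm (\<psi> \<xi>))"
    by (rule rapidly_decreasingD(2)[OF schwartz_rapidly_decreasing[OF test_schwartz[OF assms]]])
  define A where "A = (LINT \<xi>|lebesgue. (1 + norm \<xi>) ^ 2 * norm (\<psi> \<xi>))"
  have est: "norm (ft \<psi> (x + h) - ft \<psi> x - ?D h) \<le> A * (norm h)\<^sup>2" for h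
  proof -
    let ?R = "\<lambda>\<xi>. ?e (x + h) \<xi> * \<psi> \<xi> - ?e x \<xi> * \<psi> \<xi> - (\<Sum>i\<in>UNIV. h $ i *\<^sub>R (?e x \<xi> * (- \<i> * of_real (\<xi> $ i) * \<psi> \<xi>)))"
    have "ft \<psi> (x + h) - ft \<psi> x - ?D h = (LINT \<xi>|lebesgue. ?R \<xi>)"
      unfolding ft_def
      by (simp only: int[OF assms] int' Bochner_Integration.integral_diff Bochner_Integration.integral_sum
          Bochner_Integration.integrable_diff Bochner_Integration.integrable_sum integrable_scaleR_right
          integral_scaleR_right)
    also have "norm \<dots> \<le> (LINT \<xi>|lebesgue. (norm h)\<^sup>2 * ((1 + norm \<xi>) ^ 2 * norm (\<psi> \<xi>)))"
    proof (rule integral_norm_le)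
      show "integrable lebesgue (\<lambda>\<xi>. (norm h)\<^sup>2 * ((1 + norm \<xi>) ^ 2 * norm (\<psi> \<xi>)))" using iw by simp
      fix \<xi>
      have "(\<Sum>i\<in>UNIV. h $ i *\<^sub>R (?e x \<xi> * (- \<i> * of_real (\<xi> $ i) * \<psi> \<xi>))) = ?e x \<xi> * (- \<i> * of_real (h \<bullet> \<xi>) * \<psi> \<xi>)"
        by (simp add: inner_vec_def sum_distrib_left sum_distrib_right scaleR_conv_of_real mult_ac sum_negf)
      moreover have "?e (x + h) \<xi> = ?e x \<xi> * cis (- (h \<bullet> \<xi>))"
        by (simp add: inner_add_left cis_mult)
      ultimately have "?R \<xi> = ?e x \<xi> * \<psi> \<xi> * (cis (- (h \<bullet> \<xi>)) - 1 - \<i> * of_real (- (h \<bullet> \<xi>)))"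
        by (simp add: algebra_simps)
      then have "norm (?R \<xi>) = norm (\<psi> \<xi>) * norm (cis (- (h \<bullet> \<xi>)) - 1 - \<i> * of_real (- (h \<bullet> \<xi>)))"
        by (simp only: norm_mult norm_cis mult_1)
      also have "\<dots> \<le> norm (\<psi> \<xi>) * (- (h \<bullet> \<xi>))\<^sup>2" by (intro mult_left_mono cis_second_order) simp
      also have "\<dots> \<le> norm (\<psi> \<xi>) * ((norm h)\<^sup>2 * (1 + norm \<xi>)\<^sup>2)"
      proof (rule mult_left_mono)
        have "\<bar>h \<bullet> \<xi>\<bar> \<le> norm h * norm \<xi>" by (rule Cauchy_Schwarz_ineq2)
        also have "\<dots> \<le> norm h * (1 + norm \<xi>)" by (rule mult_left_mono) auto
        finally have "\<bar>h \<bullet> \<xi>\<bar>\<^sup>2 \<le> (norm h * (1 + norm \<xi>))\<^sup>2" by (rule power_mono) simp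
        then show "(- (h \<bullet> \<xi>))\<^sup>2 \<le> (norm h)\<^sup>2 * (1 + norm \<xi>)\<^sup>2" by (simp add: power_mult_distrib)
      qed simp
      finally show "norm (?R \<xi>) \<le> (norm h)\<^sup>2 * ((1 + norm \<xi>) ^ 2 * norm (\<psi> \<xi>))" by (simp add: mult_ac)
    qed
    also have "\<dots> = A * (norm h)\<^sup>2" by (simp add: A_def)
    finally show ?thesis .
  qed
  show ?thesis
    by (rule has_derivative_if_quadratic_remainder[OF _ est])
      (intro bounded_linear_sum bounded_linear_scaleR_const bounded_linear_vec_nth)
qed

lemma ft_partial_deriv:
  fixes \<psi> :: "real ^ 'n::finite \<Rightarrow> complex"
  assumes "\<psi> \<in> test_functions"
  shows "partial_deriv i (ft \<psi>) = ft (\<lambda>\<xi>. - \<i> * of_real (\<xi> $ i) * \<psi> \<xi>)"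
  using partial_deriv_eqI[OF ft_has_derivative[OF assms]] by (simp add: fun_eq_iff sum_axis_scaleR)

text \<open>Transforms of test functions are closed under differentiation, so smoothness and decay
  of all derivatives reduce to differentiability and decay of such transforms themselves.\<close>

lemma ft_iter_partial_deriv:
  assumes "\<psi> \<in> test_functions"
  shows "\<exists>\<psi>'\<in>test_functions. iter_partial_deriv is (ft \<psi>) = ft \<psi>'"
proof (induction "is")
  case (Cons i "is")
  then obtain \<psi>' where \<psi>': "\<psi>' \<in> test_functions" "iter_partial_deriv is (ft \<psi>) = ft \<psi>'" by blast
  then show ?case
    by (intro bexI[OF _ test_coordinate_mult[OF \<psi>'(1), of "- \<i>" i]]) (simp add: ft_partial_deriv)
qed (use assms in auto)

lemma ft_smooth:
  assumes "\<psi> \<in> test_functions"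
  shows "smooth (ft \<psi>)"
  unfolding smooth_def
proof (intro allI)
  fix "is" x
  obtain \<psi>' where \<psi>': "\<psi>' \<in> test_functions" "iter_partial_deriv is (ft \<psi>) = ft \<psi>'"
    using ft_iter_partial_deriv[OF assms] by blast
  show "iter_partial_deriv is (ft \<psi>) differentiable at x"
    unfolding \<psi>'(2) differentiable_def using ft_has_derivative[OF \<psi>'(1)] by blast
qed

lemma norm_ft_le:
  assumes "integrable lebesgue f"
  shows "norm (ft f x) \<le> (LINT \<xi>|lebesgue. norm (f \<xi>))"
  unfolding ft_def by (rule integral_norm_le) (use assms in \<open>auto simp: norm_mult\<close>)

lemma norm_le_all_small_imp_zero:
  fixes a :: "'a::real_normed_vector"
  assumes "\<And>t. 0 < t \<Longrightarrow> t \<le> 1 \<Longrightarrow> norm a \<le> K * t"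
  shows "a = 0"
proof -
  have "(\<lambda>n. K * inverse (real (Suc n))) \<longlonglongrightarrow> K * 0"
    by (intro tendsto_intros LIMSEQ_inverse_real_of_nat)
  moreover have "norm a \<le> K * inverse (real (Suc n))" for n
    by (rule assms) (auto simp: inverse_le_1_iff)
  ultimately have "norm a \<le> K * 0" by (intro LIMSEQ_le_const) auto
  then show ?thesis by simp
qed

text \<open>Integration by parts with difference quotients: a shift of \<psi> by t in direction i
  multiplies the transform by cis (t x_i), and the terms of first order in t are compared.\<close>

lemma ft_of_partial_deriv:
  fixes \<psi> :: "real ^ 'n::finite \<Rightarrow> complex"
  assumes "\<psi> \<in> test_functions"
  shows "ft (partial_deriv i \<psi>) x = \<i> * of_real (x $ i) * ft \<psi> x"
proof -
  let ?e = "\<lambda>\<xi>. cis (- (x \<bullet> \<xi>))" and ?D = "partial_deriv i \<psi>"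
  have int: "integrable lebesgue (\<lambda>\<xi>. ?e \<xi> * f \<xi>)" if "f \<in> test_functions" for f
    by (rule integrable_cis_mult[OF test_integrable[OF that]]) simp
  obtain R where R: "R > 0" "\<And>x. norm x > R \<Longrightarrow> \<psi> x = 0" using test_vanish[OF assms] by metis
  have RD: "?D \<xi> = 0" if "norm \<xi> > R" for \<xi>
  proof (rule zero_outside_supp)
    have "supp \<psi> \<subseteq> cball 0 R"
      unfolding supp_def using R(2) by (intro closure_minimal subsetI) (auto intro: leI)
    then show "\<xi> \<notin> supp ?D" using supp_partial[of i \<psi>] that by auto
  qed
  obtain C where C: "C \<ge> 0" "\<And>x h. norm (\<psi> (x + h) - \<psi> x - (\<Sum>i\<in>UNIV. h $ i *\<^sub>R partial_deriv i \<psi> x)) \<le> C * (norm h)\<^sup>2"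
    using schwartz_second_order[OF test_schwartz[OF assms]] by metis
  \<comment> \<open>For t \<le> 1 both \<psi> and its shift vanish outside the ball of radius R + 1,
    so the pointwise remainder C t^2 is integrated over a set of volume V.\<close>
  define V where "V = (LINT \<xi>|lebesgue. indicator (cball (0 :: real ^ 'n) (R + 1)) \<xi> :: real)"
  have iV: "integrable lebesgue (\<lambda>\<xi> :: real ^ 'n. indicator (cball 0 (R + 1)) \<xi> :: real)"
    using lmeasurable_cball[of "0 :: real ^ 'n" "R + 1"] by (simp add: fmeasurable_def)
  have *: "norm (of_real t * ft ?D x - (cis (t * x $ i) - 1) * ft \<psi> x) \<le> C * V * t\<^sup>2" if t: "0 < t" "t \<le> 1" for t
  proof -
    let ?h = "t *\<^sub>R axis i 1 :: real ^ 'n"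
    have nh: "norm ?h = t" using t by simp
    have tr: "(\<lambda>\<xi>. \<psi> (\<xi> + ?h)) \<in> test_functions"
      using test_affine[OF assms, of 1 "- ?h"] by simp
    have "(LINT \<xi>|lebesgue. ?e \<xi> * \<psi> (\<xi> + ?h)) = cis (t * x $ i) * ft \<psi> x"
    proof -
      have "(LINT \<xi>|lebesgue. ?e \<xi> * \<psi> (\<xi> + ?h)) = (LINT \<xi>|lebesgue. ?e (- ?h + \<xi>) * \<psi> (- ?h + \<xi> + ?h))"
        using integral_affine[of "\<lambda>\<xi>. ?e \<xi> * \<psi> (\<xi> + ?h)" 1 "- ?h"]
          borel_measurable_times[OF cis_borel test_borel[OF tr], of "\<lambda>\<xi>. - (x \<bullet> \<xi>)"]
        by simp
      also have "\<dots> = (LINT \<xi>|lebesgue. cis (t * x $ i) * (?e \<xi> * \<psi> \<xi>))"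
      proof -
        have "?e (- ?h + \<xi>) = cis (t * x $ i) * ?e \<xi>" for \<xi>
          by (simp add: cis_mult inner_diff_right inner_axis)
        moreover have "\<psi> (- ?h + \<xi> + ?h) = \<psi> \<xi>" for \<xi> by simp
        ultimately show ?thesis by (simp only: mult.assoc)
      qed
      finally show ?thesis by (simp add: ft_def)
    qed
    then have "of_real t * ft ?D x - (cis (t * x $ i) - 1) * ft \<psi> x =
        of_real t * ft ?D x - ((LINT \<xi>|lebesgue. ?e \<xi> * \<psi> (\<xi> + ?h)) - ft \<psi> x)"
      by (simp add: algebra_simps)
    also have "\<dots> = (LINT \<xi>|lebesgue. of_real t * (?e \<xi> * ?D \<xi>) - (?e \<xi> * \<psi> (\<xi> + ?h) - ?e \<xi> * \<psi> \<xi>))"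
      unfolding ft_def
      by (simp only: int[OF test_partial[OF assms]] int[OF assms] int[OF tr] Bochner_Integration.integral_diff
          Bochner_Integration.integrable_diff integrable_mult_right integral_mult_right_zero)
    also have "norm \<dots> \<le> (LINT \<xi>|lebesgue. C * t\<^sup>2 * indicator (cball (0 :: real ^ 'n) (R + 1)) \<xi>)"
    proof (rule integral_norm_le)
      show "integrable lebesgue (\<lambda>\<xi>. C * t\<^sup>2 * indicator (cball (0 :: real ^ 'n) (R + 1)) \<xi>)"
        using iV by (rule integrable_mult_right)
      fix \<xi>
      have eq: "of_real t * (?e \<xi> * ?D \<xi>) - (?e \<xi> * \<psi> (\<xi> + ?h) - ?e \<xi> * \<psi> \<xi>) = - ?e \<xi> * (\<psi> (\<xi> + ?h) - \<psi> \<xi> - of_real t * ?D \<xi>)"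
        by (simp add: algebra_simps)
      show "norm (of_real t * (?e \<xi> * ?D \<xi>) - (?e \<xi> * \<psi> (\<xi> + ?h) - ?e \<xi> * \<psi> \<xi>)) \<le> C * t\<^sup>2 * indicator (cball 0 (R + 1)) \<xi>"
      proof (cases "norm \<xi> \<le> R + 1")
        case True
        have "?h $ j = (if j = i then t else 0)" for j by (simp add: axis_def)
        then have "(\<Sum>j\<in>UNIV. ?h $ j *\<^sub>R partial_deriv j \<psi> \<xi>) = (\<Sum>j\<in>UNIV. if j = i then of_real t * ?D \<xi> else 0)"
          by (intro sum.cong) (auto simp: scaleR_conv_of_real)
        then have "(\<Sum>j\<in>UNIV. ?h $ j *\<^sub>R partial_deriv j \<psi> \<xi>) = of_real t * ?D \<xi>" by simp
        with C(2)[of \<xi> ?h] have "norm (\<psi> (\<xi> + ?h) - \<psi> \<xi> - of_real t * ?D \<xi>) \<le> C * t\<^sup>2"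
          unfolding nh by simp
        with True show ?thesis unfolding eq by (simp add: norm_mult)
      next
        case False
        then have "norm (\<xi> + ?h) > R" using norm_triangle_ineq2[of \<xi> "- ?h"] nh t by simp
        with False show ?thesis unfolding eq using R(2)[of \<xi>] R(2)[of "\<xi> + ?h"] RD[of \<xi>] by simp
      qed
    qed
    also have "\<dots> = C * V * t\<^sup>2" unfolding V_def by (simp only: integral_mult_right_zero mult_ac)
    finally show ?thesis .
  qed
  \<comment> \<open>Both errors are quadratic in t, so division by t leaves a multiple of t for
    every t in (0, 1].\<close>
  have "ft ?D x - \<i> * of_real (x $ i) * ft \<psi> x = 0"
  proof (rule norm_le_all_small_imp_zero[where K = "C * V + (x $ i)\<^sup>2 * norm (ft \<psi> x)"])
    fix t :: real assume t: "0 < t" "t \<le> 1"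
    have "of_real t * (ft ?D x - \<i> * of_real (x $ i) * ft \<psi> x) =
        (of_real t * ft ?D x - (cis (t * x $ i) - 1) * ft \<psi> x) + (cis (t * x $ i) - 1 - \<i> * of_real (t * x $ i)) * ft \<psi> x"
      by (simp add: algebra_simps)
    also have "norm \<dots> \<le> C * V * t\<^sup>2 + (t * x $ i)\<^sup>2 * norm (ft \<psi> x)"
    proof (rule order_trans[OF norm_triangle_ineq add_mono[OF *[OF t]]])
      show "norm ((cis (t * x $ i) - 1 - \<i> * of_real (t * x $ i)) * ft \<psi> x) \<le> (t * x $ i)\<^sup>2 * norm (ft \<psi> x)"
        unfolding norm_mult[of _ "ft \<psi> x"] by (rule mult_right_mono[OF cis_second_order]) simp
    qed
    also have "\<dots> = t * ((C * V + (x $ i)\<^sup>2 * norm (ft \<psi> x)) * t)" by (simp add: power2_eq_square algebra_simps)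
    finally have "t * norm (ft ?D x - \<i> * of_real (x $ i) * ft \<psi> x) \<le> t * ((C * V + (x $ i)\<^sup>2 * norm (ft \<psi> x)) * t)"
      using t by (simp only: norm_mult norm_of_real)
    then show "norm (ft ?D x - \<i> * of_real (x $ i) * ft \<psi> x) \<le> (C * V + (x $ i)\<^sup>2 * norm (ft \<psi> x)) * t"
      using t by simp
  qed
  then show ?thesis by simp
qed

text \<open>Induction on the power: 1 + |x| is at most 1 plus the sum of all |x_i|, and each factor
  x_i is traded for a derivative of \<psi>, again a test function.\<close>

lemma ft_decay:
  fixes \<psi> :: "real ^ 'n::finite \<Rightarrow> complex"
  assumes "\<psi> \<in> test_functions"
  shows "\<exists>C. \<forall>x. (1 + norm x) ^ N * norm (ft \<psi> x) \<le> C"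
  using assms
proof (induction N arbitrary: \<psi>)
  case 0
  then show ?case using norm_ft_le[OF test_integrable] by auto
next
  case (Suc N)
  obtain C where C: "\<And>x. (1 + norm x) ^ N * norm (ft \<psi> x) \<le> C" using Suc by blast
  have "\<forall>i. \<exists>C. \<forall>x. (1 + norm x) ^ N * norm (ft (partial_deriv i \<psi>) x) \<le> C"
    using Suc.IH[OF test_partial[OF Suc.prems]] by blast
  then obtain D where D: "\<And>i x. (1 + norm x) ^ N * norm (ft (partial_deriv i \<psi>) x) \<le> D i" by metis
  have "(1 + norm x) ^ Suc N * norm (ft \<psi> x) \<le> C + (\<Sum>i\<in>UNIV. D i)" for x
  proof -
    have "(1 + norm x) * ((1 + norm x) ^ N * norm (ft \<psi> x)) \<le> (1 + (\<Sum>i\<in>UNIV. \<bar>x $ i\<bar>)) * ((1 + norm x) ^ N * norm (ft \<psi> x))"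
      using norm_le_l1_cart[of x] by (intro mult_right_mono) auto
    also have "\<dots> = (1 + norm x) ^ N * norm (ft \<psi> x) + (\<Sum>i\<in>UNIV. \<bar>x $ i\<bar> * ((1 + norm x) ^ N * norm (ft \<psi> x)))"
      by (simp only: distrib_right mult_1 sum_distrib_right)
    also have "\<dots> = (1 + norm x) ^ N * norm (ft \<psi> x) + (\<Sum>i\<in>UNIV. (1 + norm x) ^ N * norm (ft (partial_deriv i \<psi>) x))"
      by (simp only: ft_of_partial_deriv[OF Suc.prems] norm_mult norm_ii norm_of_real mult_1 mult_ac)
    also have "\<dots> \<le> C + (\<Sum>i\<in>UNIV. D i)" by (intro add_mono sum_mono C D)
    finally show ?thesis by (simp add: mult.assoc)
  qed
  then show ?case by blast
qed

lemma ft_schwartz: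
  assumes "\<psi> \<in> test_functions"
  shows "ft \<psi> \<in> schwartz"
proof (rule schwartzI[OF ft_smooth[OF assms]])
  fix N "is"
  obtain \<psi>' where \<psi>': "\<psi>' \<in> test_functions" "iter_partial_deriv is (ft \<psi>) = ft \<psi>'"
    using ft_iter_partial_deriv[OF assms] by blast
  show "\<exists>C. \<forall>x. (1 + norm x) ^ N * norm (iter_partial_deriv is (ft \<psi>) x) \<le> C"
    unfolding \<psi>'(2) by (rule ft_decay[OF \<psi>'(1)])
qed

section \<open>Inversion up to a constant and its consequences\<close>

lemma ft_dilate:
  fixes \<psi> :: "real ^ 'n::finite \<Rightarrow> complex"
  assumes "\<psi> \<in> borel_measurable borel" "a > 0"
  shows "ft \<psi> x = of_real (a ^ CARD('n)) * ft (\<lambda>\<xi>. \<psi> (a *\<^sub>R \<xi>)) (a *\<^sub>R x)"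
proof -
  have "ft \<psi> x = of_real (\<bar>a\<bar> ^ DIM(real ^ 'n)) * (LINT \<xi>|lebesgue. cis (- (x \<bullet> (0 + a *\<^sub>R \<xi>))) * \<psi> (0 + a *\<^sub>R \<xi>))"
    unfolding ft_def
    by (rule integral_affine) (use assms in \<open>auto intro!: borel_measurable_times cis_borel\<close>)
  then show ?thesis using assms(2) by (simp add: ft_def)
qed

lemma test_bounded0:
  assumes "f \<in> test_functions"
  obtains M where "M \<ge> 0" "\<And>x. norm (f x) \<le> M"
  using schwartz_bound0[OF test_schwartz[OF assms], of 0] by auto

lemma cis_inner_kernel_borel:
  "(\<lambda>(x, y). cis (c * (x \<bullet> y))) \<in> borel_measurable (borel :: ('a::euclidean_space \<times> 'a) measure)"
  unfolding case_prod_unfold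
  by (rule borel_measurable_continuous_onI) (intro continuous_intros)

text \<open>Insert the factor \<phi>(a_n z), with a_n tending to 0, and exchange the integrals.
  After rescaling one has the integral of \<psi>(\<xi> + a_n v) times \<open>ft \<phi> v\<close>,
  and both sides converge by domination. The constant takes the part that the integral of the
  Gaussian has in the usual proof.\<close>

theorem ft_inversion:
  fixes \<phi> \<psi> :: "real ^ 'n::finite \<Rightarrow> complex"
  assumes \<phi>: "\<phi> \<in> test_functions" "\<phi> 0 = 1" and \<psi>: "\<psi> \<in> test_functions"
  shows "(LINT z|lebesgue. cis (z \<bullet> \<xi>) * ft \<psi> z) = (LINT z|lebesgue. ft \<phi> z) * \<psi> \<xi>"
proof -
  define a where "a n = inverse (real (Suc n))" for n
  have a1: "a n > 0" for n unfolding a_def by simp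
  have a2: "a \<longlonglongrightarrow> 0" unfolding a_def by (rule LIMSEQ_inverse_real_of_nat)
  let ?\<phi> = "\<lambda>n z. \<phi> (a n *\<^sub>R z)"
  have \<phi>n: "?\<phi> n \<in> test_functions" for n using test_affine[OF \<phi>(1), of "a n" 0] a1[of n] by simp
  obtain M1 where M1: "\<And>x. norm (\<phi> x) \<le> M1" using test_bounded0[OF \<phi>(1)] by metis
  obtain M2 where M2: "\<And>x. norm (\<psi> x) \<le> M2" using test_bounded0[OF \<psi>] by metis
  note s\<psi> = ft_schwartz[OF \<psi>] and s\<phi> = ft_schwartz[OF \<phi>(1)]
  have g_borel: "(\<lambda>z. ?\<phi> n z * cis (z \<bullet> \<xi>)) \<in> borel_measurable borel" for n
    using test_borel[OF \<phi>n] by (intro borel_measurable_times cis_borel) auto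
  have g_int: "integrable lebesgue (\<lambda>z. ?\<phi> n z * cis (z \<bullet> \<xi>))" for n
    using integrable_cis_mult[OF test_integrable[OF \<phi>n], of "\<lambda>z. z \<bullet> \<xi>" n] by (simp add: mult.commute)
  have eq: "(LINT z|lebesgue. (?\<phi> n z * cis (z \<bullet> \<xi>)) * ft \<psi> z) = (LINT v|lebesgue. \<psi> (\<xi> + a n *\<^sub>R v) * ft \<phi> v)" for n
  proof -
    have "(LINT z|lebesgue. (?\<phi> n z * cis (z \<bullet> \<xi>)) * (LINT \<zeta>|lebesgue. cis (- 1 * (z \<bullet> \<zeta>)) * \<psi> \<zeta>)) =
      (LINT \<zeta>|lebesgue. \<psi> \<zeta> * (LINT z|lebesgue. cis (- 1 * (z \<bullet> \<zeta>)) * (?\<phi> n z * cis (z \<bullet> \<xi>))))"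
      by (rule kernel_Fubini[OF g_borel g_int test_borel[OF \<psi>] test_integrable[OF \<psi>] cis_inner_kernel_borel]) simp
    also have "\<dots> = (LINT \<zeta>|lebesgue. \<psi> \<zeta> * ft (?\<phi> n) (\<zeta> - \<xi>))"
    proof -
      have "cis (- 1 * (z \<bullet> \<zeta>)) * (?\<phi> n z * cis (z \<bullet> \<xi>)) = cis (- ((\<zeta> - \<xi>) \<bullet> z)) * ?\<phi> n z" for z \<zeta>
      proof -
        have "cis (- ((\<zeta> - \<xi>) \<bullet> z)) = cis (- 1 * (z \<bullet> \<zeta>)) * cis (z \<bullet> \<xi>)"
          by (simp add: cis_mult inner_diff_left inner_commute[of z])
        then show ?thesis by (simp only: mult_ac)
      qed
      then show ?thesis by (simp only: ft_def)
    qed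
    also have "\<dots> = of_real (\<bar>a n\<bar> ^ DIM(real ^ 'n)) * (LINT v|lebesgue. \<psi> (\<xi> + a n *\<^sub>R v) * ft (?\<phi> n) (\<xi> + a n *\<^sub>R v - \<xi>))"
    proof (rule integral_affine)
      have "(\<lambda>\<zeta>. ft (?\<phi> n) (\<zeta> - \<xi>)) \<in> borel_measurable borel"
        by (rule schwartz_borel[OF schwartz_translate[OF ft_schwartz[OF \<phi>n]]])
      then show "(\<lambda>\<zeta>. \<psi> \<zeta> * ft (?\<phi> n) (\<zeta> - \<xi>)) \<in> borel_measurable borel"
        by (rule borel_measurable_times[OF test_borel[OF \<psi>]])
      show "a n \<noteq> 0" using a1[of n] by simp
    qed
    also have "\<dots> = (LINT v|lebesgue. of_real (a n ^ CARD('n)) * (\<psi> (\<xi> + a n *\<^sub>R v) * ft (?\<phi> n) (a n *\<^sub>R v)))"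
      using a1[of n] by simp
    also have "\<dots> = (LINT v|lebesgue. \<psi> (\<xi> + a n *\<^sub>R v) * ft \<phi> v)"
      by (simp only: ft_dilate[OF test_borel[OF \<phi>(1)] a1[of n]] mult_ac)
    finally show ?thesis by (simp add: ft_def)
  qed
  have "(\<lambda>n. LINT z|lebesgue. (?\<phi> n z * cis (z \<bullet> \<xi>)) * ft \<psi> z) \<longlonglongrightarrow> (LINT z|lebesgue. cis (z \<bullet> \<xi>) * ft \<psi> z)"
  proof (rule integral_dominated_convergence)
    show "integrable lebesgue (\<lambda>z. M1 * norm (ft \<psi> z))" using schwartz_integrable[OF s\<psi>] by simp
    show "AE z in lebesgue. (\<lambda>n. (?\<phi> n z * cis (z \<bullet> \<xi>)) * ft \<psi> z) \<longlonglongrightarrow> cis (z \<bullet> \<xi>) * ft \<psi> z"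
    proof (rule AE_I2)
      fix z :: "real ^ 'n"
      have "(\<lambda>n. a n *\<^sub>R z) \<longlonglongrightarrow> 0 *\<^sub>R z" by (intro tendsto_scaleR tendsto_add tendsto_const a2)
      then have l: "(\<lambda>n. a n *\<^sub>R z) \<longlonglongrightarrow> 0" by simp
      have "isCont \<phi> 0"
        using smooth_continuous[OF test_smooth[OF \<phi>(1)], of UNIV]
        by (simp add: continuous_on_eq_continuous_at)
      from isCont_tendsto_compose[OF this l] have "(\<lambda>n. \<phi> (a n *\<^sub>R z)) \<longlonglongrightarrow> \<phi> 0" .
      then have "(\<lambda>n. (?\<phi> n z * cis (z \<bullet> \<xi>)) * ft \<psi> z) \<longlonglongrightarrow> (\<phi> 0 * cis (z \<bullet> \<xi>)) * ft \<psi> z"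
        by (intro tendsto_intros)
      then show "(\<lambda>n. (?\<phi> n z * cis (z \<bullet> \<xi>)) * ft \<psi> z) \<longlonglongrightarrow> cis (z \<bullet> \<xi>) * ft \<psi> z" by (simp add: \<phi>(2))
    qed
    show "AE z in lebesgue. norm ((?\<phi> n z * cis (z \<bullet> \<xi>)) * ft \<psi> z) \<le> M1 * norm (ft \<psi> z)" for n
      using M1 by (intro AE_I2) (auto simp: norm_mult intro!: mult_right_mono)
    show "(\<lambda>z. (?\<phi> n z * cis (z \<bullet> \<xi>)) * ft \<psi> z) \<in> borel_measurable lebesgue" for n
      by (intro borel_measurable_lebesgueI borel_measurable_times[OF g_borel] schwartz_borel s\<psi>)
    show "(\<lambda>z. cis (z \<bullet> \<xi>) * ft \<psi> z) \<in> borel_measurable lebesgue"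
      by (intro borel_measurable_lebesgueI borel_measurable_times schwartz_borel s\<psi> cis_borel) simp
  qed
  moreover have "(\<lambda>n. LINT v|lebesgue. \<psi> (\<xi> + a n *\<^sub>R v) * ft \<phi> v) \<longlonglongrightarrow> (LINT v|lebesgue. \<psi> \<xi> * ft \<phi> v)"
  proof (rule integral_dominated_convergence)
    show "integrable lebesgue (\<lambda>z. M2 * norm (ft \<phi> z))" using schwartz_integrable[OF s\<phi>] by simp
    show "AE v in lebesgue. (\<lambda>n. \<psi> (\<xi> + a n *\<^sub>R v) * ft \<phi> v) \<longlonglongrightarrow> \<psi> \<xi> * ft \<phi> v"
    proof (rule AE_I2)
      fix v :: "real ^ 'n"
      have "(\<lambda>n. \<xi> + a n *\<^sub>R v) \<longlonglongrightarrow> \<xi> + 0 *\<^sub>R v" by (intro tendsto_scaleR tendsto_add tendsto_const a2)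
      then have l: "(\<lambda>n. \<xi> + a n *\<^sub>R v) \<longlonglongrightarrow> \<xi>" by simp
      have "isCont \<psi> \<xi>"
        using smooth_continuous[OF test_smooth[OF \<psi>], of UNIV]
        by (simp add: continuous_on_eq_continuous_at)
      from isCont_tendsto_compose[OF this l] have "(\<lambda>n. \<psi> (\<xi> + a n *\<^sub>R v)) \<longlonglongrightarrow> \<psi> \<xi>" .
      then show "(\<lambda>n. \<psi> (\<xi> + a n *\<^sub>R v) * ft \<phi> v) \<longlonglongrightarrow> \<psi> \<xi> * ft \<phi> v" by (intro tendsto_intros)
    qed
    show "AE v in lebesgue. norm (\<psi> (\<xi> + a n *\<^sub>R v) * ft \<phi> v) \<le> M2 * norm (ft \<phi> v)" for n
      using M2 by (intro AE_I2) (auto simp: norm_mult intro!: mult_right_mono)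
    have b: "(\<lambda>v. \<psi> (\<xi> + a n *\<^sub>R v)) \<in> borel_measurable borel" for n
      using test_borel[OF \<psi>] by measurable
    show "(\<lambda>v. \<psi> (\<xi> + a n *\<^sub>R v) * ft \<phi> v) \<in> borel_measurable lebesgue" for n
      by (intro borel_measurable_lebesgueI borel_measurable_times schwartz_borel s\<phi> b)
    show "(\<lambda>v. \<psi> \<xi> * ft \<phi> v) \<in> borel_measurable lebesgue"
      by (intro borel_measurable_lebesgueI borel_measurable_times[OF borel_measurable_const schwartz_borel[OF s\<phi>]])
  qed
  ultimately have "(LINT z|lebesgue. cis (z \<bullet> \<xi>) * ft \<psi> z) = (LINT v|lebesgue. \<psi> \<xi> * ft \<phi> v)"
    unfolding eq by (rule LIMSEQ_unique)
  then show ?thesis by (simp add: mult.commute)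
qed

lemma continuous_nonneg_integral_zero:
  fixes f :: "'a::euclidean_space \<Rightarrow> real"
  assumes "continuous_on UNIV f" "integrable lebesgue f" "\<And>x. f x \<ge> 0" "(LINT x|lebesgue. f x) = 0"
  shows "f x = 0"
proof -
  have "AE x in lebesgue. f x = 0"
    using integral_nonneg_eq_0_iff_AE[OF assms(2)] assms(3,4) by simp
  moreover have o: "open {x. f x \<noteq> 0}"
    using open_Collect_neq[OF assms(1) continuous_on_const] .
  ultimately have null: "emeasure lebesgue {x. f x \<noteq> 0} = 0"
    by (subst (asm) AE_iff_measurable[OF _ refl]) auto
  show ?thesis
  proof (rule ccontr)
    assume "f x \<noteq> 0"
    then obtain r where r: "r > 0" "ball x r \<subseteq> {x. f x \<noteq> 0}" using o openE by blast
    have "emeasure lebesgue (ball x r) \<le> emeasure lebesgue {x. f x \<noteq> 0}"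
      using o by (intro emeasure_mono r) auto
    moreover have "emeasure lebesgue (ball x r) > 0"
      using r(1) by (simp add: emeasure_ball ennreal_zero_less_mult_iff unit_ball_vol_pos)
    ultimately show False using null by simp
  qed
qed

text \<open>If the constant were zero, then Parseval's identity would give \<open>ft \<psi> = 0\<close> for
  \<open>\<psi> = \<bar>\<phi>\<bar>\<^sup>2\<close>, contradicting \<open>ft \<psi> 0 > 0\<close>.\<close>

theorem ft_integral_nonzero:
  fixes \<phi> :: "real ^ 'n::finite \<Rightarrow> complex"
  assumes \<phi>: "\<phi> \<in> test_functions" "\<phi> 0 = 1"
  shows "(LINT z|lebesgue. ft \<phi> z) \<noteq> 0"
proof
  assume 0: "(LINT z|lebesgue. ft \<phi> z) = 0"
  let ?\<psi> = "\<lambda>x. cnj (\<phi> x) * \<phi> x"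
  have \<psi>: "?\<psi> \<in> test_functions"
    by (rule test_mult[OF smooth_cnj[OF test_smooth[OF \<phi>(1)]] \<phi>(1)])
  note s\<psi> = ft_schwartz[OF \<psi>]
  have real_\<psi>: "?\<psi> x = of_real ((norm (\<phi> x))\<^sup>2)" for x
    by (metis complex_norm_square mult.commute)
  have cnj_ft: "cnj (ft ?\<psi> z) = (LINT \<xi>|lebesgue. cis (1 * (z \<bullet> \<xi>)) * ?\<psi> \<xi>)" for z
    unfolding ft_def
    by (subst Bochner_Integration.integral_cnj[symmetric]) (simp add: cis_cnj mult.commute)
  have "(LINT z|lebesgue. ft ?\<psi> z * (LINT \<xi>|lebesgue. cis (1 * (z \<bullet> \<xi>)) * ?\<psi> \<xi>)) =
      (LINT \<xi>|lebesgue. ?\<psi> \<xi> * (LINT z|lebesgue. cis (1 * (z \<bullet> \<xi>)) * ft ?\<psi> z))"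
    by (rule kernel_Fubini[OF schwartz_borel[OF s\<psi>] schwartz_integrable[OF s\<psi>] test_borel[OF \<psi>]
          test_integrable[OF \<psi>] cis_inner_kernel_borel]) simp
  also have "\<dots> = 0" using ft_inversion[OF \<phi> \<psi>] 0 by simp
  finally have "(LINT z|lebesgue. ft ?\<psi> z * cnj (ft ?\<psi> z)) = 0" by (simp add: cnj_ft)
  then have "(LINT z|lebesgue. complex_of_real ((norm (ft ?\<psi> z))\<^sup>2)) = 0"
    by (simp only: complex_norm_square)
  then have z: "(LINT z|lebesgue. (norm (ft ?\<psi> z))\<^sup>2) = 0" by (simp only: integral_complex_of_real of_real_eq_0_iff)
  have "(norm (ft ?\<psi> 0))\<^sup>2 = 0"
  proof (rule continuous_nonneg_integral_zero[OF _ _ _ z])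
    show "continuous_on UNIV (\<lambda>z. (norm (ft ?\<psi> z))\<^sup>2)"
      by (intro continuous_intros smooth_continuous[OF schwartz_smooth[OF s\<psi>]])
    obtain M where M: "\<And>z. norm (ft ?\<psi> z) \<le> M" using schwartz_bound0[OF s\<psi>, of 0] by auto
    show "integrable lebesgue (\<lambda>z. (norm (ft ?\<psi> z))\<^sup>2)"
    proof (rule Bochner_Integration.integrable_bound)
      show "integrable lebesgue (\<lambda>z. M * norm (ft ?\<psi> z))" using schwartz_integrable[OF s\<psi>] by simp
      show "(\<lambda>z. (norm (ft ?\<psi> z))\<^sup>2) \<in> borel_measurable lebesgue"
        using schwartz_borel[OF s\<psi>] by (intro borel_measurable_lebesgueI) measurable
      show "AE z in lebesgue. norm ((norm (ft ?\<psi> z))\<^sup>2) \<le> norm (M * norm (ft ?\<psi> z))"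
      proof (rule AE_I2)
        fix z
        have "norm (ft ?\<psi> z) * norm (ft ?\<psi> z) \<le> M * norm (ft ?\<psi> z)" by (intro mult_right_mono M) simp
        then show "norm ((norm (ft ?\<psi> z))\<^sup>2) \<le> norm (M * norm (ft ?\<psi> z))"
          using order_trans[OF norm_ge_zero M] by (simp add: power2_eq_square)
      qed
    qed
  qed simp
  then have "(LINT \<xi>|lebesgue. ?\<psi> \<xi>) = 0" by (simp add: ft_def)
  then have z: "(LINT \<xi>|lebesgue. (norm (\<phi> \<xi>))\<^sup>2) = 0"
    by (simp only: real_\<psi> integral_complex_of_real of_real_eq_0_iff)
  have "(norm (\<phi> 0))\<^sup>2 = 0"
  proof (rule continuous_nonneg_integral_zero[OF _ _ _ z])
    show "continuous_on UNIV (\<lambda>x. (norm (\<phi> x))\<^sup>2)"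
      by (intro continuous_intros smooth_continuous[OF test_smooth[OF \<phi>(1)]])
    have "integrable lebesgue (\<lambda>x. norm (?\<psi> x))" using test_integrable[OF \<psi>] by simp
    then show "integrable lebesgue (\<lambda>x. (norm (\<phi> x))\<^sup>2)" by (simp add: norm_mult power2_eq_square)
  qed simp
  then show False by (simp add: \<phi>(2))
qed

text \<open>Writing the first transform as an integral and exchanging produces the inner integral of
  \<open>ft_inversion\<close>. Later f is a dyadic piece and g a dilate equal to 1 on its support,
  so that f g = f and the formula reproduces the transform of the piece.\<close>

theorem ft_convolution:
  fixes \<phi> f g :: "real ^ 'n::finite \<Rightarrow> complex"
  assumes \<phi>: "\<phi> \<in> test_functions" "\<phi> 0 = 1" and f: "f \<in> test_functions" and g: "g \<in> test_functions"
  shows "(LINT z|lebesgue. ft f (x - z) * ft g (z - y)) = (LINT z|lebesgue. ft \<phi> z) * ft (\<lambda>\<xi>. f \<xi> * g \<xi>) (x - y)"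
proof -
  let ?f = "\<lambda>\<xi>. cis (- ((x - y) \<bullet> \<xi>)) * f \<xi>"
  note sf = ft_schwartz[OF f] and sg = ft_schwartz[OF g]
  have bf: "(\<lambda>z. ft f (x - z)) \<in> borel_measurable borel" by (rule measurable_compose[OF _ schwartz_borel[OF sf]]) simp
  have bg: "(\<lambda>z. ft g (z - y)) \<in> borel_measurable borel" by (rule measurable_compose[OF _ schwartz_borel[OF sg]]) simp
  have "(LINT z|lebesgue. ft f (x - z) * ft g (z - y)) =
      of_real (\<bar>1\<bar> ^ DIM(real ^ 'n)) * (LINT w|lebesgue. ft f (x - (y + 1 *\<^sub>R w)) * ft g (y + 1 *\<^sub>R w - y))"
    by (rule integral_affine) (auto intro: borel_measurable_times[OF bf bg])
  also have "\<dots> = (LINT w|lebesgue. ft g w * ft f ((x - y) - w))" by (simp add: mult.commute diff_diff_eq)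
  also have "\<dots> = (LINT w|lebesgue. ft g w * (LINT \<xi>|lebesgue. cis (1 * (w \<bullet> \<xi>)) * ?f \<xi>))"
  proof -
    have "cis (- (((x - y) - w) \<bullet> \<xi>)) = cis (1 * (w \<bullet> \<xi>)) * cis (- ((x - y) \<bullet> \<xi>))" for w \<xi>
      by (simp add: cis_mult inner_diff_left algebra_simps)
    then have "cis (- (((x - y) - w) \<bullet> \<xi>)) * f \<xi> = cis (1 * (w \<bullet> \<xi>)) * ?f \<xi>" for w \<xi>
      by (simp only: mult.assoc)
    then show ?thesis by (simp only: ft_def[of f])
  qed
  also have "\<dots> = (LINT \<xi>|lebesgue. ?f \<xi> * (LINT w|lebesgue. cis (1 * (w \<bullet> \<xi>)) * ft g w))"
  proof (rule kernel_Fubini[OF schwartz_borel[OF sg] schwartz_integrable[OF sg] _ _ cis_inner_kernel_borel])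
    show "?f \<in> borel_measurable borel" using test_borel[OF f] by (intro borel_measurable_times cis_borel) auto
    show "integrable lebesgue ?f" by (rule integrable_cis_mult[OF test_integrable[OF f]]) simp
  qed simp
  also have "\<dots> = (LINT \<xi>|lebesgue. (LINT z|lebesgue. ft \<phi> z) * (cis (- ((x - y) \<bullet> \<xi>)) * (f \<xi> * g \<xi>)))"
    using ft_inversion[OF \<phi> g] by (simp add: mult_ac)
  finally show ?thesis by (simp add: ft_def[of "\<lambda>\<xi>. f \<xi> * g \<xi>"])
qed

text \<open>The dual action of the multiplier on a test function is convolution with
  \<open>ft \<phi>\<close>, a superposition of translates: the form to which
  \<open>tempered_interchange\<close> applies.\<close>

lemma fourier_mult_inv_fourier:
  fixes \<phi> \<eta> :: "real ^ 'n::finite \<Rightarrow> complex"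
  assumes \<phi>: "\<phi> \<in> test_functions" and \<eta>: "\<eta> \<in> test_functions"
  shows "fourier (\<lambda>\<xi>. \<phi> \<xi> * inv_fourier \<eta> \<xi>) x =
    of_real ((2 * pi) powr - real CARD('n)) * (LINT y|lebesgue. \<eta> y * ft \<phi> (x - y))"
proof -
  let ?k = "complex_of_real ((2 * pi) powr (- real CARD('n) / 2))"
  let ?f = "\<lambda>\<xi>. cis (- (x \<bullet> \<xi>)) * \<phi> \<xi>"
  have "fourier (\<lambda>\<xi>. \<phi> \<xi> * inv_fourier \<eta> \<xi>) x = ?k * (LINT \<xi>|lebesgue. ?k * (?f \<xi> * (LINT y|lebesgue. cis (1 * (\<xi> \<bullet> y)) * \<eta> y)))"
    unfolding fourier_def inv_fourier_def
    by (intro arg_cong[where f = "(*) ?k"] Bochner_Integration.integral_cong refl)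
      (simp only: inner_commute[of x] mult_1 mult_ac)
  also have "\<dots> = ?k * ?k * (LINT \<xi>|lebesgue. ?f \<xi> * (LINT y|lebesgue. cis (1 * (\<xi> \<bullet> y)) * \<eta> y))"
    by (simp only: integral_mult_right_zero mult.assoc)
  also have "(LINT \<xi>|lebesgue. ?f \<xi> * (LINT y|lebesgue. cis (1 * (\<xi> \<bullet> y)) * \<eta> y)) =
      (LINT y|lebesgue. \<eta> y * (LINT \<xi>|lebesgue. cis (1 * (\<xi> \<bullet> y)) * ?f \<xi>))"
  proof (rule kernel_Fubini[OF _ _ test_borel[OF \<eta>] test_integrable[OF \<eta>] cis_inner_kernel_borel])
    show "?f \<in> borel_measurable borel" using test_borel[OF \<phi>] by (intro borel_measurable_times cis_borel) auto
    show "integrable lebesgue ?f" by (rule integrable_cis_mult[OF test_integrable[OF \<phi>]]) simp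
  qed simp
  also have "\<dots> = (LINT y|lebesgue. \<eta> y * ft \<phi> (x - y))"
  proof -
    have "cis (1 * (\<xi> \<bullet> y)) * ?f \<xi> = cis (- ((x - y) \<bullet> \<xi>)) * \<phi> \<xi>" for \<xi> y
      by (simp add: mult.assoc[symmetric] cis_mult inner_diff_left inner_commute[of \<xi>])
    then show ?thesis by (simp only: ft_def[of \<phi>])
  qed
  also have "?k * ?k = of_real ((2 * pi) powr - real CARD('n))"
    by (simp only: of_real_mult[symmetric] powr_add[symmetric]) (simp add: field_simps)
  finally show ?thesis .
qed

text \<open>The shift a_n z is compared with the shift 0. Their weighted distance is at most |a_n|
  times a moment of f, and |a_n| \<le> 1 keeps that moment independent of n.\<close>

lemma tempered_approximate_identity:
  fixes f \<eta> :: "real ^ 'n::finite \<Rightarrow> complex"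
  assumes T: "T \<in> tempered_distributions" and \<eta>: "\<eta> \<in> schwartz" and f: "rapidly_decreasing f"
    and a: "a \<longlonglongrightarrow> 0" "\<And>n. \<bar>a n\<bar> \<le> 1"
  shows "(\<lambda>n. T (\<lambda>x. LINT z|lebesgue. f z * \<eta> (x - a n *\<^sub>R z))) \<longlonglongrightarrow> (LINT z|lebesgue. f z) * T \<eta>"
proof -
  obtain C N where C: "C \<ge> 0" "\<And>\<eta> B. \<eta> \<in> schwartz \<Longrightarrow> schwartz_norm N \<eta> \<le> B \<Longrightarrow> norm (T \<eta>) \<le> C * B"
    using tempered_bound[OF T] by metis
  obtain D where D: "D \<ge> 0" "\<And>(\<eta>' :: real ^ 'n \<Rightarrow> complex) (s :: real ^ 'n \<Rightarrow> real ^ 'n) t. integrable lebesgue \<eta>' \<longrightarrow> s \<in> borel_measurable lebesgue \<longrightarrow> t \<in> borel_measurable lebesgue \<longrightarrow>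
      integrable lebesgue (\<lambda>z. norm (\<eta>' z) * (norm (s z - t z) * (1 + norm (s z) + norm (t z)) ^ N)) \<longrightarrow>
      schwartz_norm N (\<lambda>x. (LINT z|lebesgue. \<eta>' z * \<eta> (x - s z)) - (LINT z|lebesgue. \<eta>' z * \<eta> (x - t z)))
      \<le> D * (LINT z|lebesgue. norm (\<eta>' z) * (norm (s z - t z) * (1 + norm (s z) + norm (t z)) ^ N))"
    using schwartz_norm_superposition_diff[OF \<eta>, of N] by blast
  note fD = rapidly_decreasingD[OF f]
  define A where "A = (LINT z|lebesgue. (1 + norm z) ^ Suc N * norm (f z))"
  let ?s = "\<lambda>n z. a n *\<^sub>R z"
  let ?F = "\<lambda>n x. LINT z|lebesgue. f z * \<eta> (x - ?s n z)"
  let ?G = "\<lambda>x. (LINT z|lebesgue. f z) * \<eta> x"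
  have sm: "?s n \<in> borel_measurable lebesgue" for n by (rule borel_measurable_lebesgueI) simp
  have small: "norm (?s n z) \<le> norm z" for n z
    using a(2)[of n] by (simp add: mult_left_le_one_le)
  have wb: "norm (f z) * (norm (?s n z - 0) * (1 + norm (?s n z) + norm (0 :: real ^ 'n)) ^ M) \<le> \<bar>a n\<bar> * ((1 + norm z) ^ Suc M * norm (f z))" for n z M
  proof -
    have "norm (?s n z) * (1 + norm (?s n z)) ^ M \<le> (\<bar>a n\<bar> * (1 + norm z)) * (1 + norm z) ^ M"
      using small[of n z] by (intro mult_mono power_mono) (auto intro: mult_left_mono)
    then have "norm (f z) * (norm (?s n z) * (1 + norm (?s n z)) ^ M) \<le> norm (f z) * ((\<bar>a n\<bar> * (1 + norm z)) * (1 + norm z) ^ M)"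
      by (rule mult_left_mono) simp
    then show ?thesis by (simp add: mult_ac)
  qed
  have wi: "integrable lebesgue (\<lambda>z. norm (f z) * (norm (?s n z - 0) * (1 + norm (?s n z) + norm (0 :: real ^ 'n)) ^ N))" for n
  proof (rule Bochner_Integration.integrable_bound)
    show "integrable lebesgue (\<lambda>z. \<bar>a n\<bar> * ((1 + norm z) ^ Suc N * norm (f z)))"
      by (intro integrable_mult_right fD(2))
    show "(\<lambda>z. norm (f z) * (norm (?s n z - 0) * (1 + norm (?s n z) + norm (0 :: real ^ 'n)) ^ N)) \<in> borel_measurable lebesgue"
    proof (rule borel_measurable_times[OF measurable_compose[OF fD(1) borel_measurable_norm]])
      show "(\<lambda>z. norm (?s n z - 0) * (1 + norm (?s n z) + norm (0 :: real ^ 'n)) ^ N) \<in> borel_measurable lebesgue"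
        by (rule borel_measurable_lebesgueI) measurable
    qed
    show "AE z in lebesgue. norm (norm (f z) * (norm (?s n z - 0) * (1 + norm (?s n z) + norm (0 :: real ^ 'n)) ^ N)) \<le> norm (\<bar>a n\<bar> * ((1 + norm z) ^ Suc N * norm (f z)))"
      using wb[of _ n N] by (intro AE_I2) (simp add: abs_mult)
  qed
  have FS: "?F n \<in> schwartz" for n
  proof (rule superposition_schwartz[OF \<eta> fD(3) sm])
    fix M
    show "integrable lebesgue (\<lambda>z. (1 + norm (?s n z)) ^ M * norm (f z))"
    proof (rule Bochner_Integration.integrable_bound[OF fD(2)[of M]])
      show "(\<lambda>z. (1 + norm (?s n z)) ^ M * norm (f z)) \<in> borel_measurable lebesgue"
        by (intro borel_measurable_times measurable_compose[OF fD(1) borel_measurable_norm] borel_measurable_lebesgueI) simp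
      show "AE z in lebesgue. norm ((1 + norm (?s n z)) ^ M * norm (f z)) \<le> norm ((1 + norm z) ^ M * norm (f z))"
      proof (rule AE_I2)
        fix z
        have "(1 + norm (?s n z)) ^ M * norm (f z) \<le> (1 + norm z) ^ M * norm (f z)"
          using small[of n z] by (intro mult_right_mono power_mono) auto
        then show "norm ((1 + norm (?s n z)) ^ M * norm (f z)) \<le> norm ((1 + norm z) ^ M * norm (f z))"
          by (simp only: real_norm_def abs_mult power_abs abs_norm_cancel) simp
      qed
    qed
  qed
  have GS: "?G \<in> schwartz" by (rule schwartz_cmult[OF \<eta>])
  have bound: "norm (T (?F n) - T ?G) \<le> C * (D * (\<bar>a n\<bar> * A))" for n
  proof -
    have "schwartz_norm N (\<lambda>x. ?F n x - ?G x) \<le> D * (LINT z|lebesgue. norm (f z) * (norm (?s n z - 0) * (1 + norm (?s n z) + norm (0 :: real ^ 'n)) ^ N))"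
    proof -
      have "schwartz_norm N (\<lambda>x. ?F n x - (LINT z|lebesgue. f z * \<eta> (x - 0)))
          \<le> D * (LINT z|lebesgue. norm (f z) * (norm (?s n z - 0) * (1 + norm (?s n z) + norm (0 :: real ^ 'n)) ^ N))"
        by (rule D(2)[rule_format, OF fD(3) sm _ wi]) simp
      moreover have "(LINT z|lebesgue. f z * \<eta> (x - 0)) = ?G x" for x by simp
      ultimately show ?thesis by (simp only:)
    qed
    also have "\<dots> \<le> D * (LINT z|lebesgue. \<bar>a n\<bar> * ((1 + norm z) ^ Suc N * norm (f z)))"
      by (intro mult_left_mono integral_mono wi wb D(1) integrable_mult_right fD(2))
    also have "\<dots> = D * (\<bar>a n\<bar> * A)" by (simp only: A_def integral_mult_right_zero)
    finally have "norm (T (\<lambda>x. ?F n x - ?G x)) \<le> C * (D * (\<bar>a n\<bar> * A))"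
      by (rule C(2)[OF schwartz_diff[OF FS GS]])
    then show ?thesis by (simp only: tempered_diff[OF T FS GS])
  qed
  have "(\<lambda>n. T (?F n)) \<longlonglongrightarrow> T ?G"
  proof (rule LIM_zero_cancel, rule Lim_null_comparison)
    show "\<forall>\<^sub>F n in sequentially. norm (T (?F n) - T ?G) \<le> C * (D * (\<bar>a n\<bar> * A))" using bound by simp
    have "(\<lambda>n. C * (D * (\<bar>a n\<bar> * A))) \<longlonglongrightarrow> C * (D * (\<bar>0\<bar> * A))" by (intro tendsto_intros a(1))
    then show "(\<lambda>n. C * (D * (\<bar>a n\<bar> * A))) \<longlonglongrightarrow> 0" by simp
  qed
  then show ?thesis by (simp only: tempered_cmult[OF T \<eta>])
qed

lemma convolution_ft_dilate:
  fixes \<phi> \<eta> :: "real ^ 'n::finite \<Rightarrow> complex"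
  assumes \<phi>: "\<phi> \<in> test_functions" and \<eta>: "\<eta> \<in> test_functions" and a: "a > 0"
  shows "(LINT y|lebesgue. \<eta> y * ft (\<lambda>\<xi>. \<phi> (a *\<^sub>R \<xi>)) (x - y)) = (LINT v|lebesgue. ft \<phi> v * \<eta> (x - a *\<^sub>R v))"
proof -
  let ?\<phi> = "\<lambda>\<xi>. \<phi> (a *\<^sub>R \<xi>)"
  have \<phi>': "?\<phi> \<in> test_functions" using test_affine[OF \<phi>, of a 0] a by simp
  have "(LINT y|lebesgue. \<eta> y * ft ?\<phi> (x - y)) = of_real (\<bar>- a\<bar> ^ DIM(real ^ 'n)) * (LINT v|lebesgue. \<eta> (x + (- a) *\<^sub>R v) * ft ?\<phi> (x - (x + (- a) *\<^sub>R v)))"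
  proof (rule integral_affine)
    have "(\<lambda>y. ft ?\<phi> (x - y)) \<in> borel_measurable borel"
      by (rule measurable_compose[OF _ schwartz_borel[OF ft_schwartz[OF \<phi>']]]) simp
    then show "(\<lambda>y. \<eta> y * ft ?\<phi> (x - y)) \<in> borel_measurable borel"
      by (rule borel_measurable_times[OF test_borel[OF \<eta>]])
  qed (use a in simp)
  also have "\<dots> = (LINT v|lebesgue. of_real (a ^ CARD('n)) * (\<eta> (x - a *\<^sub>R v) * ft ?\<phi> (a *\<^sub>R v)))"
    using a by simp
  also have "\<dots> = (LINT v|lebesgue. ft \<phi> v * \<eta> (x - a *\<^sub>R v))"
    by (simp only: ft_dilate[OF test_borel[OF \<phi>] a] mult_ac)
  finally show ?thesis .
qed

section \<open>Uniqueness of the representing function\<close>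

text \<open>Inner regularity: a closed part of the bounded set where f > 0 is compact, and f is
  positive on it with integral 0, which forces measure 0. Such closed parts exhaust the set up to
  arbitrarily small measure.\<close>

lemma AE_nonpos_if_compact_integrals_zero:
  fixes f :: "'a::euclidean_space \<Rightarrow> real"
  assumes m: "f \<in> borel_measurable lebesgue"
    and i: "\<And>K. compact K \<Longrightarrow> integrable lebesgue (\<lambda>x. f x * indicator K x)"
    and z: "\<And>K. compact K \<Longrightarrow> (LINT x|lebesgue. f x * indicator K x) = 0"
  shows "AE x in lebesgue. f x \<le> 0"
proof -
  define S where "S k = {x. f x > 0} \<inter> cball 0 (real k)" for k
  have Sm: "S k \<in> sets lebesgue" for k
  proof -
    have "{x \<in> space lebesgue. f x > 0} \<in> sets lebesgue" using m by measurable
    then show ?thesis unfolding S_def by (intro sets.Int) auto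
  qed
  have "emeasure lebesgue (S k) = 0" for k
  proof -
    have *: "emeasure lebesgue (S k) \<le> 0 + ennreal e" if e: "e > 0" for e
    proof -
      obtain T where T: "closed T" "T \<subseteq> S k" "S k - T \<in> lmeasurable" "emeasure lebesgue (S k - T) < ennreal e"
        using sets_lebesgue_inner_closed[OF Sm e] by metis
      have "bounded T" using T(2) unfolding S_def by (meson bounded_cball bounded_subset inf.boundedE)
      then have cT: "compact T" using T(1) compact_eq_bounded_closed by blast
      have "AE x in lebesgue. f x * indicator T x = 0"
        using integral_nonneg_eq_0_iff_AE[OF i[OF cT]] z[OF cT] T(2) unfolding S_def
        by (force simp: indicator_def)
      then have "AE x in lebesgue. x \<notin> T"
        using T(2) unfolding S_def by (auto simp: indicator_def split: if_splits elim!: eventually_mono)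
      then have "emeasure lebesgue T = 0"
        using T(1) by (subst (asm) AE_iff_measurable[of T]) auto
      have "emeasure lebesgue (S k) = emeasure lebesgue (T \<union> (S k - T))"
        using T(2) by (simp add: Un_absorb1)
      also have "\<dots> \<le> emeasure lebesgue T + emeasure lebesgue (S k - T)"
        using T by (intro emeasure_subadditive) auto
      also have "\<dots> \<le> 0 + ennreal e" using T(4) \<open>emeasure lebesgue T = 0\<close> by auto
      finally show ?thesis .
    qed
    have "emeasure lebesgue (S k) \<le> 0" by (rule ennreal_le_epsilon) (rule *)
    then show ?thesis by simp
  qed
  then have "AE x in lebesgue. x \<notin> S k" for k
    using Sm[of k] by (subst AE_iff_measurable[of "S k"]) auto
  then have "AE x in lebesgue. \<forall>k. x \<notin> S k" by (simp add: AE_all_countable)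
  then show ?thesis
  proof (rule eventually_mono)
    fix x assume *: "\<forall>k. x \<notin> S k"
    obtain k where "norm x \<le> real k" using real_arch_simple by blast
    with *[rule_format, of k] show "f x \<le> 0" by (simp add: S_def)
  qed
qed

lemma AE_zero_if_compact_integrals_zero:
  fixes h :: "'a::euclidean_space \<Rightarrow> complex"
  assumes m: "h \<in> borel_measurable lebesgue"
    and i: "\<And>K. compact K \<Longrightarrow> integrable lebesgue (\<lambda>x. h x * indicator K x)"
    and z: "\<And>K. compact K \<Longrightarrow> (LINT x|lebesgue. h x * indicator K x) = 0"
  shows "AE x in lebesgue. h x = 0"
proof -
  \<comment> \<open>Used with L the real part, the imaginary part and their negatives.\<close>
  have *: "AE x in lebesgue. L (h x) \<le> 0" if L: "bounded_linear L" for L :: "complex \<Rightarrow> real"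
  proof (rule AE_nonpos_if_compact_integrals_zero)
    interpret L: bounded_linear L by (rule L)
    have "L \<in> borel_measurable borel"
      by (intro borel_measurable_continuous_onI linear_continuous_on L)
    from measurable_compose[OF m this] show "(\<lambda>x. L (h x)) \<in> borel_measurable lebesgue" .
    have eq: "L (h x) * indicator K x = L (h x * indicator K x)" for x K
      by (auto simp: indicator_def L.zero)
    show "integrable lebesgue (\<lambda>x. L (h x) * indicator K x)" if "compact K" for K
      unfolding eq by (rule integrable_bounded_linear[OF L i[OF that]])
    show "(LINT x|lebesgue. L (h x) * indicator K x) = 0" if "compact K" for K
      unfolding eq integral_bounded_linear[OF L i[OF that]] z[OF that] by (rule L.zero)
  qed
  have "AE x in lebesgue. Re (h x) \<le> 0" by (rule *[OF bounded_linear_Re])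
  moreover have "AE x in lebesgue. - Re (h x) \<le> 0" by (rule *[OF bounded_linear_minus[OF bounded_linear_Re]])
  moreover have "AE x in lebesgue. Im (h x) \<le> 0" by (rule *[OF bounded_linear_Im])
  moreover have "AE x in lebesgue. - Im (h x) \<le> 0" by (rule *[OF bounded_linear_minus[OF bounded_linear_Im]])
  ultimately show ?thesis by eventually_elim (auto simp: complex_eq_iff)
qed

text \<open>The indicator of the e-neighbourhood of K is mollified by a bump of radius at most e and
  normalised. The bump is a dilate of |\<phi>|^2, so the generator of the resolution of unity
  supplies the cutoffs too.\<close>

lemma smooth_cutoff:
  fixes \<phi> :: "real ^ 'n::finite \<Rightarrow> complex" and K :: "(real ^ 'n) set"
  assumes \<phi>: "\<phi> \<in> test_functions" "\<phi> 0 = 1" and K: "compact K" "K \<noteq> {}" and e: "0 < e"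
  shows "\<exists>\<eta>\<in>test_functions. (\<forall>x. norm (\<eta> x) \<le> 1) \<and> (\<forall>x\<in>K. \<eta> x = 1) \<and> (\<forall>x. infdist x K > 2 * e \<longrightarrow> \<eta> x = 0)"
proof -
  obtain R where R: "R > 0" "\<And>x. norm x > R \<Longrightarrow> \<phi> x = 0" using test_vanish[OF \<phi>(1)] by metis
  \<comment> \<open>The squared modulus is nonnegative and still smooth, being \<phi> times its
    conjugate; \<phi> 0 = 1 makes its integral positive.\<close>
  define r where "r x = (norm (\<phi> x))\<^sup>2" for x
  define \<rho> where "\<rho> x = complex_of_real (r x)" for x
  have \<rho>: "\<rho> \<in> test_functions"
  proof -
    have "\<rho> = (\<lambda>x. cnj (\<phi> x) * \<phi> x)"
      unfolding \<rho>_def[abs_def] r_def by (rule ext) (simp only: complex_norm_square mult.commute)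
    then show ?thesis using test_mult[OF smooth_cnj[OF test_smooth[OF \<phi>(1)]] \<phi>(1)] by simp
  qed
  have r0: "r x \<ge> 0" for x by (simp add: r_def)
  have ir: "integrable lebesgue r"
    using integrable_norm[OF test_integrable[OF \<rho>]] r0 by (simp add: \<rho>_def)
  define M where "M = (LINT x|lebesgue. r x)"
  have "M \<noteq> 0"
  proof
    assume "M = 0"
    have "continuous_on UNIV r"
      unfolding r_def by (intro continuous_intros smooth_continuous[OF test_smooth[OF \<phi>(1)]])
    from continuous_nonneg_integral_zero[OF this ir r0] \<open>M = 0\<close> have "r 0 = 0" by (simp add: M_def)
    then show False by (simp add: r_def \<phi>(2))
  qed
  moreover have "M \<ge> 0" unfolding M_def using r0 by simp
  ultimately have M: "M > 0" by simp
  \<comment> \<open>Chosen so that \<delta> R < e: the dilated bump fits into the ball of radius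
    e.\<close>
  define \<delta> where "\<delta> = e / (R + 1)"
  have \<delta>: "\<delta> > 0" "\<delta> * R < e" using R(1) e by (simp_all add: \<delta>_def field_simps)
  define A where "A = {z. infdist z K \<le> e}"
  have cA: "compact A" unfolding A_def using K e by (intro compact_infdist_le) auto
  have Am: "A \<in> lmeasurable" using cA by (rule lmeasurable_compact)
  define \<kappa> where "\<kappa> y = \<rho> ((1 / \<delta>) *\<^sub>R y)" for y
  have \<kappa>: "\<kappa> \<in> test_functions" unfolding \<kappa>_def using test_affine[OF \<rho>, of "1 / \<delta>" 0] \<delta> by simp
  have \<kappa>0: "\<kappa> y = 0" if "norm y > e" for y
  proof -
    have "norm ((1 / \<delta>) *\<^sub>R y) = norm y / \<delta>" using \<delta> by simp
    moreover have "R < norm y / \<delta>" using \<delta> that by (simp add: pos_less_divide_eq mult.commute)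
    ultimately have "R < norm ((1 / \<delta>) *\<^sub>R y)" by linarith
    from R(2)[OF this] show ?thesis by (simp add: \<kappa>_def \<rho>_def r_def)
  qed
  have iA: "integrable lebesgue (\<lambda>z. indicator A z :: complex)"
  proof -
    have "integrable lebesgue (\<lambda>z. indicator A z :: real)" using Am by (simp add: lmeasurable_iff_integrable)
    then have "integrable lebesgue (\<lambda>z. complex_of_real (indicator A z))" by simp
    moreover have "(\<lambda>z. complex_of_real (indicator A z)) = indicator A" by (auto simp: indicator_def)
    ultimately show ?thesis by simp
  qed
  have idm: "(\<lambda>z :: real ^ 'n. z) \<in> borel_measurable lebesgue" by (rule borel_measurable_lebesgueI) simp
  define c where "c = \<delta> ^ CARD('n) * M"
  have c: "c > 0" using \<delta> M by (simp add: c_def)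
  define F where "F x = (LINT z|lebesgue. indicator A z * \<kappa> (x - z))" for x
  have total: "(LINT z|lebesgue. norm (\<kappa> (x - z))) = c" "(LINT z|lebesgue. \<kappa> (x - z)) = of_real c"
     "integrable lebesgue (\<lambda>z. \<kappa> (x - z))" for x
  proof -
    have b: "(\<lambda>z. \<kappa> (x - z)) \<in> borel_measurable borel"
      by (rule measurable_compose[OF _ test_borel[OF \<kappa>]]) simp
    have "(LINT z|lebesgue. \<kappa> (x - z)) = of_real (\<bar>- \<delta>\<bar> ^ DIM(real ^ 'n)) * (LINT v|lebesgue. \<kappa> (x - (x + (- \<delta>) *\<^sub>R v)))"
      by (rule integral_affine[OF b]) (use \<delta> in simp)
    also have "\<dots> = of_real (\<delta> ^ CARD('n)) * (LINT v|lebesgue. of_real (r v))"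
      using \<delta> by (simp add: \<kappa>_def \<rho>_def)
    also have "\<dots> = of_real c" by (simp add: c_def M_def)
    finally show t: "(LINT z|lebesgue. \<kappa> (x - z)) = of_real c" .
    \<comment> \<open>A non-integrable function would have integral 0, but the value c is
      positive.\<close>
    show i: "integrable lebesgue (\<lambda>z. \<kappa> (x - z))"
      using t c by (metis not_integrable_integral_eq of_real_eq_0_iff order_less_irrefl)
    have "\<kappa> (x - z) = of_real (norm (\<kappa> (x - z)))" for z using r0 by (simp add: \<kappa>_def \<rho>_def)
    then have "(LINT z|lebesgue. \<kappa> (x - z)) = of_real (LINT z|lebesgue. norm (\<kappa> (x - z)))"
      by (metis (no_types, lifting) Bochner_Integration.integral_cong integral_complex_of_real)
    with t show "(LINT z|lebesgue. norm (\<kappa> (x - z))) = c" by (simp only: of_real_eq_iff)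
  qed
  have Fbound: "norm (F x) \<le> c" for x
  proof -
    have "norm (F x) \<le> (LINT z|lebesgue. norm (\<kappa> (x - z)))"
      unfolding F_def by (rule integral_norm_le) (use total(3) in \<open>auto simp: indicator_def\<close>)
    then show ?thesis by (simp add: total)
  qed
  have Fone: "F x = of_real c" if "x \<in> K" for x
  proof -
    have "indicator A z * \<kappa> (x - z) = \<kappa> (x - z)" for z
    proof (cases "z \<in> A")
      case False
      have "infdist z K \<le> dist z x" by (rule infdist_le[OF that])
      with False have "norm (x - z) > e" by (simp add: A_def dist_norm norm_minus_commute)
      with \<kappa>0 show ?thesis by simp
    qed simp
    then show ?thesis by (simp only: F_def total)
  qed
  have Fzero: "F x = 0" if "infdist x K > 2 * e" for x
  proof -
    have "indicator A z * \<kappa> (x - z) = 0" for z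
    proof (cases "z \<in> A")
      case True
      have "infdist x K \<le> infdist z K + dist x z" by (rule infdist_triangle)
      with True that have "norm (x - z) > e" by (simp add: A_def dist_norm)
      with \<kappa>0 show ?thesis by simp
    qed simp
    then show ?thesis by (simp only: F_def Bochner_Integration.integral_zero)
  qed
  have "F \<in> test_functions"
  proof -
    have "smooth F" unfolding F_def by (rule superposition_smooth[OF test_schwartz[OF \<kappa>] iA idm])
    moreover have "bounded {x. infdist x K \<le> 2 * e}"
      using compact_infdist_le[OF K(2,1), of "2 * e"] e by (simp add: compact_imp_bounded)
    then obtain B where "\<And>x. infdist x K \<le> 2 * e \<Longrightarrow> norm x \<le> B" unfolding bounded_iff by auto
    then have "F x = 0" if "norm x > B" for x using Fzero[of x] that by (meson not_le)
    ultimately show ?thesis by (rule testI)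
  qed
  then have "(\<lambda>x. of_real (1 / c) * F x) \<in> test_functions" by (intro test_mult smooth_const)
  moreover have "norm (of_real (1 / c) * F x) \<le> 1" for x
    using Fbound[of x] c by (simp add: norm_mult norm_divide divide_le_eq)
  ultimately show ?thesis
    using Fone Fzero c by (intro bexI[of _ "\<lambda>x. of_real (1 / c) * F x"]) auto
qed

text \<open>Cutoffs around shrinking neighbourhoods of a compact K converge to its indicator and are
  dominated on the neighbourhood of radius 2, so the integrals of h over compact sets vanish as
  well.\<close>

theorem du_Bois_Reymond:
  fixes \<phi> h :: "real ^ 'n::finite \<Rightarrow> complex"
  assumes \<phi>: "\<phi> \<in> test_functions" "\<phi> 0 = 1" and m: "h \<in> borel_measurable lebesgue"
    and i: "\<And>K. compact K \<Longrightarrow> integrable lebesgue (\<lambda>x. h x * indicator K x)"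
    and z: "\<And>\<eta>. \<eta> \<in> test_functions \<Longrightarrow> (LINT x|lebesgue. h x * \<eta> x) = 0"
  shows "AE x in lebesgue. h x = 0"
proof (rule AE_zero_if_compact_integrals_zero[OF m i])
  fix K :: "(real ^ 'n) set" assume K: "compact K"
  show "(LINT x|lebesgue. h x * indicator K x) = 0"
  proof (cases "K = {}")
    case False
    define e where "e n = inverse (real (Suc n))" for n
    have e: "e n > 0" "e n \<le> 1" for n by (auto simp: e_def inverse_le_1_iff)
    have elim: "e \<longlonglongrightarrow> 0" unfolding e_def by (rule LIMSEQ_inverse_real_of_nat)
    have "\<forall>n. \<exists>\<eta>. \<eta> \<in> test_functions \<and> (\<forall>x. norm (\<eta> x) \<le> 1) \<and> (\<forall>x\<in>K. \<eta> x = 1) \<and> (\<forall>x. infdist x K > 2 * e n \<longrightarrow> \<eta> x = 0)"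
      using smooth_cutoff[OF \<phi> K False] e(1) by blast
    then obtain \<eta> where \<eta>: "\<And>n. \<eta> n \<in> test_functions" "\<And>n x. norm (\<eta> n x) \<le> 1" "\<And>n x. x \<in> K \<Longrightarrow> \<eta> n x = 1"
        "\<And>n x. infdist x K > 2 * e n \<Longrightarrow> \<eta> n x = 0" by metis
    define B where "B = {x. infdist x K \<le> 2}"
    have cB: "compact B" unfolding B_def by (rule compact_infdist_le[OF False K]) simp
    have "(\<lambda>n. LINT x|lebesgue. h x * \<eta> n x) \<longlonglongrightarrow> (LINT x|lebesgue. h x * indicator K x)"
    proof (rule integral_dominated_convergence)
      show "integrable lebesgue (\<lambda>x. norm (h x * indicator B x))" using i[OF cB] by simp
      show "(\<lambda>x. h x * indicator K x) \<in> borel_measurable lebesgue"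
        using i[OF K] by (rule borel_measurable_integrable)
      show "(\<lambda>x. h x * \<eta> n x) \<in> borel_measurable lebesgue" for n
        by (intro borel_measurable_times m borel_measurable_lebesgueI test_borel \<eta>(1))
      show "AE x in lebesgue. norm (h x * \<eta> n x) \<le> norm (h x * indicator B x)" for n
      proof (rule AE_I2)
        fix x
        show "norm (h x * \<eta> n x) \<le> norm (h x * indicator B x)"
        proof (cases "x \<in> B")
          case True
          then show ?thesis using mult_left_mono[OF \<eta>(2)[of n x], of "norm (h x)"] by (simp add: norm_mult)
        next
          case False
          then have "infdist x K > 2 * e n" using e(2)[of n] by (simp add: B_def)
          then show ?thesis by (simp add: \<eta>(4))
        qed
      qed
      show "AE x in lebesgue. (\<lambda>n. h x * \<eta> n x) \<longlonglongrightarrow> h x * indicator K x"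
      proof (rule AE_I2)
        fix x
        show "(\<lambda>n. h x * \<eta> n x) \<longlonglongrightarrow> h x * indicator K x"
        proof (cases "x \<in> K")
          case False
          then have "infdist x K > 0"
            using in_closed_iff_infdist_zero[OF compact_imp_closed[OF K] \<open>K \<noteq> {}\<close>, of x] infdist_nonneg[of x K] by simp
          moreover have "(\<lambda>n. 2 * e n) \<longlonglongrightarrow> 2 * 0" by (intro tendsto_intros elim)
          ultimately have "\<forall>\<^sub>F n in sequentially. 2 * e n < infdist x K" by (intro order_tendstoD) auto
          then have "\<forall>\<^sub>F n in sequentially. h x * \<eta> n x = 0" by eventually_elim (simp add: \<eta>(4))
          then show ?thesis using False by (simp add: tendsto_eventually)
        qed (simp add: \<eta>(3))
      qed
    qed
    then show ?thesis by (simp add: z[OF \<eta>(1)] LIMSEQ_const_iff)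
  qed simp
qed

section \<open>Dyadic cubes and a Nikolskii inequality\<close>

lemma nn_integral_affine:
  fixes f :: "'a::euclidean_space \<Rightarrow> ennreal"
  assumes "f \<in> borel_measurable borel" "c \<noteq> 0"
  shows "(\<integral>\<^sup>+x. f x \<partial>lebesgue) = ennreal (\<bar>c\<bar> ^ DIM('a)) * (\<integral>\<^sup>+x. f (t + c *\<^sub>R x) \<partial>lebesgue)"
proof -
  have m: "(\<lambda>x. f (t + c *\<^sub>R x)) \<in> borel_measurable borel"
    by (rule measurable_compose[OF _ assms(1)]) simp
  have "(\<integral>\<^sup>+x. f x \<partial>lebesgue) = (\<integral>\<^sup>+x. f x \<partial>lborel)" by (rule nn_integral_completion)
  also have "\<dots> = (\<integral>\<^sup>+x. f x \<partial>density (distr lborel borel (\<lambda>x. t + c *\<^sub>R x)) (\<lambda>_. ennreal (\<bar>c\<bar> ^ DIM('a))))"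
    by (subst lborel_affine[OF assms(2), of t]) rule
  also have "\<dots> = (\<integral>\<^sup>+x. ennreal (\<bar>c\<bar> ^ DIM('a)) * f x \<partial>distr lborel borel (\<lambda>x. t + c *\<^sub>R x))"
    using assms(1) by (intro nn_integral_density) auto
  also have "\<dots> = (\<integral>\<^sup>+x. ennreal (\<bar>c\<bar> ^ DIM('a)) * f (t + c *\<^sub>R x) \<partial>lborel)"
    using assms(1) by (intro nn_integral_distr) auto
  also have "\<dots> = ennreal (\<bar>c\<bar> ^ DIM('a)) * (\<integral>\<^sup>+x. f (t + c *\<^sub>R x) \<partial>lborel)"
    by (rule nn_integral_cmult) (use m in simp)
  also have "(\<integral>\<^sup>+x. f (t + c *\<^sub>R x) \<partial>lborel) = (\<integral>\<^sup>+x. f (t + c *\<^sub>R x) \<partial>lebesgue)"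
    by (rule nn_integral_completion[symmetric])
  finally show ?thesis .
qed

text \<open>Coordinate inequalities in place of the image of a unit cube: measurability, volume and
  scaling can be read off from them.\<close>

definition cube :: "int \<Rightarrow> int ^ 'n \<Rightarrow> (real ^ 'n::finite) set" where
  "cube j k = {x. \<forall>i. 2 powi (- j) * of_int (k $ i) \<le> x $ i \<and> x $ i < 2 powi (- j) * (of_int (k $ i) + 1)}"

lemma dyadic_cube_eq: "dyadic_cube j k = cube j k"
proof -
  define a :: real where "a = 2 powi (- j)"
  have a: "a > 0" by (simp add: a_def)
  have "x \<in> dyadic_cube j k \<longleftrightarrow> x \<in> cube j k" for x
  proof
    assume "x \<in> dyadic_cube j k"
    then obtain y where y: "\<And>i. 0 \<le> y $ i" "\<And>i. y $ i < 1" "x = a *\<^sub>R (y + (\<chi> i. of_int (k $ i)))"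
      unfolding dyadic_cube_def a_def by auto
    then show "x \<in> cube j k"
      using a by (auto simp: cube_def a_def[symmetric] intro!: mult_left_mono mult_strict_left_mono)
  next
    assume "x \<in> cube j k"
    then have x: "\<And>i. a * of_int (k $ i) \<le> x $ i" "\<And>i. x $ i < a * (of_int (k $ i) + 1)"
      by (auto simp: cube_def a_def)
    let ?y = "(1 / a) *\<^sub>R x - (\<chi> i. of_int (k $ i))"
    have "0 \<le> ?y $ i" "?y $ i < 1" for i
      using x[of i] a by (auto simp: pos_le_divide_eq pos_divide_less_eq algebra_simps)
    moreover have "x = a *\<^sub>R (?y + (\<chi> i. of_int (k $ i)))" using a by simp
    ultimately show "x \<in> dyadic_cube j k"
      unfolding dyadic_cube_def a_def[symmetric] by (intro image_eqI[of _ _ ?y]) auto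
  qed
  then show ?thesis by blast
qed

lemma cube_borel: "cube j k \<in> sets borel"
proof -
  have "cube j k = (\<Inter>i. {x. 2 powi (- j) * of_int (k $ i) \<le> x $ i} \<inter> {x. x $ i < 2 powi (- j) * (of_int (k $ i) + 1)})"
    by (auto simp: cube_def)
  also have "\<dots> \<in> sets borel"
    by (intro sets.finite_INT sets.Int borel_closed borel_open closed_halfspace_component_ge_cart
        open_halfspace_component_lt_cart) auto
  finally show ?thesis .
qed

lemma emeasure_cube: "emeasure lebesgue (cube j k :: (real ^ 'n::finite) set) = ennreal ((2 powi (- j)) ^ CARD('n))"
proof -
  define a b :: "real ^ 'n" where "a = (\<chi> i. 2 powi (- j) * of_int (k $ i))" and "b = (\<chi> i. 2 powi (- j) * (of_int (k $ i) + 1))"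
  have s1: "box a b \<subseteq> cube j k" by (auto simp: a_def b_def cube_def mem_box_cart intro: less_imp_le)
  have s2: "cube j k \<subseteq> cbox a b" by (simp add: a_def b_def cube_def mem_box_cart subset_iff less_imp_le)
  have ab: "\<And>i. a $ i \<le> b $ i" by (simp add: a_def b_def)
  then have ne: "a \<in> cbox a b" by (simp add: mem_box_cart)
  have "(b - a) \<bullet> \<beta> = 2 powi (- j)" if "\<beta> \<in> Basis" for \<beta>
    using that by (auto simp: Basis_vec_def inner_axis a_def b_def right_diff_distrib[symmetric])
  then have p: "(\<Prod>\<beta>\<in>Basis. (b - a) \<bullet> \<beta>) = (2 powi (- j)) ^ CARD('n)" by simp
  have le: "a \<bullet> \<beta> \<le> b \<bullet> \<beta>" if "\<beta> \<in> Basis" for \<beta>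
    using that ab by (auto simp: Basis_vec_def inner_axis)
  have "emeasure lborel (cube j k) \<le> emeasure lborel (cbox a b)" by (rule emeasure_mono[OF s2]) simp
  moreover have "emeasure lborel (box a b) \<le> emeasure lborel (cube j k)"
    by (rule emeasure_mono[OF s1]) (simp add: cube_borel)
  ultimately have "emeasure lborel (cube j k) = ennreal ((2 powi (- j)) ^ CARD('n))"
    using emeasure_lborel_cbox[OF le] emeasure_lborel_box[OF le] p by simp
  then show ?thesis by (simp add: cube_borel)
qed

lemma cube_scale: "(2 powi (- j)) *\<^sub>R y \<in> cube j k \<longleftrightarrow> y \<in> cube 0 k"
  by (simp add: cube_def)

definition vfloor :: "real ^ 'n \<Rightarrow> int ^ 'n::finite" where "vfloor y = (\<chi> i. \<lfloor>y $ i\<rfloor>)"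

lemma mem_unit_cube: "y \<in> cube 0 k \<longleftrightarrow> vfloor y = k"
  by (auto simp: cube_def vfloor_def vec_eq_iff floor_eq_iff)

text \<open>The unit cubes partition the space. Their indices form a countable type, and
  \<open>to_nat\<close> turns the sum over cubes into a series; a number that encodes no index
  contributes the empty set.\<close>

lemma nn_integral_unit_cubes:
  fixes f :: "real ^ 'n::finite \<Rightarrow> ennreal"
  assumes "f \<in> borel_measurable lebesgue"
  shows "(\<integral>\<^sup>+y. f y \<partial>lebesgue) = (\<Sum>n. \<integral>\<^sup>+y. f y * indicator {y. to_nat (vfloor y) = n} y \<partial>lebesgue)"
proof -
  have m: "{y :: real ^ 'n. to_nat (vfloor y) = n} \<in> sets lebesgue" for n
  proof (cases "\<exists>k :: int ^ 'n. to_nat k = n")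
    case True
    then obtain k :: "int ^ 'n" where "to_nat k = n" by blast
    then have "{y. to_nat (vfloor y) = n} = cube 0 k" by (auto simp: mem_unit_cube)
    then show ?thesis using cube_borel[of 0 k] by simp
  qed auto
  have "f y = (\<Sum>n. f y * indicator {y. to_nat (vfloor y) = n} y)" for y
    by (subst suminf_finite[of "{to_nat (vfloor y)}"]) auto
  then have "(\<integral>\<^sup>+y. f y \<partial>lebesgue) = (\<integral>\<^sup>+y. (\<Sum>n. f y * indicator {y. to_nat (vfloor y) = n} y) \<partial>lebesgue)" by simp
  also have "\<dots> = (\<Sum>n. \<integral>\<^sup>+y. f y * indicator {y. to_nat (vfloor y) = n} y \<partial>lebesgue)"
    by (intro nn_integral_suminf borel_measurable_times_ennreal assms borel_measurable_indicator m)
  finally show ?thesis .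
qed

text \<open>On a unit cube the weight varies by a factor of at most (1 + d)^N, since two of its
  points have distance at most d. Hence F may be spread evenly over each cube, and only its mass per
  cube matters.\<close>

lemma nn_integral_weight_unit_cubes:
  fixes F :: "real ^ 'n::finite \<Rightarrow> ennreal"
  assumes F: "F \<in> borel_measurable lebesgue" and B: "\<And>k. (\<integral>\<^sup>+y. F y * indicator (cube 0 k) y \<partial>lebesgue) \<le> B"
  shows "(\<integral>\<^sup>+y. ennreal (1 / (1 + norm (x - y)) ^ N) * F y \<partial>lebesgue) \<le>
    ennreal ((1 + real CARD('n)) ^ N) * B * (\<integral>\<^sup>+(y :: real ^ 'n). ennreal (1 / (1 + norm y) ^ N) \<partial>lebesgue)"
proof -
  let ?w = "\<lambda>y. ennreal (1 / (1 + norm (x - y)) ^ N)" and ?c = "ennreal ((1 + real CARD('n)) ^ N)"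
  have wb: "?w \<in> borel_measurable borel" by measurable
  have w: "?w \<in> borel_measurable lebesgue" by (rule borel_measurable_lebesgueI[OF wb])
  let ?D = "\<lambda>n. {y :: real ^ 'n. to_nat (vfloor y) = n}"
  have "(\<integral>\<^sup>+y. ?w y * F y * indicator (?D n) y \<partial>lebesgue) \<le> (\<integral>\<^sup>+y. (?c * B * ?w y) * indicator (?D n) y \<partial>lebesgue)" for n
  proof (cases "\<exists>k :: int ^ 'n. to_nat k = n")
    case True
    then obtain k :: "int ^ 'n" where k: "to_nat k = n" by blast
    then have D: "?D n = cube 0 k" by (auto simp: mem_unit_cube)
    let ?L = "\<integral>\<^sup>+y. ?w y * F y * indicator (cube 0 k) y \<partial>lebesgue"
    have L: "?L \<le> ?c * B * ?w y'" if y': "y' \<in> cube 0 k" for y'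
    proof -
      have "?w y * F y * indicator (cube 0 k) y \<le> (?c * ?w y') * (F y * indicator (cube 0 k) y)" for y
      proof (cases "y \<in> cube 0 k")
        case True
        have "\<bar>(y - y') $ i\<bar> \<le> 1" for i
          using True y' unfolding cube_def by (auto simp: abs_le_iff) (smt (verit))+
        then have "norm (y - y') \<le> (\<Sum>i\<in>(UNIV :: 'n set). 1)"
          by (intro order_trans[OF norm_le_l1_cart] sum_mono)
        then have n: "norm (y - y') \<le> real CARD('n)" by simp
        have "(1 + norm (x - y')) ^ N \<le> (1 + norm (x - y)) ^ N * (1 + norm (y - y')) ^ N"
          using one_plus_norm_triangle_power[of "x - y'" N "y - y'"] by (simp add: algebra_simps)
        also have "\<dots> \<le> (1 + norm (x - y)) ^ N * (1 + real CARD('n)) ^ N"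
          using n by (intro mult_left_mono power_mono) auto
        finally have "1 / (1 + norm (x - y)) ^ N \<le> (1 + real CARD('n)) ^ N * (1 / (1 + norm (x - y')) ^ N)"
        proof -
          assume a: "(1 + norm (x - y')) ^ N \<le> (1 + norm (x - y)) ^ N * (1 + real CARD('n)) ^ N"
          have "(1 + norm (x - y)) ^ N > 0" "(1 + norm (x - y')) ^ N > 0"
            by (intro zero_less_power add_pos_nonneg; simp)+
          with a show ?thesis by (simp add: divide_simps mult.commute)
        qed
        then have "?w y \<le> ennreal ((1 + real CARD('n)) ^ N * (1 / (1 + norm (x - y')) ^ N))" by (rule ennreal_leI)
        also have "\<dots> = ?c * ?w y'" by (rule ennreal_mult) auto
        finally have "?w y * F y \<le> (?c * ?w y') * F y" by (rule mult_right_mono) simp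
        then show ?thesis using True by simp
      qed simp
      then have "?L \<le> (\<integral>\<^sup>+y. (?c * ?w y') * (F y * indicator (cube 0 k) y) \<partial>lebesgue)"
        by (rule nn_integral_mono)
      also have "\<dots> = (?c * ?w y') * (\<integral>\<^sup>+y. F y * indicator (cube 0 k) y \<partial>lebesgue)"
        by (rule nn_integral_cmult)
          (intro borel_measurable_times_ennreal F borel_measurable_indicator, use cube_borel[of 0 k] in simp)
      also have "\<dots> \<le> (?c * ?w y') * B" by (intro mult_left_mono B) simp
      finally show ?thesis by (simp add: mult_ac)
    qed
    \<comment> \<open>The cube has measure 1, so the constant \<open>?L\<close> is its own mean over
      the cube, and the bound by the weight at y' can be integrated in y'.\<close>
    have "?L = (\<integral>\<^sup>+y'. ?L * indicator (cube 0 k) y' \<partial>lebesgue)"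
      by (subst nn_integral_cmult_indicator) (use cube_borel[of 0 k] emeasure_cube[of 0 k] in auto)
    also have "\<dots> \<le> (\<integral>\<^sup>+y. (?c * B * ?w y) * indicator (cube 0 k) y \<partial>lebesgue)"
    proof (rule nn_integral_mono)
      fix y'
      show "?L * indicator (cube 0 k) y' \<le> (?c * B * ?w y') * indicator (cube 0 k) y'"
        using L[of y'] by (cases "y' \<in> cube 0 k") auto
    qed
    finally show ?thesis unfolding D .
  next
    case False
    then have "?D n = {}" by blast
    then show ?thesis by simp
  qed
  then have "(\<integral>\<^sup>+y. ?w y * F y \<partial>lebesgue) \<le> (\<integral>\<^sup>+y. ?c * B * ?w y \<partial>lebesgue)"
    using w F by (subst (1 2) nn_integral_unit_cubes) (auto intro!: suminf_le)
  also have "\<dots> = ?c * B * (\<integral>\<^sup>+y. ?w y \<partial>lebesgue)" by (rule nn_integral_cmult[OF w])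
  also have "(\<integral>\<^sup>+y. ?w y \<partial>lebesgue) = (\<integral>\<^sup>+(y :: real ^ 'n). ennreal (1 / (1 + norm y) ^ N) \<partial>lebesgue)"
    using nn_integral_affine[OF wb, of "-1" x] by simp
  finally show ?thesis .
qed

text \<open>The exponent d + 2 is that of \<open>integrable_inverse_one_plus_norm_power\<close>; the
  value depends on the dimension alone.\<close>

definition weight_const :: "'n::finite itself \<Rightarrow> real" where
  "weight_const _ = (1 + real CARD('n)) ^ (CARD('n) + 2) * (LINT y|(lebesgue :: (real ^ 'n) measure). 1 / (1 + norm y) ^ (CARD('n) + 2))"

lemma weight_const_nonneg: "weight_const TYPE('n::finite) \<ge> 0"
  unfolding weight_const_def by (intro mult_nonneg_nonneg integral_nonneg_AE AE_I2) auto

lemma nn_integral_weight_le: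
  fixes F :: "real ^ 'n::finite \<Rightarrow> ennreal"
  assumes F: "F \<in> borel_measurable lebesgue" and B: "B \<ge> 0" "\<And>k. (\<integral>\<^sup>+y. F y * indicator (cube 0 k) y \<partial>lebesgue) \<le> ennreal B"
  shows "(\<integral>\<^sup>+y. ennreal (1 / (1 + norm (x - y)) ^ (CARD('n) + 2)) * F y \<partial>lebesgue) \<le> ennreal (weight_const TYPE('n) * B)"
proof -
  let ?w = "\<lambda>y :: real ^ 'n. 1 / (1 + norm y) ^ (CARD('n) + 2)"
  have i: "integrable lebesgue ?w"
    using integrable_inverse_one_plus_norm_power[where 'a = "real ^ 'n"] by simp
  have "(\<integral>\<^sup>+y. ennreal (1 / (1 + norm (x - y)) ^ (CARD('n) + 2)) * F y \<partial>lebesgue) \<le>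
    ennreal ((1 + real CARD('n)) ^ (CARD('n) + 2)) * ennreal B * (\<integral>\<^sup>+y. ennreal (?w y) \<partial>lebesgue)"
    by (rule nn_integral_weight_unit_cubes[OF F B(2)])
  also have "(\<integral>\<^sup>+y. ennreal (?w y) \<partial>lebesgue) = ennreal (LINT y|lebesgue. ?w y)"
    by (rule nn_integral_eq_integral[OF i]) auto
  also have "ennreal ((1 + real CARD('n)) ^ (CARD('n) + 2)) * ennreal B * ennreal (LINT y|lebesgue. ?w y) = ennreal (weight_const TYPE('n) * B)"
  proof -
    have I: "(LINT y|lebesgue. ?w y) \<ge> 0" by (intro integral_nonneg_AE AE_I2) auto
    have "weight_const TYPE('n) * B = (1 + real CARD('n)) ^ (CARD('n) + 2) * B * (LINT y|lebesgue. ?w y)"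
      unfolding weight_const_def by (simp only: mult_ac)
    also have "ennreal \<dots> = ennreal ((1 + real CARD('n)) ^ (CARD('n) + 2) * B) * ennreal (LINT y|lebesgue. ?w y)"
      by (rule ennreal_mult[OF _ I]) (use B(1) in simp)
    also have "ennreal ((1 + real CARD('n)) ^ (CARD('n) + 2) * B) = ennreal ((1 + real CARD('n)) ^ (CARD('n) + 2)) * ennreal B"
      by (rule ennreal_mult[OF _ B(1)]) simp
    finally show ?thesis by (rule sym)
  qed
  finally show ?thesis .
qed

text \<open>The growth bound makes A = sup |H| / v finite for v y = (1 + e |y|)^M. Splitting |H| =
  |H|^(1-p) |H|^p inside the reproducing inequality gives A \<le> A^(1-p) Q, hence A^p \<le> Q. As Q
  does not depend on e, the weight disappears when e tends to 0.\<close>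

lemma nikolskii_polynomial_growth:
  fixes H :: "real ^ 'n::finite \<Rightarrow> complex"
  assumes H: "H \<in> borel_measurable borel" and p: "0 < p" "p \<le> 1"
    and growth: "\<And>y. norm (H y) \<le> C * (1 + norm y) ^ M"
    and E: "E > 0" "\<And>z. \<omega> z \<le> E / (1 + norm z) ^ (M + (CARD('n) + 2))"
    and rep: "\<And>x. ennreal (norm (H x)) \<le> (\<integral>\<^sup>+y. ennreal (\<omega> (x - y) * norm (H y)) \<partial>lebesgue)"
    and B: "B \<ge> 0" "\<And>k. (\<integral>\<^sup>+y. ennreal (norm (H y) powr p) * indicator (cube 0 k) y \<partial>lebesgue) \<le> ennreal B"
  shows "norm (H x) \<le> (E * weight_const TYPE('n) * B) powr (1 / p)"
proof -
  let ?N = "CARD('n) + 2" and ?K = "weight_const TYPE('n)"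
  define Q where "Q = E * ?K * B"
  have Q0: "Q \<ge> 0" using E(1) B(1) weight_const_nonneg[where 'n = 'n] by (simp add: Q_def)
  have main: "norm (H x) \<le> Q powr (1 / p) * (1 + e * norm x) ^ M" if e: "0 < e" "e \<le> 1" for e x
  proof -
    define v where "v y = (1 + e * norm y) ^ M" for y :: "real ^ 'n"
    have v1: "v y \<ge> 1" for y unfolding v_def using e by (intro one_le_power) simp
    have v_pos: "v y > 0" for y using v1[of y] by linarith
    define A where "A = (SUP y. norm (H y) / v y)"
    have bd: "bdd_above (range (\<lambda>y. norm (H y) / v y))"
    proof (rule bdd_aboveI2)
      fix y :: "real ^ 'n"
      have "norm (H 0) \<le> C" using growth[of 0] by simp
      then have C0: "C \<ge> 0" by (rule order_trans[OF norm_ge_zero])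
      have "1 + norm y \<le> (1 / e) * (1 + e * norm y)" using e by (simp add: field_simps)
      then have "(1 + norm y) ^ M \<le> ((1 / e) * (1 + e * norm y)) ^ M" by (rule power_mono) simp
      then have "(1 + norm y) ^ M \<le> (1 / e) ^ M * v y" unfolding v_def by (simp only: power_mult_distrib)
      then have "C * (1 + norm y) ^ M \<le> C * ((1 / e) ^ M * v y)" using C0 by (rule mult_left_mono)
      with growth[of y] have "norm (H y) \<le> C * (1 / e) ^ M * v y" by (simp add: mult.assoc)
      then show "norm (H y) / v y \<le> C * (1 / e) ^ M" using v_pos[of y] by (simp add: pos_divide_le_eq)
    qed
    have HA: "norm (H y) \<le> A * v y" for y
      using cSUP_upper[OF _ bd, of y] v_pos[of y] unfolding A_def by (simp add: pos_divide_le_eq)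
    have "A \<ge> 0" unfolding A_def by (rule cSUP_upper2[OF bd, of 0]) (use v_pos in \<open>auto intro: divide_nonneg_pos\<close>)
    have "A \<le> Q powr (1 / p)"
    proof (cases "A = 0")
      case False
      with \<open>A \<ge> 0\<close> have A: "A > 0" by simp
      have "norm (H x) / v x \<le> A powr (1 - p) * Q" for x
      proof -
        let ?a = "A powr (1 - p) * v x * E"
        have a0: "?a \<ge> 0" using v_pos[of x] E(1) by simp
        have "ennreal (norm (H x)) \<le> (\<integral>\<^sup>+y. ennreal (\<omega> (x - y) * norm (H y)) \<partial>lebesgue)" by (rule rep)
        also have "\<dots> \<le> (\<integral>\<^sup>+y. ennreal ?a * (ennreal (1 / (1 + norm (x - y)) ^ ?N) * ennreal (norm (H y) powr p)) \<partial>lebesgue)"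
        proof (rule nn_integral_mono)
          fix y :: "real ^ 'n"
          let ?t = "(1 + norm (x - y))"
          have t: "?t > 0" by (simp add: add_pos_nonneg)
          \<comment> \<open>Peetre's inequality for v, with e \<le> 1. It costs M powers of 1 + |x -
            y|, which explains the exponent M + (d + 2) in the decay of \<omega>.\<close>
          have vy: "v y \<le> v x * ?t ^ M"
          proof -
            have "norm y \<le> norm x + norm (x - y)" using norm_triangle_sub[of y x] by (simp add: norm_minus_commute)
            then have "e * norm y \<le> e * norm x + e * norm (x - y)" using e by (simp add: distrib_left[symmetric])
            moreover have "e * norm (x - y) \<le> 1 * norm (x - y)" using e by (intro mult_right_mono) auto
            moreover have "0 \<le> e * norm x * norm (x - y)" using e by simp
            ultimately have "1 + e * norm y \<le> (1 + e * norm x) * ?t" by (simp add: algebra_simps)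
            then have "(1 + e * norm y) ^ M \<le> ((1 + e * norm x) * ?t) ^ M"
              using e by (intro power_mono) auto
            then show ?thesis unfolding v_def by (simp only: power_mult_distrib)
          qed
          have Hy: "norm (H y) \<le> (A powr (1 - p) * (v x * ?t ^ M)) * norm (H y) powr p"
          proof (cases "H y = 0")
            case False
            then have h: "norm (H y) > 0" by simp
            have "norm (H y) = norm (H y) powr (1 - p) * norm (H y) powr p"
              using h by (simp add: powr_add[symmetric])
            also have "\<dots> \<le> (A * v y) powr (1 - p) * norm (H y) powr p"
              using HA[of y] p by (intro mult_right_mono powr_mono2) auto
            also have "(A * v y) powr (1 - p) = A powr (1 - p) * v y powr (1 - p)"
              using A v_pos[of y] by (simp add: powr_mult)
            also have "\<dots> * norm (H y) powr p \<le> (A powr (1 - p) * (v x * ?t ^ M)) * norm (H y) powr p"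
            proof (intro mult_right_mono mult_left_mono)
              have "v y powr (1 - p) \<le> v y powr 1" using p v1[of y] by (intro powr_mono) auto
              then show "v y powr (1 - p) \<le> v x * ?t ^ M" using vy v_pos[of y] by simp
            qed auto
            finally show ?thesis .
          qed simp
          have "\<omega> (x - y) * norm (H y) \<le> (E / ?t ^ (M + ?N)) * norm (H y)"
            by (intro mult_right_mono E(2)) simp
          also have "\<dots> \<le> (E / ?t ^ (M + ?N)) * ((A powr (1 - p) * (v x * ?t ^ M)) * norm (H y) powr p)"
            using E(1) t by (intro mult_left_mono Hy) auto
          also have "\<dots> = ?a * ((1 / ?t ^ ?N) * norm (H y) powr p)"
            unfolding power_add using t by (simp add: field_simps)
          finally have "ennreal (\<omega> (x - y) * norm (H y)) \<le> ennreal (?a * ((1 / ?t ^ ?N) * norm (H y) powr p))"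
            by (rule ennreal_leI)
          also have "\<dots> = ennreal ?a * (ennreal (1 / ?t ^ ?N) * ennreal (norm (H y) powr p))"
            using a0 t by (simp only: ennreal_mult mult_nonneg_nonneg divide_nonneg_nonneg zero_le_one zero_le_power less_imp_le powr_ge_zero)
          finally show "ennreal (\<omega> (x - y) * norm (H y)) \<le> ennreal ?a * (ennreal (1 / ?t ^ ?N) * ennreal (norm (H y) powr p))" .
        qed
        also have "\<dots> = ennreal ?a * (\<integral>\<^sup>+y. ennreal (1 / (1 + norm (x - y)) ^ ?N) * ennreal (norm (H y) powr p) \<partial>lebesgue)"
          by (rule nn_integral_cmult, rule borel_measurable_lebesgueI) (use H in measurable)
        also have "\<dots> \<le> ennreal ?a * ennreal (?K * B)"
        proof (intro mult_left_mono nn_integral_weight_le B)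
          show "(\<lambda>y. ennreal (norm (H y) powr p)) \<in> borel_measurable lebesgue"
            by (rule borel_measurable_lebesgueI) (use H in measurable)
        qed auto
        also have "\<dots> = ennreal (?a * (?K * B))"
          using a0 B(1) weight_const_nonneg[where 'n = 'n] by (intro ennreal_mult[symmetric]) auto
        finally have "norm (H x) \<le> ?a * (?K * B)"
          using a0 B(1) weight_const_nonneg[where 'n = 'n] by (subst (asm) ennreal_le_iff) auto
        then have "norm (H x) \<le> A powr (1 - p) * Q * v x" by (simp add: Q_def mult_ac)
        then show ?thesis using v_pos[of x] by (simp add: pos_divide_le_eq)
      qed
      \<comment> \<open>A is finite and positive, so the factor A^(1-p) can be cancelled.\<close>
      then have "A \<le> A powr (1 - p) * Q" unfolding A_def[symmetric] by (subst A_def) (intro cSUP_least, auto)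
      moreover have "A = A powr (1 - p) * A powr p" using A by (simp add: powr_add[symmetric])
      ultimately have "A powr (1 - p) * A powr p \<le> A powr (1 - p) * Q" by simp
      then have "A powr p \<le> Q" using A by simp
      then have "(A powr p) powr (1 / p) \<le> Q powr (1 / p)" using p by (intro powr_mono2) auto
      then show ?thesis using A p by (simp add: powr_powr)
    qed simp
    then have "A * v x \<le> Q powr (1 / p) * v x" using v_pos[of x] by (intro mult_right_mono) auto
    with HA[of x] show ?thesis unfolding v_def by linarith
  qed
  have "(\<lambda>n. Q powr (1 / p) * (1 + inverse (real (Suc n)) * norm x) ^ M) \<longlonglongrightarrow> Q powr (1 / p) * (1 + 0 * norm x) ^ M"
    by (intro tendsto_intros LIMSEQ_inverse_real_of_nat)
  moreover have "norm (H x) \<le> Q powr (1 / p) * (1 + inverse (real (Suc n)) * norm x) ^ M" for n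
    by (rule main) (auto simp: inverse_le_1_iff)
  ultimately have "norm (H x) \<le> Q powr (1 / p) * (1 + 0 * norm x) ^ M" by (intro LIMSEQ_le_const) auto
  then show ?thesis by (simp add: Q_def)
qed

text \<open>The constant is chosen before H: it depends on \<omega> and p, but not on the order of
  growth of H.\<close>

theorem nikolskii:
  fixes \<omega> :: "real ^ 'n::finite \<Rightarrow> real"
  assumes dec: "\<And>M. \<exists>E. \<forall>z. (1 + norm z) ^ M * \<omega> z \<le> E" and p: "0 < p"
  shows "\<exists>C>0. \<forall>(H :: real ^ 'n \<Rightarrow> complex) b. H \<in> borel_measurable borel \<longrightarrow>
    (\<exists>D M. \<forall>y. norm (H y) \<le> D * (1 + norm y) ^ M) \<longrightarrow>
    (\<forall>x. ennreal (norm (H x)) \<le> (\<integral>\<^sup>+y. ennreal (\<omega> (x - y) * norm (H y)) \<partial>lebesgue)) \<longrightarrow>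
    0 < b \<longrightarrow> (\<forall>k. (\<integral>\<^sup>+y. ennreal (norm (H y) powr p) * indicator (cube 0 k) y \<partial>lebesgue) \<le> ennreal (b powr p)) \<longrightarrow>
    (\<forall>x. norm (H x) \<le> C * b)"
proof -
  let ?K = "weight_const TYPE('n)" and ?N = "CARD('n) + 2"
  have dec': "\<exists>E>0. \<forall>z. \<omega> z \<le> E / (1 + norm z) ^ (M + ?N)" for M
  proof -
    obtain E where E: "\<And>z. (1 + norm z) ^ (M + ?N) * \<omega> z \<le> E" using dec by blast
    have "\<omega> z \<le> (\<bar>E\<bar> + 1) / (1 + norm z) ^ (M + ?N)" for z
    proof -
      have "(1 + norm z) ^ (M + ?N) > 0" by (intro zero_less_power add_pos_nonneg) auto
      moreover have "\<omega> z * (1 + norm z) ^ (M + ?N) \<le> \<bar>E\<bar> + 1" using E[of z] by (simp add: mult.commute)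
      ultimately show ?thesis by (simp only: pos_le_divide_eq)
    qed
    then show ?thesis by (intro exI[of _ "\<bar>E\<bar> + 1"]) auto
  qed
  obtain E0 where E0: "E0 > 0" "\<And>z. \<omega> z \<le> E0 / (1 + norm z) ^ (0 + ?N)" using dec'[of 0] by blast
  \<comment> \<open>The preceding lemma is used twice. The first use shows that H is bounded, with a
    constant depending on the growth order M; the second starts from growth order 0 and has the
    universal constant E0.\<close>
  have small: "norm (H x) \<le> (E0 * ?K * B) powr (1 / r)"
    if H: "H \<in> borel_measurable borel" "\<exists>D M. \<forall>y. norm (H y) \<le> D * (1 + norm y) ^ M"
      and rep: "\<And>x. ennreal (norm (H x)) \<le> (\<integral>\<^sup>+y. ennreal (\<omega> (x - y) * norm (H y)) \<partial>lebesgue)"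
      and r: "0 < r" "r \<le> 1" and B: "0 \<le> B" "\<And>k. (\<integral>\<^sup>+y. ennreal (norm (H y) powr r) * indicator (cube 0 k) y \<partial>lebesgue) \<le> ennreal B"
    for H :: "real ^ 'n \<Rightarrow> complex" and r B x
  proof -
    obtain D M where DM: "\<And>y. norm (H y) \<le> D * (1 + norm y) ^ M" using H(2) by blast
    obtain E where E: "E > 0" "\<And>z. \<omega> z \<le> E / (1 + norm z) ^ (M + ?N)" using dec'[of M] by blast
    have "norm (H y) \<le> (E * ?K * B) powr (1 / r) * (1 + norm y) ^ 0" for y
      using nikolskii_polynomial_growth[OF H(1) r DM E rep B] by simp
    from nikolskii_polynomial_growth[OF H(1) r this E0 rep B] show ?thesis .
  qed
  show ?thesis
  proof (cases "p \<le> 1")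
    case True
    have "norm (H x) \<le> ((E0 * ?K) powr (1 / p) + 1) * b"
      if "H \<in> borel_measurable borel" "\<exists>D M. \<forall>y. norm (H y) \<le> D * (1 + norm y) ^ M"
        "\<forall>x. ennreal (norm (H x)) \<le> (\<integral>\<^sup>+y. ennreal (\<omega> (x - y) * norm (H y)) \<partial>lebesgue)"
        "0 < b" "\<forall>k. (\<integral>\<^sup>+y. ennreal (norm (H y) powr p) * indicator (cube 0 k) y \<partial>lebesgue) \<le> ennreal (b powr p)"
      for H :: "real ^ 'n \<Rightarrow> complex" and b x
    proof -
      have "norm (H x) \<le> (E0 * ?K * b powr p) powr (1 / p)"
        using that p True by (intro small) auto
      also have "\<dots> = (E0 * ?K) powr (1 / p) * b"
        using that(4) p E0(1) weight_const_nonneg[where 'n = 'n] by (simp add: powr_mult powr_powr)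
      also have "\<dots> \<le> ((E0 * ?K) powr (1 / p) + 1) * b" using that(4) by (intro mult_right_mono) auto
      finally show ?thesis .
    qed
    then show ?thesis by (intro exI[of _ "(E0 * ?K) powr (1 / p) + 1"]) (auto intro: add_nonneg_pos)
  next
    case False
    \<comment> \<open>For p > 1 pass to the exponent 1: |H| is at most b^(1-p) |H|^p wherever it
      exceeds b, so its integral over a unit cube is at most 2 b.\<close>
    have "norm (H x) \<le> (E0 * ?K * 2 + 1) * b"
      if "H \<in> borel_measurable borel" "\<exists>D M. \<forall>y. norm (H y) \<le> D * (1 + norm y) ^ M"
        "\<forall>x. ennreal (norm (H x)) \<le> (\<integral>\<^sup>+y. ennreal (\<omega> (x - y) * norm (H y)) \<partial>lebesgue)"
        and b: "0 < b" and c: "\<forall>k. (\<integral>\<^sup>+y. ennreal (norm (H y) powr p) * indicator (cube 0 k) y \<partial>lebesgue) \<le> ennreal (b powr p)"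
      for H :: "real ^ 'n \<Rightarrow> complex" and b x
    proof -
      have "(\<integral>\<^sup>+y. ennreal (norm (H y) powr 1) * indicator (cube 0 k) y \<partial>lebesgue) \<le> ennreal (2 * b)" for k
      proof -
        let ?I = "\<lambda>y. indicator (cube 0 k) y :: ennreal"
        have im: "?I \<in> borel_measurable lebesgue" by (rule borel_measurable_indicator) (simp add: cube_borel)
        have hm: "(\<lambda>y. ennreal (norm (H y) powr p)) \<in> borel_measurable lebesgue"
          by (rule borel_measurable_lebesgueI) (use that(1) in measurable)
        have "ennreal (norm (H y) powr 1) * ?I y \<le> ennreal b * ?I y + ennreal (b powr (1 - p)) * (ennreal (norm (H y) powr p) * ?I y)" for y
        proof -
          have "norm (H y) \<le> b + b powr (1 - p) * norm (H y) powr p"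
          proof (cases "norm (H y) \<le> b")
            case False
            then have "norm (H y) = norm (H y) powr (1 - p) * norm (H y) powr p"
              using b by (simp add: powr_add[symmetric])
            also have "\<dots> \<le> b powr (1 - p) * norm (H y) powr p"
              using False b \<open>\<not> p \<le> 1\<close> by (intro mult_right_mono powr_mono2') auto
            finally show ?thesis using b by simp
          qed (simp add: add_increasing2)
          then have "ennreal (norm (H y)) \<le> ennreal (b + b powr (1 - p) * norm (H y) powr p)" by (rule ennreal_leI)
          also have "\<dots> = ennreal b + ennreal (b powr (1 - p)) * ennreal (norm (H y) powr p)"
            using b by (simp add: ennreal_plus ennreal_mult)
          finally show ?thesis by (cases "y \<in> cube 0 k") auto
        qed
        then have "(\<integral>\<^sup>+y. ennreal (norm (H y) powr 1) * ?I y \<partial>lebesgue) \<le>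
          (\<integral>\<^sup>+y. ennreal b * ?I y + ennreal (b powr (1 - p)) * (ennreal (norm (H y) powr p) * ?I y) \<partial>lebesgue)"
          by (rule nn_integral_mono)
        also have "\<dots> = (\<integral>\<^sup>+y. ennreal b * ?I y \<partial>lebesgue) + (\<integral>\<^sup>+y. ennreal (b powr (1 - p)) * (ennreal (norm (H y) powr p) * ?I y) \<partial>lebesgue)"
          using im hm by (intro nn_integral_add borel_measurable_times_ennreal borel_measurable_const)
        also have "(\<integral>\<^sup>+y. ennreal b * ?I y \<partial>lebesgue) = ennreal b"
          by (subst nn_integral_cmult_indicator) (use cube_borel[of 0 k] emeasure_cube[of 0 k] in auto)
        also have "(\<integral>\<^sup>+y. ennreal (b powr (1 - p)) * (ennreal (norm (H y) powr p) * ?I y) \<partial>lebesgue)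
            = ennreal (b powr (1 - p)) * (\<integral>\<^sup>+y. ennreal (norm (H y) powr p) * ?I y \<partial>lebesgue)"
          using im hm by (intro nn_integral_cmult borel_measurable_times_ennreal)
        also have "ennreal b + \<dots> \<le> ennreal b + ennreal (b powr (1 - p)) * ennreal (b powr p)"
          using c by (intro add_left_mono mult_left_mono) auto
        also have "\<dots> = ennreal (2 * b)"
          using b by (simp add: ennreal_mult[symmetric] powr_add[symmetric] ennreal_plus[symmetric] del: ennreal_plus)
        finally show ?thesis .
      qed
      then have "norm (H x) \<le> (E0 * ?K * (2 * b)) powr (1 / 1)"
        using that by (intro small) auto
      also have "\<dots> = E0 * ?K * 2 * b" using E0(1) weight_const_nonneg[where 'n = 'n] b by simp
      also have "\<dots> \<le> (E0 * ?K * 2 + 1) * b" using b by (intro mult_right_mono) auto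
      finally show ?thesis .
    qed
    then show ?thesis
      using E0(1) weight_const_nonneg[where 'n = 'n]
      by (intro exI[of _ "E0 * ?K * 2 + 1"]) (auto intro: add_nonneg_pos)
  qed
qed

section \<open>The pointwise exponential estimate\<close>

text \<open>This is x \<le> exp x at x = c w / k, raised to the power k.\<close>

lemma powr_le_exp_mult:
  fixes w k c :: real
  assumes "w \<ge> 0" "k > 0" "c > 0"
  shows "w powr k \<le> (k / c) powr k * exp (c * w)"
proof (cases "w = 0")
  case False
  with assms have w: "w > 0" by simp
  have "c * w / k \<le> exp (c * w / k)" using exp_ge_add_one_self[of "c * w / k"] by linarith
  then have "(c * w / k) powr k \<le> exp (c * w / k) powr k" using assms by (intro powr_mono2) auto
  also have "\<dots> = exp (c * w)" using assms by (simp add: powr_def)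
  finally have "(k / c) powr k * (c * w / k) powr k \<le> (k / c) powr k * exp (c * w)" by (rule mult_left_mono) simp
  moreover have "(k / c) powr k * (c * w / k) powr k = w powr k"
    using assms w by (simp add: powr_mult[symmetric])
  ultimately show ?thesis by simp
qed (use assms in simp)

lemma Phi_exp_mono:
  assumes "0 < p" "0 < q" "0 \<le> s" "s \<le> t"
  shows "Phi_exp p q s \<le> Phi_exp p q t"
  unfolding Phi_exp_def using assms by (intro mult_mono powr_mono2) (auto intro!: powr_mono2)

text \<open>The exponent q here is the q' of the embedding. The scale l is chosen before b, and
  \<epsilon> is arbitrary so that it can be matched to the mass of the weighted sum S. For S \<le> 1
  the geometric bound is summed over all j, and the factor S arises from the power t^p; for S > 1
  the series is cut at N, and S arises from the exponentials.\<close>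

lemma Phi_exp_series_bound:
  fixes p q \<theta> \<epsilon> :: real
  assumes p: "0 < p" and q: "0 < q" and \<theta>: "1 < \<theta>" and \<epsilon>: "0 < \<epsilon>"
  shows "\<exists>l>0. \<forall>b :: nat \<Rightarrow> real. (\<forall>j. 0 \<le> b j) \<longrightarrow> (\<forall>N. (\<Sum>j\<le>N. b j) \<le> (real N + 1) powr (1 / q)) \<longrightarrow>
     summable (\<lambda>j. \<theta> ^ j * b j powr p) \<longrightarrow>
     summable b \<and> Phi_exp p q (suminf b / l) \<le> \<epsilon> * (\<Sum>j. \<theta> ^ j * b j powr p)"
proof -
  \<comment> \<open>The rate of decay forced by a finite S: b j \<le> S^(1/p) r^j.\<close>
  define r where "r = \<theta> powr (- 1 / p)"
  have "\<theta> powr (- 1 / p) < \<theta> powr 0" using \<theta> p by (intro powr_less_mono) auto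
  then have r: "0 < r" "r < 1" using \<theta> by (auto simp: r_def)
  define R where "R = 1 / (1 - r)"
  have R: "R > 0" using r by (simp add: R_def)
  \<comment> \<open>With w = 2 + ln S / ln \<theta>, each factor exp (c w) equals \<theta> times the
    square root of S. Two of them occur, one from w^k and one from the exponential, and together
    they make one power of S.\<close>
  define c where "c = ln \<theta> / 2"
  have c: "c > 0" using \<theta> by (simp add: c_def)
  define k where "k = p / q"
  have k: "k > 0" using p q by (simp add: k_def)
  define D where "D = (k / c) powr k"
  have D: "D > 0" using k c by (simp add: D_def)
  \<comment> \<open>The smallness gained from a large l. It needs \<mu> \<le> 1 when S \<le> 1,
    \<mu> \<le> c when S > 1, and \<mu>^k (exp 1 + D \<theta>^2) \<le> \<epsilon>, which covers the
    constants of both cases at once.\<close>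
  define \<mu> where "\<mu> = min (min 1 c) ((\<epsilon> / (exp 1 + D * \<theta>\<^sup>2)) powr (1 / k))"
  have den: "exp 1 + D * \<theta>\<^sup>2 > 0" using D \<theta> by (intro add_pos_pos) auto
  have \<mu>: "0 < \<mu>" "\<mu> \<le> 1" "\<mu> \<le> c" using c \<epsilon> den by (auto simp: \<mu>_def)
  have "\<mu> powr k \<le> ((\<epsilon> / (exp 1 + D * \<theta>\<^sup>2)) powr (1 / k)) powr k"
    using \<mu> k by (intro powr_mono2) (auto simp: \<mu>_def)
  then have "\<mu> powr k \<le> \<epsilon> / (exp 1 + D * \<theta>\<^sup>2)" using k \<epsilon> den by (simp add: powr_powr)
  then have \<mu>k: "\<mu> powr k * (exp 1 + D * \<theta>\<^sup>2) \<le> \<epsilon>" using den by (simp add: pos_le_divide_eq)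
  have \<mu>1: "\<mu> powr k * exp 1 \<le> \<epsilon>" and \<mu>2: "\<mu> powr k * (D * \<theta>\<^sup>2) \<le> \<epsilon>"
  proof -
    have "0 \<le> \<mu> powr k * (D * \<theta>\<^sup>2)" "0 \<le> \<mu> powr k * exp 1" using D by auto
    with \<mu>k show "\<mu> powr k * exp 1 \<le> \<epsilon>" "\<mu> powr k * (D * \<theta>\<^sup>2) \<le> \<epsilon>"
      unfolding distrib_left by linarith+
  qed
  define l where "l = (1 + R) / \<mu> powr (1 / q)"
  have l: "l > 0" using R \<mu> by (simp add: l_def)
  have div_l: "x / l \<le> z * \<mu> powr (1 / q)" if "x \<le> z * (1 + R)" for x z
  proof -
    have "x / l \<le> z * (1 + R) / l" using that l by (intro divide_right_mono) auto
    also have "\<dots> = z * \<mu> powr (1 / q)" using R by (simp add: l_def)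
    finally show ?thesis .
  qed
  have main: "summable b \<and> Phi_exp p q (suminf b / l) \<le> \<epsilon> * (\<Sum>j. \<theta> ^ j * b j powr p)"
    if b0: "\<And>j. 0 \<le> b j" and bs: "\<And>N. (\<Sum>j\<le>N. b j) \<le> (real N + 1) powr (1 / q)"
      and sm: "summable (\<lambda>j. \<theta> ^ j * b j powr p)" for b :: "nat \<Rightarrow> real"
  proof -
    define S where "S = (\<Sum>j. \<theta> ^ j * b j powr p)"
    have S0: "S \<ge> 0" unfolding S_def using \<theta> sm by (intro suminf_nonneg) auto
    have bj: "b j \<le> S powr (1 / p) * r ^ j" for j
    proof -
      have "\<theta> ^ j * b j powr p \<le> S"
        using sum_le_suminf[OF sm, of "{j}"] \<theta> by (simp add: S_def)
      then have "b j powr p \<le> S * \<theta> powr (- real j)"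
        using \<theta> by (simp add: powr_minus powr_realpow field_simps)
      then have "(b j powr p) powr (1 / p) \<le> (S * \<theta> powr (- real j)) powr (1 / p)"
        using p by (intro powr_mono2) auto
      also have "\<dots> = S powr (1 / p) * \<theta> powr (- real j / p)" using S0 by (simp add: powr_mult powr_powr)
      also have "\<theta> powr (- real j / p) = r ^ j"
        using r by (simp add: r_def powr_powr powr_realpow[symmetric])
      finally show ?thesis using b0[of j] p by (simp add: powr_powr)
    qed
    have sg: "summable (\<lambda>j. S powr (1 / p) * r ^ j)" using r by (intro summable_mult summable_geometric) auto
    have sb: "summable b" by (rule summable_comparison_test[OF _ sg]) (use b0 bj in auto)
    have B0: "suminf b \<ge> 0" by (rule suminf_nonneg[OF sb b0])
    have "Phi_exp p q (suminf b / l) \<le> \<epsilon> * S"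
    proof (cases "S \<le> 1")
      case True
      have "suminf b \<le> (\<Sum>j. S powr (1 / p) * r ^ j)" by (rule suminf_le[OF bj sb sg])
      also have "\<dots> = S powr (1 / p) * R" using r by (simp add: suminf_mult suminf_geometric summable_geometric R_def)
      also have "\<dots> \<le> S powr (1 / p) * (1 + R)" by (intro mult_left_mono) auto
      finally have "suminf b / l \<le> S powr (1 / p) * \<mu> powr (1 / q)"
        by (rule div_l)
      then have "Phi_exp p q (suminf b / l) \<le> Phi_exp p q (S powr (1 / p) * \<mu> powr (1 / q))"
        using p q B0 l by (intro Phi_exp_mono) auto
      also have "\<dots> = S * \<mu> powr k * exp (S powr (q / p) * \<mu>)"
        using S0 \<mu> p q by (simp add: Phi_exp_def powr_mult powr_powr k_def)
      also have "\<dots> \<le> S * \<mu> powr k * exp 1"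
      proof -
        have "S powr (q / p) \<le> 1 powr (q / p)" using True S0 p q by (intro powr_mono2) auto
        then have "S powr (q / p) * \<mu> \<le> 1 * 1" using \<mu> by (intro mult_mono) auto
        then show ?thesis using S0 by (intro mult_left_mono) auto
      qed
      also have "\<dots> = S * (\<mu> powr k * exp 1)" by simp
      also have "\<dots> \<le> S * \<epsilon>" by (rule mult_left_mono[OF \<mu>1 S0])
      finally show ?thesis by (simp add: mult.commute)
    next
      case False
      then have S1: "S > 1" by simp
      \<comment> \<open>The first index with \<theta>^N \<ge> S: from here on the geometric bound
        S^(1/p) r^j is at most 1.\<close>
      define N where "N = nat \<lceil>ln S / ln \<theta>\<rceil>"
      have lS: "ln S / ln \<theta> \<ge> 0" using S1 \<theta> by simp
      \<comment> \<open>Bounds the number N + 1 of leading terms: one unit for rounding up, one for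
        the index 0.\<close>
      define w where "w = 2 + ln S / ln \<theta>"
      have N1: "ln S / ln \<theta> \<le> real N" unfolding N_def by linarith
      have N2: "real N + 1 \<le> w" unfolding N_def w_def using lS by linarith
      have SN: "S powr (1 / p) * r ^ N \<le> 1"
      proof -
        have "ln S \<le> real N * ln \<theta>" using N1 \<theta> by (simp add: pos_divide_le_eq)
        then have "exp (ln S) \<le> exp (real N * ln \<theta>)" by simp
        then have "S \<le> \<theta> powr real N" using S1 \<theta> by (simp add: powr_def)
        then have "S powr (1 / p) \<le> (\<theta> powr real N) powr (1 / p)" using S1 p by (intro powr_mono2) auto
        then have "S powr (1 / p) * r ^ N \<le> (\<theta> powr real N) powr (1 / p) * r ^ N"
          using r by (intro mult_right_mono) auto
        also have "\<dots> = \<theta> powr (real N / p) * \<theta> powr (- real N / p)"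
          using r by (simp add: r_def powr_powr powr_realpow[symmetric])
        also have "\<dots> = 1" using \<theta> by (simp add: powr_add[symmetric])
        finally show ?thesis .
      qed
      have "suminf b = (\<Sum>n. b (n + Suc N)) + (\<Sum>j<Suc N. b j)" by (rule suminf_split_initial_segment[OF sb])
      also have "(\<Sum>j<Suc N. b j) \<le> (real N + 1) powr (1 / q)" using bs[of N] by (simp add: lessThan_Suc_atMost)
      also have "(\<Sum>n. b (n + Suc N)) \<le> (\<Sum>n. r ^ n)"
      proof (rule suminf_le)
        fix n
        have "S powr (1 / p) * r ^ (n + Suc N) = (S powr (1 / p) * r ^ N) * r ^ Suc n" by (simp add: power_add mult_ac)
        also have "\<dots> \<le> 1 * r ^ Suc n" using SN r by (intro mult_right_mono) auto
        also have "\<dots> \<le> 1 * r ^ n" using r by simp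
        finally show "b (n + Suc N) \<le> r ^ n" using bj[of "n + Suc N"] by linarith
        show "summable (\<lambda>n. b (n + Suc N))" using sb by (subst summable_iff_shift)
        show "summable (\<lambda>n. r ^ n)" using r by (intro summable_geometric) auto
      qed
      also have "(\<Sum>n. r ^ n) = R" using r by (simp add: suminf_geometric R_def)
      finally have "suminf b \<le> R + (real N + 1) powr (1 / q)" by simp
      also have "\<dots> \<le> R * (real N + 1) powr (1 / q) + (real N + 1) powr (1 / q)"
        using R q ge_one_powr_ge_zero[of "real N + 1" "1 / q"] by simp
      also have "\<dots> = (1 + R) * (real N + 1) powr (1 / q)" by (simp add: algebra_simps)
      also have "\<dots> \<le> (1 + R) * w powr (1 / q)" using R N2 q by (intro mult_left_mono powr_mono2) auto
      finally have "suminf b / l \<le> w powr (1 / q) * \<mu> powr (1 / q)"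
        by (intro div_l) (simp add: mult.commute)
      then have "Phi_exp p q (suminf b / l) \<le> Phi_exp p q (w powr (1 / q) * \<mu> powr (1 / q))"
        using p q B0 l by (intro Phi_exp_mono) auto
      also have "\<dots> = w powr k * \<mu> powr k * exp (w * \<mu>)"
        using \<mu> p q lS by (simp add: Phi_exp_def powr_mult powr_powr k_def w_def)
      also have "\<dots> \<le> (D * exp (c * w)) * \<mu> powr k * exp (c * w)"
      proof (intro mult_mono)
        show "w powr k \<le> D * exp (c * w)" unfolding D_def using lS k c by (intro powr_le_exp_mult) (auto simp: w_def)
        show "exp (w * \<mu>) \<le> exp (c * w)" using \<mu> lS by (simp add: w_def mult.commute mult_right_mono)
      qed (use D in auto)
      also have "\<dots> = S * (\<mu> powr k * (D * \<theta>\<^sup>2))"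
      proof -
        have "c * w = ln \<theta> + ln S / 2" using \<theta> by (simp add: c_def w_def field_simps)
        then have "exp (c * w) * exp (c * w) = exp (ln \<theta>) * exp (ln \<theta>) * exp (ln S)"
          by (simp add: exp_add[symmetric] algebra_simps)
        also have "\<dots> = \<theta>\<^sup>2 * S" using \<theta> S1 by (simp add: power2_eq_square)
        finally show ?thesis by (simp add: mult_ac)
      qed
      also have "\<dots> \<le> S * \<epsilon>" by (rule mult_left_mono[OF \<mu>2 S0])
      finally show ?thesis by (simp add: mult.commute)
    qed
    with sb show ?thesis by (simp add: S_def)
  qed
  show ?thesis
    using l main by blast
qed

text \<open>Lets the bound on \<Phi> also control the absolute sum of the blocks linearly, which is
  what local integrability and dominated convergence require.\<close>

lemma le_one_plus_Phi_exp:
  assumes "0 < p" "1 \<le> q" "0 \<le> t"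
  shows "t \<le> 1 + Phi_exp p q t"
proof (cases "t \<le> 1")
  case True
  have "Phi_exp p q t \<ge> 0" by (simp add: Phi_exp_def)
  with True show ?thesis by linarith
next
  case False
  have "t powr 1 \<le> t powr q" using False assms by (intro powr_mono) auto
  then have "t \<le> exp (t powr q)" using exp_ge_add_one_self[of "t powr q"] False by (simp del: exp_ge_add_one_self)
  also have "1 * exp (t powr q) \<le> t powr p * exp (t powr q)"
    using False assms ge_one_powr_ge_zero[of t p] by (intro mult_right_mono) auto
  then have "exp (t powr q) \<le> Phi_exp p q t" by (simp add: Phi_exp_def)
  finally show ?thesis by linarith
qed

section \<open>Dyadic blocks of a tempered distribution\<close>

lemma resolution_generator_test:
  assumes "resolution_generator \<phi>"
  shows "\<phi> \<in> test_functions" "\<phi> 0 = 1" "\<And>x. norm x > 2 \<Longrightarrow> \<phi> x = 0" "\<And>x. norm x \<le> 1 \<Longrightarrow> \<phi> x = 1"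
proof -
  show z: "\<phi> x = 0" if "norm x > 2" for x
    by (rule zero_outside_supp) (use assms that in \<open>auto simp: resolution_generator_def\<close>)
  show "\<phi> x = 1" if "norm x \<le> 1" for x using assms that by (simp add: resolution_generator_def)
  then show "\<phi> 0 = 1" by simp
  show "\<phi> \<in> test_functions"
    by (rule testI[OF _ z]) (use assms in \<open>auto simp: resolution_generator_def schwartz_smooth\<close>)
qed

definition dil :: "(real ^ 'n::finite \<Rightarrow> complex) \<Rightarrow> nat \<Rightarrow> real ^ 'n \<Rightarrow> complex" where
  "dil \<phi> j x = \<phi> ((1 / 2) ^ j *\<^sub>R x)"

lemma resolution_0: "resolution \<phi> 0 = dil \<phi> 0"
  by (simp add: resolution_def dil_def fun_eq_iff)

lemma powi_neg_nat: "(2 :: real) powi (- int j) = (1 / 2) ^ j"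
  by (simp add: power_int_minus power_one_over inverse_eq_divide)

lemma resolution_Suc: "resolution \<phi> (Suc j) = (\<lambda>x. dil \<phi> (Suc j) x - dil \<phi> j x)"
proof -
  have "- int (Suc j) + 1 = - int j" by simp
  then have e: "(2 :: real) powi (- int (Suc j) + 1) = (1 / 2) ^ j" using powi_neg_nat[of j] by (simp only:)
  show ?thesis unfolding resolution_def dil_def e powi_neg_nat by simp
qed

lemma sum_resolution: "(\<Sum>j\<le>N. resolution \<phi> j x) = dil \<phi> N x"
  by (induction N) (auto simp: resolution_0 resolution_Suc)

lemma test_diff:
  assumes "f \<in> test_functions" "g \<in> test_functions"
  shows "(\<lambda>x. f x - g x) \<in> test_functions"
proof -
  obtain R1 where R1: "\<And>x. norm x > R1 \<Longrightarrow> f x = 0" using test_vanish[OF assms(1)] by metis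
  obtain R2 where R2: "\<And>x. norm x > R2 \<Longrightarrow> g x = 0" using test_vanish[OF assms(2)] by metis
  show ?thesis
  proof (rule testI)
    show "smooth (\<lambda>x. f x - g x)"
      using smooth_lincomb[OF assms[THEN test_smooth], of 1 "-1"] by simp
    show "f x - g x = 0" if "norm x > max R1 R2" for x using that R1[of x] R2[of x] by simp
  qed
qed

lemma dil_test: "\<phi> \<in> test_functions \<Longrightarrow> dil \<phi> j \<in> test_functions"
  using test_affine[of \<phi> "(1 / 2) ^ j" 0] by (simp add: dil_def[abs_def])

lemma resolution_test: "\<phi> \<in> test_functions \<Longrightarrow> resolution \<phi> j \<in> test_functions"
  by (cases j) (auto simp: resolution_0 resolution_Suc intro: test_diff dil_test)

text \<open>The piece number j lives where |\<xi>| \<le> 2^(j+1), and there the next dilate equals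
  1. The two dilates whose difference is the piece are treated separately.\<close>

lemma resolution_mult_dil:
  assumes "resolution_generator \<phi>"
  shows "resolution \<phi> j \<xi> * dil \<phi> (Suc j) \<xi> = resolution \<phi> j \<xi>"
proof -
  note \<phi> = resolution_generator_test[OF assms]
  have *: "dil \<phi> i \<xi> * dil \<phi> (Suc j) \<xi> = dil \<phi> i \<xi>" if "i \<le> j" for i
  proof (cases "norm ((1 / 2) ^ Suc j *\<^sub>R \<xi>) \<le> 1")
    case True
    then show ?thesis by (simp only: dil_def[of _ "Suc j"] \<phi>(4) mult_1_right)
  next
    case False
    then have "(1 / 2) ^ j * norm \<xi> > 2" by (simp add: power_one_over field_simps)
    moreover have "(1 / 2 :: real) ^ j \<le> (1 / 2) ^ i" using that by (intro power_decreasing) auto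
    then have "(1 / 2) ^ j * norm \<xi> \<le> (1 / 2) ^ i * norm \<xi>" by (rule mult_right_mono) simp
    ultimately have "norm ((1 / 2) ^ i *\<^sub>R \<xi>) > 2" by simp
    then have "dil \<phi> i \<xi> = 0" unfolding dil_def by (rule \<phi>(3))
    then show ?thesis by simp
  qed
  show ?thesis
  proof (cases j)
    case 0
    with *[of 0] show ?thesis by (simp only: resolution_0 order_refl)
  next
    case (Suc n)
    then have "n \<le> j" by simp
    from *[OF this] *[of j] show ?thesis by (simp only: Suc resolution_Suc left_diff_distrib order_refl)
  qed
qed

lemma ft_dil:
  fixes \<phi> :: "real ^ 'n::finite \<Rightarrow> complex"
  assumes "\<phi> \<in> test_functions"
  shows "ft (dil \<phi> j) x = of_real (2 ^ (j * CARD('n))) * ft \<phi> (2 ^ j *\<^sub>R x)"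
proof -
  have "ft \<phi> (2 ^ j *\<^sub>R x) = of_real (((1 / 2) ^ j) ^ CARD('n)) * ft (\<lambda>\<xi>. \<phi> ((1 / 2) ^ j *\<^sub>R \<xi>)) ((1 / 2) ^ j *\<^sub>R (2 ^ j *\<^sub>R x))"
    by (rule ft_dilate[OF test_borel[OF assms]]) simp
  moreover have "(1 / 2 :: real) ^ j * 2 ^ j = 1" by (simp add: power_mult_distrib[symmetric])
  ultimately have "ft \<phi> (2 ^ j *\<^sub>R x) = of_real (((1 / 2) ^ j) ^ CARD('n)) * ft (dil \<phi> j) x"
    by (simp add: dil_def[abs_def])
  moreover have "(2 :: real) ^ (j * CARD('n)) * ((1 / 2) ^ j) ^ CARD('n) = 1"
    by (simp add: power_mult power_mult_distrib[symmetric])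
  then have "complex_of_real (2 ^ (j * CARD('n))) * of_real (((1 / 2) ^ j) ^ CARD('n)) = 1"
    by (simp only: of_real_mult[symmetric] of_real_1)
  ultimately show ?thesis by (simp only: mult.assoc[symmetric] mult_1)
qed

text \<open>The continuous function that \<open>block_dist \<phi> T j\<close> is given by.\<close>

definition block :: "(real ^ 'n::finite \<Rightarrow> complex) \<Rightarrow> ((real ^ 'n \<Rightarrow> complex) \<Rightarrow> complex) \<Rightarrow> nat \<Rightarrow> real ^ 'n \<Rightarrow> complex" where
  "block \<phi> T j y = of_real ((2 * pi) powr - real CARD('n)) * T (\<lambda>x. ft (resolution \<phi> j) (x - y))"

definition block_dist :: "(real ^ 'n::finite \<Rightarrow> complex) \<Rightarrow> ((real ^ 'n \<Rightarrow> complex) \<Rightarrow> complex) \<Rightarrow> nat \<Rightarrow> (real ^ 'n \<Rightarrow> complex) \<Rightarrow> complex" where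
  "block_dist \<phi> T j = inv_fourier_dist (mult_dist (resolution \<phi> j) (fourier_dist T))"

lemma integrable_continuous_compact:
  fixes f :: "'a::euclidean_space \<Rightarrow> complex"
  assumes "continuous_on UNIV f" "compact K"
  shows "integrable lebesgue (\<lambda>x. f x * indicator K x)"
proof -
  have "integrable lborel (\<lambda>x. indicator K x *\<^sub>R f x)"
    using assms by (intro borel_integrable_compact) (auto intro: continuous_on_subset)
  moreover have "(\<lambda>x. indicator K x *\<^sub>R f x) = (\<lambda>x. f x * indicator K x)" by (auto simp: indicator_def)
  ultimately have i: "integrable lborel (\<lambda>x. f x * indicator K x)" by simp
  then show ?thesis using integrable_completion[OF borel_measurable_integrable[OF i]] by simp
qed

lemma set_integrable_iff_indicator:
  fixes f :: "'a \<Rightarrow> complex"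
  shows "set_integrable M K f \<longleftrightarrow> integrable M (\<lambda>x. f x * indicator K x)"
proof -
  have "(\<lambda>x. indicator K x *\<^sub>R f x) = (\<lambda>x. f x * indicator K x)" by (auto simp: indicator_def)
  then show ?thesis by (simp add: set_integrable_def)
qed

section \<open>The blocks of a fixed distribution T\<close>

context
  fixes \<phi> :: "real ^ 'n::finite \<Rightarrow> complex" and T :: "(real ^ 'n \<Rightarrow> complex) \<Rightarrow> complex"
  assumes \<phi>: "resolution_generator \<phi>" and T: "T \<in> tempered_distributions"
begin

lemmas generator = resolution_generator_test[OF \<phi>]
lemmas piece_test = resolution_test[OF generator(1)]
lemmas piece_ft = ft_schwartz[OF piece_test]

lemma block_continuous: "continuous_on S (block \<phi> T j)"
  unfolding block_def by (intro continuous_intros tempered_translate_continuous[OF T piece_ft])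

lemma block_borel: "block \<phi> T j \<in> borel_measurable borel"
  by (intro borel_measurable_continuous_onI block_continuous)

lemma block_growth: "\<exists>C\<ge>0. \<exists>M. \<forall>y. norm (block \<phi> T j y) \<le> C * (1 + norm y) ^ M"
proof -
  obtain C M where C: "C \<ge> 0" "\<And>z. norm (T (\<lambda>x. ft (resolution \<phi> j) (x - z))) \<le> C * (1 + norm z) ^ M"
    using tempered_translate_growth[OF T piece_ft[of j]] by metis
  let ?k = "norm (complex_of_real ((2 * pi) powr - real CARD('n)))"
  have "norm (block \<phi> T j y) \<le> (?k * C) * (1 + norm y) ^ M" for y
    unfolding block_def norm_mult[of "complex_of_real _"] mult.assoc by (intro mult_left_mono C(2)) simp
  moreover have "?k * C \<ge> 0" using C(1) by simp
  ultimately show ?thesis by blast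
qed

lemma fourier_mult_inv_fourier_fun:
  assumes "f \<in> test_functions" "\<eta> \<in> test_functions"
  shows "fourier (\<lambda>\<xi>. f \<xi> * inv_fourier \<eta> \<xi>) =
     (\<lambda>x. of_real ((2 * pi) powr - real CARD('n)) * (LINT y|lebesgue. \<eta> y * ft f (x - y :: real ^ 'n)))"
  using fourier_mult_inv_fourier[OF assms] by blast

text \<open>The multiplier acts on \<eta> as a convolution; moving T under the integral over the
  translates leaves \<open>block\<close> as the density.\<close>

lemma block_dist_eq:
  assumes \<eta>: "\<eta> \<in> test_functions"
  shows "block_dist \<phi> T j \<eta> = (LINT y|lebesgue. \<eta> y * block \<phi> T j y)"
    and "integrable lebesgue (\<lambda>y. \<eta> y * block \<phi> T j y)"
proof -
  let ?c = "complex_of_real ((2 * pi) powr - real CARD('n))"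
  note r\<eta> = schwartz_rapidly_decreasing[OF test_schwartz[OF \<eta>]]
  have "block_dist \<phi> T j \<eta> = T (\<lambda>x. ?c * (LINT y|lebesgue. \<eta> y * ft (resolution \<phi> j) (x - y)))"
    unfolding block_dist_def inv_fourier_dist_def mult_dist_def fourier_dist_def
      fourier_mult_inv_fourier_fun[OF piece_test \<eta>] ..
  also have "\<dots> = ?c * T (\<lambda>x. LINT y|lebesgue. \<eta> y * ft (resolution \<phi> j) (x - y))"
    by (rule tempered_cmult[OF T convolution_schwartz[OF piece_ft r\<eta>]])
  also have "\<dots> = ?c * (LINT y|lebesgue. \<eta> y * T (\<lambda>x. ft (resolution \<phi> j) (x - y)))"
    by (simp only: tempered_interchange(2)[OF T piece_ft r\<eta>])
  also have "\<dots> = (LINT y|lebesgue. ?c * (\<eta> y * T (\<lambda>x. ft (resolution \<phi> j) (x - y))))"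
    by (simp only: integral_mult_right_zero)
  also have "\<dots> = (LINT y|lebesgue. \<eta> y * block \<phi> T j y)"
    by (simp only: block_def mult_ac)
  finally show "block_dist \<phi> T j \<eta> = (LINT y|lebesgue. \<eta> y * block \<phi> T j y)" .
  have "integrable lebesgue (\<lambda>y. ?c * (\<eta> y * T (\<lambda>x. ft (resolution \<phi> j) (x - y))))"
    by (rule integrable_mult_right[OF tempered_interchange(1)[OF T piece_ft r\<eta>]])
  then show "integrable lebesgue (\<lambda>y. \<eta> y * block \<phi> T j y)" by (simp only: block_def mult_ac)
qed

text \<open>The next dilate is 1 on the support of the piece, so convolution with its transform
  returns the transform of the piece up to the constant of \<open>ft_inversion\<close>. T is then
  applied to both sides.\<close>

lemma block_reproducing:
  shows "(LINT z|lebesgue. ft \<phi> z) * block \<phi> T j y = (LINT z|lebesgue. ft (dil \<phi> (Suc j)) (z - y) * block \<phi> T j z)"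
    and "integrable lebesgue (\<lambda>z. ft (dil \<phi> (Suc j)) (z - y) * block \<phi> T j z)"
proof -
  let ?c = "complex_of_real ((2 * pi) powr - real CARD('n))" and ?m = "LINT z|lebesgue. ft \<phi> z"
  let ?\<eta> = "\<lambda>z. ft (dil \<phi> (Suc j)) (z - y)"
  have r\<eta>: "rapidly_decreasing ?\<eta>"
    by (intro schwartz_rapidly_decreasing schwartz_translate ft_schwartz dil_test generator)
  have "(LINT z|lebesgue. ?\<eta> z * ft (resolution \<phi> j) (x - z)) = ?m * ft (resolution \<phi> j) (x - y)" for x
    using ft_convolution[OF generator(1,2) piece_test[of j] dil_test[OF generator(1), of "Suc j"], of x y]
    by (simp only: resolution_mult_dil[OF \<phi>] mult.commute[of "ft (resolution \<phi> j) (x - _)"])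
  then have "T (\<lambda>x. LINT z|lebesgue. ?\<eta> z * ft (resolution \<phi> j) (x - z)) = T (\<lambda>x. ?m * ft (resolution \<phi> j) (x - y))"
    by (simp only:)
  also have "\<dots> = ?m * T (\<lambda>x. ft (resolution \<phi> j) (x - y))"
    by (rule tempered_cmult[OF T schwartz_translate[OF piece_ft]])
  finally have "?m * T (\<lambda>x. ft (resolution \<phi> j) (x - y)) = (LINT z|lebesgue. ?\<eta> z * T (\<lambda>x. ft (resolution \<phi> j) (x - z)))"
    by (simp only: tempered_interchange(2)[OF T piece_ft r\<eta>])
  note eq = this
  have "?m * block \<phi> T j y = ?c * (?m * T (\<lambda>x. ft (resolution \<phi> j) (x - y)))"
    unfolding block_def by (rule mult.left_commute)
  also have "\<dots> = ?c * (LINT z|lebesgue. ?\<eta> z * T (\<lambda>x. ft (resolution \<phi> j) (x - z)))"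
    by (simp only: eq)
  also have "\<dots> = (LINT z|lebesgue. ?c * (?\<eta> z * T (\<lambda>x. ft (resolution \<phi> j) (x - z))))"
    by (simp only: integral_mult_right_zero)
  finally show "?m * block \<phi> T j y = (LINT z|lebesgue. ?\<eta> z * block \<phi> T j z)"
    by (simp only: block_def mult_ac)
  have "integrable lebesgue (\<lambda>z. ?c * (?\<eta> z * T (\<lambda>x. ft (resolution \<phi> j) (x - z))))"
    by (rule integrable_mult_right[OF tempered_interchange(1)[OF T piece_ft r\<eta>]])
  then show "integrable lebesgue (\<lambda>z. ?\<eta> z * block \<phi> T j z)" by (simp only: block_def mult_ac)
qed

text \<open>The norm \<open>morrey_norm_dist\<close> is an infimum over representing functions; this
  identifies each of them with the continuous one, whose pointwise values are estimated
  later.\<close>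

lemma block_unique:
  assumes g: "g \<in> borel_measurable lebesgue" "distribution_given_by (block_dist \<phi> T j) g"
  shows "AE x in lebesgue. g x = block \<phi> T j x"
proof -
  note bm = borel_measurable_lebesgueI[OF block_borel[of j]]
  have gi: "integrable lebesgue (\<lambda>x. g x * indicator K x)" if "compact K" for K
    using g(2) that by (simp add: distribution_given_by_def set_integrable_iff_indicator)
  have "AE x in lebesgue. g x - block \<phi> T j x = 0"
  proof (rule du_Bois_Reymond[OF generator(1,2)])
    show "(\<lambda>x. g x - block \<phi> T j x) \<in> borel_measurable lebesgue" using g(1) bm by (rule borel_measurable_diff)
    show "integrable lebesgue (\<lambda>x. (g x - block \<phi> T j x) * indicator K x)" if "compact K" for K
      using Bochner_Integration.integrable_diff[OF gi[OF that] integrable_continuous_compact[OF block_continuous that]]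
      by (simp only: left_diff_distrib)
    fix \<eta> :: "real ^ 'n \<Rightarrow> complex" assume \<eta>: "\<eta> \<in> test_functions"
    have "(LINT x|lebesgue. g x * \<eta> x) = block_dist \<phi> T j \<eta>"
      using g(2) \<eta> by (simp add: distribution_given_by_def)
    also have "\<dots> = (LINT x|lebesgue. block \<phi> T j x * \<eta> x)"
      using block_dist_eq(1)[OF \<eta>] by (simp only: mult.commute)
    finally have eq: "(LINT x|lebesgue. g x * \<eta> x) = (LINT x|lebesgue. block \<phi> T j x * \<eta> x)" .
    have ib: "integrable lebesgue (\<lambda>x. block \<phi> T j x * \<eta> x)"
      using block_dist_eq(2)[OF \<eta>] by (simp only: mult.commute)
    have ig: "integrable lebesgue (\<lambda>x. g x * \<eta> x)"
    proof -
      obtain R where R: "\<And>x. norm x > R \<Longrightarrow> \<eta> x = 0" using test_vanish[OF \<eta>] by metis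
      obtain M where M: "M \<ge> 0" "\<And>x. norm (\<eta> x) \<le> M" using test_bounded0[OF \<eta>] by metis
      show ?thesis
      proof (rule Bochner_Integration.integrable_bound)
        show "integrable lebesgue (\<lambda>x. of_real M * (g x * indicator (cball 0 R) x))"
          by (intro integrable_mult_right gi) simp
        show "(\<lambda>x. g x * \<eta> x) \<in> borel_measurable lebesgue"
          by (intro borel_measurable_times g(1) borel_measurable_lebesgueI test_borel \<eta>)
        show "AE x in lebesgue. norm (g x * \<eta> x) \<le> norm (of_real M * (g x * indicator (cball 0 R) x))"
        proof (rule AE_I2)
          fix x
          show "norm (g x * \<eta> x) \<le> norm (of_real M * (g x * indicator (cball 0 R) x))"
            using R[of x] mult_left_mono[OF M(2)[of x], of "norm (g x)"] M(1)
            by (cases "norm x > R") (auto simp: norm_mult mult.commute)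
        qed
      qed
    qed
    show "(LINT x|lebesgue. (g x - block \<phi> T j x) * \<eta> x) = 0"
      using Bochner_Integration.integral_diff[OF ig ib] eq by (simp add: left_diff_distrib)
  qed
  then show ?thesis by simp
qed

text \<open>Without a representing function of finite norm the right side is the infimum of the
  empty set, that is \<infinity>.\<close>

lemma morrey_norm_block_le: "morrey_norm u p (block \<phi> T j) \<le> morrey_norm_dist u p (block_dist \<phi> T j)"
  unfolding morrey_norm_dist_def
proof (rule INF_greatest)
  fix g assume "g \<in> {g \<in> morrey_space u p. distribution_given_by (block_dist \<phi> T j) g}"
  then have g: "g \<in> borel_measurable lebesgue" "distribution_given_by (block_dist \<phi> T j) g"
    by (auto simp: morrey_space_def)
  have "(\<integral>\<^sup>+y\<in>Q. ennreal (norm (block \<phi> T j y) powr p) \<partial>lebesgue) = (\<integral>\<^sup>+y\<in>Q. ennreal (norm (g y) powr p) \<partial>lebesgue)" for Q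
    by (rule nn_integral_cong_AE) (use block_unique[OF g] in eventually_elim, simp)
  then have "morrey_norm u p (block \<phi> T j) = morrey_norm u p g" by (simp add: morrey_norm_def)
  then show "morrey_norm u p (block \<phi> T j) \<le> morrey_norm u p g" by simp
qed

text \<open>The transforms of the pieces telescope to that of \<phi>(2^-N x), and a substitution
  turns convolution with it into a superposition of shifts that shrink like 2^-N.\<close>

lemma sum_block_dist:
  assumes \<eta>: "\<eta> \<in> test_functions"
  shows "(\<Sum>j\<le>N. block_dist \<phi> T j \<eta>) = of_real ((2 * pi) powr - real CARD('n)) * T (\<lambda>x. LINT v|lebesgue. ft \<phi> v * \<eta> (x - (1 / 2) ^ N *\<^sub>R v))"
proof -
  let ?c = "complex_of_real ((2 * pi) powr - real CARD('n))"
  note r\<eta> = schwartz_rapidly_decreasing[OF test_schwartz[OF \<eta>]]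
  note S = convolution_schwartz[OF piece_ft r\<eta>]
  have "(\<Sum>j\<le>N. block_dist \<phi> T j \<eta>) = (\<Sum>j\<le>N. ?c * T (\<lambda>x. LINT y|lebesgue. \<eta> y * ft (resolution \<phi> j) (x - y)))"
    unfolding block_dist_def inv_fourier_dist_def mult_dist_def fourier_dist_def
      fourier_mult_inv_fourier_fun[OF piece_test \<eta>] tempered_cmult[OF T S] ..
  also have "\<dots> = ?c * (\<Sum>j\<le>N. 1 * T (\<lambda>x. LINT y|lebesgue. \<eta> y * ft (resolution \<phi> j) (x - y)))"
    by (simp add: sum_distrib_left)
  also have "(\<Sum>j\<le>N. 1 * T (\<lambda>x. LINT y|lebesgue. \<eta> y * ft (resolution \<phi> j) (x - y))) =
     T (\<lambda>x. \<Sum>j\<le>N. 1 * (LINT y|lebesgue. \<eta> y * ft (resolution \<phi> j) (x - y)))"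
    using tempered_sum[OF T _ S, of "{..N}" "\<lambda>j. 1" "\<lambda>j. j"] by simp
  also have "(\<lambda>x. \<Sum>j\<le>N. 1 * (LINT y|lebesgue. \<eta> y * ft (resolution \<phi> j) (x - y))) =
      (\<lambda>x. LINT v|lebesgue. ft \<phi> v * \<eta> (x - (1 / 2) ^ N *\<^sub>R v))"
  proof
    fix x
    have i1: "integrable lebesgue (\<lambda>y. \<eta> y * ft (resolution \<phi> j) (x - y))" for j
      by (rule superposition_integrable[OF piece_ft test_integrable[OF \<eta>]]) (rule borel_measurable_lebesgueI, simp)
    have ii: "integrable lebesgue (\<lambda>\<xi>. cis (- (z \<bullet> \<xi>)) * resolution \<phi> j \<xi>)" for z j
      by (rule integrable_cis_mult[OF test_integrable[OF piece_test]]) simp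
    have ftsum: "(\<Sum>j\<le>N. ft (resolution \<phi> j) z) = ft (dil \<phi> N) z" for z
      unfolding ft_def by (simp add: ii Bochner_Integration.integral_sum[symmetric] sum_distrib_left[symmetric] sum_resolution)
    have "(\<Sum>j\<le>N. 1 * (LINT y|lebesgue. \<eta> y * ft (resolution \<phi> j) (x - y))) = (LINT y|lebesgue. (\<Sum>j\<le>N. \<eta> y * ft (resolution \<phi> j) (x - y)))"
      by (simp add: i1 Bochner_Integration.integral_sum)
    also have "\<dots> = (LINT y|lebesgue. \<eta> y * ft (dil \<phi> N) (x - y))"
      by (simp only: sum_distrib_left[symmetric] ftsum)
    also have "\<dots> = (LINT v|lebesgue. ft \<phi> v * \<eta> (x - (1 / 2) ^ N *\<^sub>R v))"
      unfolding dil_def[abs_def] by (rule convolution_ft_dilate[OF generator(1) \<eta>]) simp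
    finally show "(\<Sum>j\<le>N. 1 * (LINT y|lebesgue. \<eta> y * ft (resolution \<phi> j) (x - y))) =
       (LINT v|lebesgue. ft \<phi> v * \<eta> (x - (1 / 2) ^ N *\<^sub>R v))" .
  qed
  finally show ?thesis .
qed

lemma sum_block_dist_tendsto:
  assumes \<eta>: "\<eta> \<in> test_functions"
  shows "(\<lambda>N. \<Sum>j\<le>N. block_dist \<phi> T j \<eta>) \<longlonglongrightarrow>
    of_real ((2 * pi) powr - real CARD('n)) * (LINT z|lebesgue. ft \<phi> z) * T \<eta>"
proof -
  have "(\<lambda>N. (1 / 2 :: real) ^ N) \<longlonglongrightarrow> 0" by (rule LIMSEQ_power_zero) simp
  moreover have "\<bar>(1 / 2 :: real) ^ N\<bar> \<le> 1" for N by (simp add: power_le_one)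
  ultimately show ?thesis
    unfolding sum_block_dist[OF \<eta>] mult.assoc
    by (intro tendsto_mult_left tempered_approximate_identity T test_schwartz \<eta> schwartz_rapidly_decreasing
        ft_schwartz generator(1))
qed

end

section \<open>Real bounds extracted from the extended norms\<close>

lemma conjugate_exponent_cases:
  fixes q :: ennreal and q' :: real
  assumes "1 < q" "1 / q + 1 / ennreal q' = 1"
  shows "q' \<ge> 1" "q = \<infinity> \<Longrightarrow> q' = 1" "q \<noteq> \<infinity> \<Longrightarrow> enn2real q > 1 \<and> q' > 1 \<and> 1 / enn2real q + 1 / q' = 1"
proof -
  \<comment> \<open>A nonpositive real becomes 0 in \<open>ennreal\<close>; its reciprocal is
    \<infinity> and would violate the conjugacy relation.\<close>
  have q': "q' > 0"
  proof (rule ccontr)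
    assume "\<not> q' > 0"
    then have "ennreal q' = 0" by (simp add: ennreal_neg)
    then have "1 / ennreal q' = top" by (simp add: ennreal_divide_zero)
    with assms(2) show False by simp
  qed
  have i: "1 / ennreal q' = ennreal (1 / q')"
    using divide_ennreal[of 1 q'] q' by simp
  show inf: "q' = 1" if "q = \<infinity>"
    using assms(2) q' unfolding i that by (simp add: ennreal_eq_1)
  show fin: "enn2real q > 1 \<and> q' > 1 \<and> 1 / enn2real q + 1 / q' = 1" if "q \<noteq> \<infinity>"
  proof -
    obtain r where r: "q = ennreal r" "r \<ge> 0" using \<open>q \<noteq> \<infinity>\<close> by (cases q rule: ennreal_cases) auto
    have r1: "r > 1" using assms(1) r by (metis ennreal_1 ennreal_less_iff zero_le_one)
    have "1 / q = ennreal (1 / r)" unfolding r using divide_ennreal[of 1 r] r1 by simp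
    then have "ennreal (1 / r + 1 / q') = ennreal 1"
      using assms(2) i r1 q' by (simp add: ennreal_plus)
    then have s: "1 / r + 1 / q' = 1" using r1 q' by (subst (asm) ennreal_inj) auto
    then have "1 / q' < 1" using r1 by (smt (verit) divide_pos_pos)
    then have "q' > 1" using q' by (simp add: divide_less_eq)
    with s r1 r show ?thesis by simp
  qed
  show "q' \<ge> 1" using inf fin by (cases "q = \<infinity>") auto
qed

text \<open>All later dependence on q is contained in two properties of a: the bound by A and
  Hoelder's inequality for partial sums, where q = \<infinity> corresponds to q' = 1. An infinite X
  j is excluded because its weight is positive.\<close>

lemma weighted_sequence_bounds:
  fixes q :: ennreal and q' s A :: real and X :: "nat \<Rightarrow> ennreal"
  assumes q: "1 < q" "1 / q + 1 / ennreal q' = 1" and A: "A > 0"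
    and X: "(if q = \<infinity> then (SUP j. ennreal (2 powr (real j * s)) * X j)
         else epowr (\<Sum>j. ennreal (2 powr (real j * s * enn2real q)) * epowr (X j) (enn2real q))
                (1 / enn2real q)) \<le> ennreal A"
  shows "\<exists>a. (\<forall>j. 0 \<le> a j \<and> a j \<le> A \<and> X j = ennreal (a j * 2 powr - (real j * s))) \<and>
      (\<forall>N. (\<Sum>j\<le>N. a j) \<le> A * (real N + 1) powr (1 / q'))"
proof -
  have fin: "X j \<noteq> top" if "ennreal (2 powr (real j * s)) * X j \<le> ennreal A" for j
    using that by (auto simp: ennreal_mult_top top_unique)
  define a where "a j = enn2real (X j) * 2 powr (real j * s)" for j
  have a0: "a j \<ge> 0" for j by (simp add: a_def)
  have Xa: "X j = ennreal (a j * 2 powr - (real j * s))" if "X j \<noteq> top" for j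
  proof -
    have "a j * 2 powr - (real j * s) = enn2real (X j)" by (simp add: a_def powr_minus)
    with that show ?thesis by (simp add: less_top)
  qed
  show ?thesis
  proof (cases "q = \<infinity>")
    case True
    have le: "ennreal (2 powr (real j * s)) * X j \<le> ennreal A" for j
    proof -
      have "ennreal (2 powr (real j * s)) * X j \<le> (SUP j. ennreal (2 powr (real j * s)) * X j)"
        by (rule SUP_upper) simp
      also have "\<dots> \<le> ennreal A" using X True by simp
      finally show ?thesis .
    qed
    have aA: "a j \<le> A" for j
    proof -
      have "ennreal (a j) = ennreal (2 powr (real j * s)) * X j"
        using fin[OF le[of j]] by (simp add: a_def ennreal_mult less_top mult.commute)
      with le[of j] A show ?thesis by (metis ennreal_le_iff less_imp_le)
    qed
    have "(\<Sum>j\<le>N. a j) \<le> A * (real N + 1) powr (1 / q')" for N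
      using sum_bounded_above[of "{..N}" a A] aA conjugate_exponent_cases(2)[OF q True] by (simp add: mult.commute add.commute)
    then show ?thesis using a0 aA Xa fin[OF le] by (intro exI[of _ a]) blast
  next
    case False
    define r where "r = enn2real q"
    have r: "r > 1" "q' > 1" "1 / r + 1 / q' = 1"
      using conjugate_exponent_cases(3)[OF q False] by (auto simp: r_def)
    let ?t = "\<lambda>j. ennreal (2 powr (real j * s * r)) * epowr (X j) r"
    have Y: "epowr (\<Sum>j. ?t j) (1 / r) \<le> ennreal A" using X False by (simp add: r_def)
    then have Ytop: "(\<Sum>j. ?t j) \<noteq> top" by (auto simp: epowr_def top_unique)
    then obtain y where y: "(\<Sum>j. ?t j) = ennreal y" "y \<ge> 0" by (cases "\<Sum>j. ?t j" rule: ennreal_cases) auto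
    have "y powr (1 / r) \<le> A" using Y y A by (simp add: epowr_def)
    then have "(y powr (1 / r)) powr r \<le> A powr r" using r by (intro powr_mono2) auto
    then have yA: "y \<le> A powr r" using r y by (simp add: powr_powr)
    have tj: "?t j \<le> ennreal (A powr r)" for j
    proof -
      have "?t j \<le> (\<Sum>j. ?t j)" using sum_le_suminf[of ?t "{j}"] by simp
      then show ?thesis using yA y by (metis ennreal_leI order_trans)
    qed
    have nt: "X j \<noteq> top" for j
    proof
      assume "X j = top"
      then have "?t j = top" by (simp add: epowr_def ennreal_mult_top)
      with tj[of j] show False by (simp add: top_unique)
    qed
    have ta: "?t j = ennreal (a j powr r)" for j
      using nt[of j] by (simp add: epowr_def a_def powr_mult powr_powr ennreal_mult mult.commute)
    have sumA: "(\<Sum>j\<le>N. a j powr r) \<le> A powr r" for N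
    proof -
      have "ennreal (\<Sum>j\<le>N. a j powr r) = (\<Sum>j\<le>N. ?t j)" unfolding ta by (simp add: sum_ennreal)
      also have "\<dots> \<le> (\<Sum>j. ?t j)" by (rule sum_le_suminf) auto
      also have "\<dots> \<le> ennreal (A powr r)" unfolding y(1) using yA by (rule ennreal_leI)
      finally show ?thesis by (simp add: ennreal_le_iff)
    qed
    have aA: "a j \<le> A" for j
    proof -
      \<comment> \<open>In the sum the bound \<open>j\<close> runs up to the outer
        \<open>j\<close>.\<close>
      have "a j powr r \<le> (\<Sum>j\<le>j. a j powr r)" by (rule member_le_sum) auto
      with sumA[of j] have "a j powr r \<le> A powr r" by linarith
      then have "(a j powr r) powr (1 / r) \<le> (A powr r) powr (1 / r)" by (rule powr_mono2[rotated 2]) (use r in auto)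
      then show ?thesis using r A a0[of j] by (simp add: powr_powr)
    qed
    have "(\<Sum>j\<le>N. a j) \<le> A * (real N + 1) powr (1 / q')" for N
    proof -
      \<comment> \<open>Young's inequality for \<open>(a j / M) * 1\<close>, with \<open>M\<close> chosen so that the two sums balance.\<close>
      define M where "M = A * (real N + 1) powr (- 1 / r)"
      have M: "M > 0" using A by (simp add: M_def)
      have "a j \<le> M * ((a j / M) powr r / r + 1 / q')" for j
      proof -
        have "(a j / M) * 1 \<le> (a j / M) powr r / r + 1 powr q' / q'"
          using r a0[of j] M by (intro Youngs_inequality) auto
        then have "M * (a j / M) \<le> M * ((a j / M) powr r / r + 1 / q')" using M by (intro mult_left_mono) auto
        then show ?thesis using M by simp
      qed
      then have "(\<Sum>j\<le>N. a j) \<le> (\<Sum>j\<le>N. M * ((a j / M) powr r / r + 1 / q'))" by (rule sum_mono)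
      also have "\<dots> = M * ((\<Sum>j\<le>N. a j powr r) / M powr r / r + (real N + 1) / q')"
        using M a0 by (simp add: sum_distrib_left[symmetric] sum.distrib sum_divide_distrib powr_divide add.commute)
      also have "\<dots> \<le> M * (A powr r / M powr r / r + (real N + 1) / q')"
        using M r sumA[of N] by (intro mult_left_mono add_right_mono divide_right_mono) auto
      also have "A powr r / M powr r = real N + 1"
      proof -
        have "- 1 / r * r = - 1" using r by simp
        then have "((real N + 1) powr (- 1 / r)) powr r = (real N + 1) powr (- 1)" by (simp only: powr_powr)
        also have "\<dots> = 1 / (real N + 1)" by (simp add: powr_minus_divide)
        finally show ?thesis using A unfolding M_def by (subst powr_mult) auto
      qed
      also have "M * ((real N + 1) / r + (real N + 1) / q') = M * (real N + 1) * (1 / r + 1 / q')"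
      proof -
        have "M * (b / r + b / q') = M * b * (1 / r + 1 / q')" for b by (simp add: distrib_left)
        then show ?thesis .
      qed
      also have "\<dots> = A * ((real N + 1) powr (- 1 / r) * (real N + 1) powr 1)" by (simp add: r M_def)
      also have "\<dots> = A * (real N + 1) powr (- 1 / r + 1)" by (simp only: powr_add)
      also have "- 1 / r + 1 = 1 / q'" using r(3) by simp
      finally show ?thesis .
    qed
    then show ?thesis using a0 aA Xa[OF nt] by (intro exI[of _ a]) blast
  qed
qed

lemma measure_cube: "measure lebesgue (cube j k :: (real ^ 'n::finite) set) = (2 powi (- j)) ^ CARD('n)"
  by (simp add: measure_def emeasure_cube)

text \<open>The supremum is read off at a single cube and the power 1/p is removed; positive volume
  of the cube rules out an infinite integral.\<close>

lemma morrey_norm_cube_bound: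
  assumes pu: "0 < p" "0 < u" and m: "0 \<le> m" and le: "morrey_norm u p f \<le> ennreal m"
  shows "(\<integral>\<^sup>+y. ennreal (norm (f y) powr p) * indicator (cube j k) y \<partial>lebesgue)
    \<le> ennreal (m powr p * measure lebesgue (cube j k) powr (1 - p / u))"
proof -
  define V where "V = measure lebesgue (cube j k)"
  have V: "V > 0" by (simp add: V_def measure_cube)
  define Y where "Y = (\<integral>\<^sup>+y. ennreal (norm (f y) powr p) * indicator (cube j k) y \<partial>lebesgue)"
  have "cube j k \<in> dyadic_cubes" unfolding dyadic_cubes_def dyadic_cube_eq by blast
  then have "ennreal (V powr (1 / u - 1 / p)) * epowr Y (1 / p) \<le> morrey_norm u p f"
    unfolding morrey_norm_def V_def Y_def by (intro SUP_upper)
  then have Ym: "ennreal (V powr (1 / u - 1 / p)) * epowr Y (1 / p) \<le> ennreal m" using le by (rule order_trans)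
  have "Y \<noteq> top"
  proof
    assume "Y = top"
    with Ym V show False by (simp add: epowr_def ennreal_mult_top top_unique)
  qed
  then obtain y where y: "Y = ennreal y" "y \<ge> 0" by (cases Y rule: ennreal_cases) auto
  have "ennreal (V powr (1 / u - 1 / p) * y powr (1 / p)) \<le> ennreal m"
    using Ym y by (simp add: epowr_def ennreal_mult)
  then have "V powr (1 / u - 1 / p) * y powr (1 / p) \<le> m" using m by (simp only: ennreal_le_iff)
  then have "(V powr (1 / u - 1 / p) * y powr (1 / p)) powr p \<le> m powr p"
    using pu by (intro powr_mono2) auto
  moreover have "(V powr (1 / u - 1 / p) * y powr (1 / p)) powr p = V powr (p / u - 1) * y"
    using pu y by (simp add: powr_mult powr_powr left_diff_distrib)
  ultimately have "V powr (1 - p / u) * (V powr (p / u - 1) * y) \<le> V powr (1 - p / u) * m powr p"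
    by (intro mult_left_mono) auto
  moreover have "V powr (1 - p / u) * (V powr (p / u - 1) * y) = y"
    using V by (simp add: mult.assoc[symmetric] powr_add[symmetric])
  ultimately have "y \<le> m powr p * V powr (1 - p / u)" by (simp only: mult.commute)
  then show ?thesis using y unfolding Y_def[symmetric] V_def[symmetric] by (simp add: ennreal_leI)
qed

text \<open>Rescaling by 2^-j turns cubes of side 2^-j into unit cubes and the reproducing kernel
  into one function independent of j, so a single Nikolskii constant serves all j and T.\<close>

lemma block_sup_bound:
  fixes \<phi> :: "real ^ 'n::finite \<Rightarrow> complex"
  assumes \<phi>: "resolution_generator \<phi>" and pu: "0 < p" "0 < u"
  shows "\<exists>C>0. \<forall>T\<in>tempered_distributions. \<forall>j m y. 0 \<le> m \<longrightarrow> morrey_norm u p (block \<phi> T j) \<le> ennreal m \<longrightarrow>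
     norm (block \<phi> T j y) \<le> C * (m * 2 powr (real j * (real CARD('n) / u)))"
proof -
  note \<phi>t = resolution_generator_test[OF \<phi>]
  define c where "c = norm (LINT z|lebesgue. ft \<phi> z)"
  have c: "c > 0" using ft_integral_nonzero[OF \<phi>t(1,2)] by (simp add: c_def)
  \<comment> \<open>The rescaled kernel of the dilate j + 1: the Jacobian 2^(-jd) against the factor
    2^((j+1)d) leaves 2^d, the argument becomes 2 (y - x), and c is the modulus of the constant in
    the reproducing formula.\<close>
  define \<omega> where "\<omega> z = 2 ^ CARD('n) / c * norm (ft \<phi> ((- 2) *\<^sub>R z))" for z
  have "\<exists>E. \<forall>z. (1 + norm z) ^ M * \<omega> z \<le> E" for M
  proof -
    have "(\<lambda>z. ft \<phi> ((- 2) *\<^sub>R z - 0)) \<in> schwartz" by (rule schwartz_affine[OF ft_schwartz[OF \<phi>t(1)]]) simp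
    then obtain E where E: "\<And>z. (1 + norm z) ^ M * norm (ft \<phi> ((- 2) *\<^sub>R z - 0)) \<le> E" using schwartz_bound0 by metis
    have "(1 + norm z) ^ M * \<omega> z \<le> 2 ^ CARD('n) / c * E" for z
    proof -
      have "2 ^ CARD('n) / c * ((1 + norm z) ^ M * norm (ft \<phi> ((- 2) *\<^sub>R z))) \<le> 2 ^ CARD('n) / c * E"
        using E[of z] c by (intro mult_left_mono) auto
      then show ?thesis by (simp only: \<omega>_def mult_ac)
    qed
    then show ?thesis by blast
  qed
  from nikolskii[OF this pu(1)] obtain C where C: "C > 0" and nik: "\<And>(H :: real ^ 'n \<Rightarrow> complex) b x. H \<in> borel_measurable borel \<Longrightarrow>
    (\<exists>D M. \<forall>y. norm (H y) \<le> D * (1 + norm y) ^ M) \<Longrightarrow>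
    (\<forall>x. ennreal (norm (H x)) \<le> (\<integral>\<^sup>+y. ennreal (\<omega> (x - y) * norm (H y)) \<partial>lebesgue)) \<Longrightarrow>
    0 < b \<Longrightarrow> (\<forall>k. (\<integral>\<^sup>+y. ennreal (norm (H y) powr p) * indicator (cube 0 k) y \<partial>lebesgue) \<le> ennreal (b powr p)) \<Longrightarrow>
    norm (H x) \<le> C * b" by blast
  let ?s = "real CARD('n) / u"
  have pos: "norm (block \<phi> T j y) \<le> C * (m * 2 powr (real j * ?s))"
    if T: "T \<in> tempered_distributions" and m: "0 < m" and le: "morrey_norm u p (block \<phi> T j) \<le> ennreal m" for T j m y
  proof -
    define \<delta> :: real where "\<delta> = (1 / 2) ^ j"
    have \<delta>: "\<delta> > 0" "\<delta> \<le> 1" by (simp_all add: \<delta>_def power_le_one)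
    define G where "G = block \<phi> T j"
    define H where "H x = G (\<delta> *\<^sub>R x)" for x
    note Gb = block_borel[OF \<phi> T, of j, folded G_def]
    have Hb: "H \<in> borel_measurable borel" unfolding H_def by (rule measurable_compose[OF _ Gb]) simp
    have growth: "\<exists>D M. \<forall>y. norm (H y) \<le> D * (1 + norm y) ^ M"
    proof -
      obtain D M where D: "D \<ge> 0" "\<And>y. norm (G y) \<le> D * (1 + norm y) ^ M"
        using block_growth[OF \<phi> T, of j] unfolding G_def by blast
      have "norm (H y) \<le> D * (1 + norm y) ^ M" for y
      proof -
        have "norm (H y) \<le> D * (1 + norm (\<delta> *\<^sub>R y)) ^ M" unfolding H_def by (rule D(2))
        also have "\<dots> \<le> D * (1 + norm y) ^ M"
          using \<delta> by (intro mult_left_mono D(1) power_mono) (auto simp: mult_left_le_one_le)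
        finally show ?thesis .
      qed
      then show ?thesis by blast
    qed
    have rep: "ennreal (norm (H x)) \<le> (\<integral>\<^sup>+y. ennreal (\<omega> (x - y) * norm (H y)) \<partial>lebesgue)" for x
    proof -
      let ?f = "\<lambda>z. ft (dil \<phi> (Suc j)) (z - \<delta> *\<^sub>R x) * G z"
      have fb: "(\<lambda>z. ennreal (norm (?f z))) \<in> borel_measurable borel"
      proof -
        have "(\<lambda>z. ft (dil \<phi> (Suc j)) (z - \<delta> *\<^sub>R x)) \<in> borel_measurable borel"
          by (intro schwartz_borel schwartz_translate ft_schwartz dil_test \<phi>t)
        with Gb show ?thesis by measurable
      qed
      have "ennreal (c * norm (H x)) = ennreal (norm (LINT z|lebesgue. ?f z))"
        using block_reproducing(1)[OF \<phi> T, of j "\<delta> *\<^sub>R x"] by (simp add: c_def H_def G_def norm_mult[symmetric])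
      also have "\<dots> \<le> (\<integral>\<^sup>+z. ennreal (norm (?f z)) \<partial>lebesgue)"
        using block_reproducing(2)[OF \<phi> T, of j "\<delta> *\<^sub>R x"] unfolding G_def by (rule integral_norm_bound_ennreal)
      also have "\<dots> = ennreal (\<bar>\<delta>\<bar> ^ DIM(real ^ 'n)) * (\<integral>\<^sup>+w. ennreal (norm (?f (0 + \<delta> *\<^sub>R w))) \<partial>lebesgue)"
        by (rule nn_integral_affine[OF fb]) (use \<delta> in simp)
      also have "\<dots> = (\<integral>\<^sup>+w. ennreal (\<bar>\<delta>\<bar> ^ DIM(real ^ 'n)) * ennreal (norm (?f (0 + \<delta> *\<^sub>R w))) \<partial>lebesgue)"
        by (rule nn_integral_cmult[symmetric], rule borel_measurable_lebesgueI, rule measurable_compose[OF _ fb]) simp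
      also have "\<dots> = (\<integral>\<^sup>+w. ennreal c * ennreal (\<omega> (x - w) * norm (H w)) \<partial>lebesgue)"
      proof (rule nn_integral_cong)
        fix w
        have "\<delta> *\<^sub>R w - \<delta> *\<^sub>R x = \<delta> *\<^sub>R (w - x)" by (simp add: scaleR_diff_right)
        then have "ft (dil \<phi> (Suc j)) (\<delta> *\<^sub>R w - \<delta> *\<^sub>R x) = of_real (2 ^ (Suc j * CARD('n))) * ft \<phi> (2 ^ Suc j *\<^sub>R (\<delta> *\<^sub>R (w - x)))"
          by (simp only: ft_dil[OF \<phi>t(1)])
        also have "2 ^ Suc j *\<^sub>R (\<delta> *\<^sub>R (w - x)) = (- 2) *\<^sub>R (x - w)"
        proof -
          have "2 ^ Suc j * \<delta> = 2" by (simp add: \<delta>_def power_mult_distrib[symmetric] mult.assoc)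
          then have "2 ^ Suc j *\<^sub>R (\<delta> *\<^sub>R (w - x)) = 2 *\<^sub>R (w - x)" by (simp only: scaleR_scaleR)
          then show ?thesis by (simp add: scaleR_diff_right)
        qed
        finally have e: "norm (ft (dil \<phi> (Suc j)) (\<delta> *\<^sub>R w - \<delta> *\<^sub>R x)) = 2 ^ (Suc j * CARD('n)) * norm (ft \<phi> ((- 2) *\<^sub>R (x - w)))"
          by (simp add: norm_mult norm_power)
        have d: "\<delta> ^ CARD('n) * 2 ^ (Suc j * CARD('n)) = 2 ^ CARD('n)"
          by (simp add: \<delta>_def power_mult[symmetric] power_add power_one_over)
        have "\<delta> ^ CARD('n) * norm (?f (0 + \<delta> *\<^sub>R w)) = (\<delta> ^ CARD('n) * 2 ^ (Suc j * CARD('n))) * norm (ft \<phi> ((- 2) *\<^sub>R (x - w))) * norm (H w)"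
          by (simp only: add_0 norm_mult e H_def mult.assoc)
        also have "\<dots> = c * (\<omega> (x - w) * norm (H w))"
          unfolding d \<omega>_def using c by simp
        finally have "ennreal (\<delta> ^ CARD('n) * norm (?f (0 + \<delta> *\<^sub>R w))) = ennreal (c * (\<omega> (x - w) * norm (H w)))" by simp
        then show "ennreal (\<bar>\<delta>\<bar> ^ DIM(real ^ 'n)) * ennreal (norm (?f (0 + \<delta> *\<^sub>R w))) = ennreal c * ennreal (\<omega> (x - w) * norm (H w))"
          using \<delta> c by (simp add: ennreal_mult'[symmetric])
      qed
      also have "\<dots> = ennreal c * (\<integral>\<^sup>+w. ennreal (\<omega> (x - w) * norm (H w)) \<partial>lebesgue)"
      proof (rule nn_integral_cmult, rule borel_measurable_lebesgueI)
        have "(\<lambda>w. ft \<phi> ((- 2) *\<^sub>R (x - w))) \<in> borel_measurable borel"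
          by (rule measurable_compose[OF _ schwartz_borel[OF ft_schwartz[OF \<phi>t(1)]]]) simp
        with Hb show "(\<lambda>w. ennreal (\<omega> (x - w) * norm (H w))) \<in> borel_measurable borel"
          unfolding \<omega>_def by measurable
      qed
      finally have "ennreal c * ennreal (norm (H x)) \<le> ennreal c * (\<integral>\<^sup>+w. ennreal (\<omega> (x - w) * norm (H w)) \<partial>lebesgue)"
        using c by (simp add: ennreal_mult)
      then have "ennreal (1 / c) * (ennreal c * ennreal (norm (H x))) \<le> ennreal (1 / c) * (ennreal c * (\<integral>\<^sup>+w. ennreal (\<omega> (x - w) * norm (H w)) \<partial>lebesgue))"
        by (rule mult_left_mono) simp
      moreover have "ennreal (1 / c) * ennreal c = 1" using c by (simp add: ennreal_mult[symmetric])
      ultimately show ?thesis by (simp only: mult.assoc[symmetric] mult_1)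
    qed
    have cubes: "(\<integral>\<^sup>+y. ennreal (norm (H y) powr p) * indicator (cube 0 k) y \<partial>lebesgue) \<le> ennreal ((m * 2 powr (real j * ?s)) powr p)" for k
    proof -
      let ?Q = "cube (int j) k"
      let ?f = "\<lambda>z. ennreal (norm (G z) powr p) * indicator ?Q z"
      have fb: "?f \<in> borel_measurable borel"
        by (intro borel_measurable_times_ennreal borel_measurable_indicator) (use Gb cube_borel[of "int j" k] in measurable)
      have ind: "indicator ?Q (\<delta> *\<^sub>R y) = (indicator (cube 0 k) y :: ennreal)" for y
        using cube_scale[of "int j" y k] unfolding powi_neg_nat \<delta>_def by (simp add: indicator_def)
      have "(\<integral>\<^sup>+z. ?f z \<partial>lebesgue) = ennreal (\<bar>\<delta>\<bar> ^ DIM(real ^ 'n)) * (\<integral>\<^sup>+y. ?f (0 + \<delta> *\<^sub>R y) \<partial>lebesgue)"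
        by (rule nn_integral_affine[OF fb]) (use \<delta> in simp)
      also have "\<dots> = ennreal (\<delta> ^ CARD('n)) * (\<integral>\<^sup>+y. ennreal (norm (H y) powr p) * indicator (cube 0 k) y \<partial>lebesgue)"
        using \<delta> by (simp add: ind H_def)
      finally have "ennreal (\<delta> ^ CARD('n)) * (\<integral>\<^sup>+y. ennreal (norm (H y) powr p) * indicator (cube 0 k) y \<partial>lebesgue)
          \<le> ennreal (m powr p * measure lebesgue ?Q powr (1 - p / u))"
        using morrey_norm_cube_bound[OF pu _ le, of "int j" k] m by (simp add: G_def)
      also have "measure lebesgue ?Q = \<delta> ^ CARD('n)" by (simp only: measure_cube powi_neg_nat \<delta>_def)
      finally have "ennreal (1 / \<delta> ^ CARD('n)) * (ennreal (\<delta> ^ CARD('n)) * (\<integral>\<^sup>+y. ennreal (norm (H y) powr p) * indicator (cube 0 k) y \<partial>lebesgue))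
          \<le> ennreal (1 / \<delta> ^ CARD('n)) * ennreal (m powr p * (\<delta> ^ CARD('n)) powr (1 - p / u))"
        by (rule mult_left_mono) simp
      moreover have "ennreal (1 / \<delta> ^ CARD('n)) * ennreal (\<delta> ^ CARD('n)) = 1"
        using \<delta> by (simp add: ennreal_mult[symmetric])
      moreover have "ennreal (1 / \<delta> ^ CARD('n)) * ennreal (m powr p * (\<delta> ^ CARD('n)) powr (1 - p / u)) = ennreal ((m * 2 powr (real j * ?s)) powr p)"
      proof -
        have \<delta>p: "\<delta> ^ CARD('n) = 2 powr (- (real j * real CARD('n)))"
        proof -
          have \<delta>2: "\<delta> = 2 powr (- real j)"
            by (simp add: \<delta>_def powr_minus powr_realpow power_one_over inverse_eq_divide)
          have "\<delta> ^ CARD('n) = \<delta> powr real CARD('n)" using \<delta> by (simp add: powr_realpow)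
          also have "\<dots> = 2 powr (- real j * real CARD('n))" unfolding \<delta>2 by (rule powr_powr)
          finally show ?thesis by simp
        qed
        \<comment> \<open>The volume enters with the exponent (1 - p/u) - 1 = -p/u, which yields the
          factor 2^(jdp/u).\<close>
        have "1 / \<delta> ^ CARD('n) * (m powr p * (\<delta> ^ CARD('n)) powr (1 - p / u)) =
           m powr p * (2 powr (real j * real CARD('n)) * 2 powr (- (real j * real CARD('n)) * (1 - p / u)))"
        proof -
          have e1: "1 / \<delta> ^ CARD('n) = 2 powr (real j * real CARD('n))" unfolding \<delta>p by (simp add: powr_minus divide_inverse)
          have e2: "(\<delta> ^ CARD('n)) powr (1 - p / u) = 2 powr (- (real j * real CARD('n)) * (1 - p / u))"
            unfolding \<delta>p by (rule powr_powr)
          show ?thesis unfolding e1 e2 by (rule mult.left_commute)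
        qed
        also have "\<dots> = m powr p * 2 powr (real j * ?s * p)"
          unfolding powr_add[symmetric] by (simp add: algebra_simps)
        also have "\<dots> = (m * 2 powr (real j * ?s)) powr p" using m by (simp add: powr_mult powr_powr)
        finally show ?thesis using m \<delta> by (simp add: ennreal_mult[symmetric])
      qed
      ultimately show ?thesis by (simp only: mult.assoc[symmetric] mult_1)
    qed
    have "norm (H x) \<le> C * (m * 2 powr (real j * ?s))" for x
      by (rule nik[OF Hb growth]) (use rep cubes m in auto)
    from this[of "(1 / \<delta>) *\<^sub>R y"] show ?thesis using \<delta> by (simp add: H_def G_def)
  qed
  have "norm (block \<phi> T j y) \<le> C * (m * 2 powr (real j * ?s))"
    if T: "T \<in> tempered_distributions" and m: "0 \<le> m" and le: "morrey_norm u p (block \<phi> T j) \<le> ennreal m" for T j m y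
  \<comment> \<open>The Nikolskii inequality asks for b > 0, so the value m = 0 is reached by
    enlarging m slightly.\<close>
  proof (rule field_le_epsilon)
    fix e :: real assume e: "e > 0"
    define w where "w = 2 powr (real j * ?s)"
    have w: "w > 0" by (simp add: w_def)
    define e' where "e' = e / (C * w)"
    have e': "e' > 0" using e C w by (simp add: e'_def)
    have "morrey_norm u p (block \<phi> T j) \<le> ennreal (m + e')"
      using le e' m by (meson ennreal_leI less_imp_le less_add_same_cancel1 order_trans)
    from pos[OF T _ this] e' m have "norm (block \<phi> T j y) \<le> C * ((m + e') * w)" by (simp add: w_def)
    also have "\<dots> = C * (m * w) + e" using C w by (simp add: e'_def field_simps)
    finally show "norm (block \<phi> T j y) \<le> C * (m * 2 powr (real j * ?s)) + e" by (simp add: w_def)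
  qed
  with C show ?thesis by blast
qed

lemma finite_vfloor:
  fixes K :: "(real ^ 'n::finite) set"
  assumes "bounded K"
  shows "finite (vfloor ` K)"
proof -
  obtain B where B: "\<And>x. x \<in> K \<Longrightarrow> norm x \<le> B" using assms unfolding bounded_iff by blast
  define F where "F = {f :: 'n \<Rightarrow> int. \<forall>i. f i \<in> {\<lfloor>- B\<rfloor>..\<lfloor>B\<rfloor>}}"
  have "F = PiE UNIV (\<lambda>_. {\<lfloor>- B\<rfloor>..\<lfloor>B\<rfloor>})" by (auto simp: F_def PiE_def)
  then have "finite F" by (simp add: finite_PiE)
  moreover have "vfloor ` K \<subseteq> vec_lambda ` F"
  proof
    fix v assume "v \<in> vfloor ` K"
    then obtain x where x: "x \<in> K" "v = vfloor x" by blast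
    have "\<lfloor>x $ i\<rfloor> \<in> {\<lfloor>- B\<rfloor>..\<lfloor>B\<rfloor>}" for i
    proof -
      have "\<bar>x $ i\<bar> \<le> B" using component_le_norm_cart[of x i] B[OF x(1)] by linarith
      then show ?thesis by (auto intro!: floor_mono)
    qed
    then show "v \<in> vec_lambda ` F" unfolding x(2) vfloor_def F_def by blast
  qed
  ultimately show ?thesis using finite_surj by blast
qed

text \<open>Turns control on dyadic cubes into finiteness on every bounded set; it is applied to S,
  to obtain a locally integrable majorant.\<close>

lemma nn_integral_compact_finite:
  fixes f :: "real ^ 'n::finite \<Rightarrow> ennreal"
  assumes f: "f \<in> borel_measurable lebesgue" and K: "bounded K"
    and fin: "\<And>k. (\<integral>\<^sup>+y. f y * indicator (cube 0 k) y \<partial>lebesgue) < \<infinity>"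
  shows "(\<integral>\<^sup>+y. f y * indicator K y \<partial>lebesgue) < \<infinity>"
proof -
  have "f y * indicator K y \<le> (\<Sum>k\<in>vfloor ` K. f y * indicator (cube 0 k) y)" for y
  proof (cases "y \<in> K")
    case True
    then have "f y * indicator K y = f y * indicator (cube 0 (vfloor y)) y"
      using mem_unit_cube[of y "vfloor y"] by simp
    also have "\<dots> \<le> (\<Sum>k\<in>vfloor ` K. f y * indicator (cube 0 k) y)"
      using True finite_vfloor[OF K] by (intro member_le_sum) auto
    finally show ?thesis .
  qed simp
  then have "(\<integral>\<^sup>+y. f y * indicator K y \<partial>lebesgue) \<le> (\<integral>\<^sup>+y. (\<Sum>k\<in>vfloor ` K. f y * indicator (cube 0 k) y) \<partial>lebesgue)"
    by (rule nn_integral_mono)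
  also have "\<dots> = (\<Sum>k\<in>vfloor ` K. \<integral>\<^sup>+y. f y * indicator (cube 0 k) y \<partial>lebesgue)"
    by (intro nn_integral_sum borel_measurable_times_ennreal f borel_measurable_indicator) (simp add: cube_borel)
  also have "\<dots> < \<infinity>" using finite_vfloor[OF K] fin by simp
  finally show ?thesis .
qed

section \<open>The embedding\<close>

text \<open>The bound A is a separate positive number because the blocks are normalised by dividing
  by it, while the norm itself may be 0.\<close>

lemma besov_block_representation:
  fixes \<phi> :: "real ^ 'n::finite \<Rightarrow> complex" and p u q' :: real and q :: ennreal
  assumes \<phi>: "resolution_generator \<phi>" and p: "0 < p" and u: "p \<le> u"
    and q: "1 < q" "1 / q + 1 / ennreal q' = 1"
  shows "\<exists>C\<ge>0. \<forall>T\<in>tempered_distributions. \<forall>A>0.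
    besov_morrey_norm \<phi> (real CARD('n) / u) u p q T \<le> ennreal A \<longrightarrow>
    distribution_given_by T (\<lambda>y. (\<Sum>j. block \<phi> T j y) / (of_real ((2 * pi) powr - real CARD('n)) * (LINT z|lebesgue. ft \<phi> z))) \<and>
    orlicz_morrey_norm (u / p) (Phi_exp p q') (\<lambda>y. (\<Sum>j. block \<phi> T j y) / (of_real ((2 * pi) powr - real CARD('n)) * (LINT z|lebesgue. ft \<phi> z)))
      \<le> ennreal (C * A)"
proof -
  note \<phi>t = resolution_generator_test[OF \<phi>]
  have u0: "u > 0" using p u by simp
  have q'1: "q' \<ge> 1" by (rule conjugate_exponent_cases(1)[OF q])
  define s where "s = real CARD('n) / u"
  have s: "s > 0" using u0 by (simp add: s_def)
  define cc where "cc = complex_of_real ((2 * pi) powr - real CARD('n)) * (LINT z|lebesgue. ft \<phi> z)"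
  have cc: "cc \<noteq> 0" using ft_integral_nonzero[OF \<phi>t(1,2)] by (simp add: cc_def)
  obtain C1 where C1: "C1 > 0" and sup: "\<And>T j m y. T \<in> tempered_distributions \<Longrightarrow> 0 \<le> m \<Longrightarrow> morrey_norm u p (block \<phi> T j) \<le> ennreal m \<Longrightarrow>
     norm (block \<phi> T j y) \<le> C1 * (m * 2 powr (real j * s))"
    using block_sup_bound[OF \<phi> p u0] unfolding s_def by blast
  \<comment> \<open>Half of the exponent p s with s = d/u: block j contributes 2^(-jsp) =
    \<theta>^(-2j) to the integral over a cube, and one factor \<theta>^j can be spent on the weight
    in S.\<close>
  define \<theta> where "\<theta> = 2 powr (p * s / 2)"
  have \<theta>: "\<theta> > 1" unfolding \<theta>_def using p s by (intro gr_one_powr) auto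
  have \<theta>j: "\<theta> ^ j * (2 powr (- (real j * s))) powr p = (1 / \<theta>) ^ j" for j
  proof -
    have "(2 powr (- (real j * s))) powr p = (2 powr (p * s / 2)) powr (- real j * 2)"
      unfolding powr_powr by (rule arg_cong[where f = "\<lambda>x. 2 powr x"]) (simp add: field_simps)
    also have "\<dots> = \<theta> powr (- real j) * \<theta> powr (- real j)"
      unfolding \<theta>_def[symmetric] powr_add[symmetric] by (rule arg_cong[where f = "\<lambda>x. \<theta> powr x"]) simp
    also have "\<theta> powr (- real j) = (1 / \<theta>) ^ j"
      using \<theta> by (simp add: powr_minus powr_realpow power_one_over inverse_eq_divide)
    finally have "(2 powr (- (real j * s))) powr p = (1 / \<theta>) ^ j * (1 / \<theta>) ^ j" .
    moreover have "\<theta> ^ j * (1 / \<theta>) ^ j = 1" using \<theta> by (simp add: power_mult_distrib[symmetric])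
    ultimately show ?thesis by (simp only: mult.assoc[symmetric] mult_1)
  qed
  \<comment> \<open>Bounds the mass of S on a cube Q in units of |Q|^(1 - p/u). Taking \<epsilon> =
    1 / D below makes the normalised Orlicz integral at most 1.\<close>
  define D where "D = C1 powr (- p) / (1 - 1 / \<theta>)"
  have D: "D > 0" unfolding D_def using C1 \<theta> by simp
  obtain l where l: "l > 0" and series: "\<And>b :: nat \<Rightarrow> real. \<lbrakk>\<forall>j. 0 \<le> b j; \<forall>N. (\<Sum>j\<le>N. b j) \<le> (real N + 1) powr (1 / q');
      summable (\<lambda>j. \<theta> ^ j * b j powr p)\<rbrakk> \<Longrightarrow> summable b \<and> Phi_exp p q' (suminf b / l) \<le> 1 / D * (\<Sum>j. \<theta> ^ j * b j powr p)"
    using Phi_exp_series_bound[OF p _ \<theta>, of q' "1 / D"] q'1 D by fastforce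
  have main: "distribution_given_by T (\<lambda>y. (\<Sum>j. block \<phi> T j y) / cc) \<and>
     orlicz_morrey_norm (u / p) (Phi_exp p q') (\<lambda>y. (\<Sum>j. block \<phi> T j y) / cc) \<le> ennreal (l * C1 / norm cc * A)"
    if T: "T \<in> tempered_distributions" and A: "A > 0" and le: "besov_morrey_norm \<phi> s u p q T \<le> ennreal A" for T A
  proof -
    define G where "G = block \<phi> T"
    have Gb: "G j \<in> borel_measurable borel" for j unfolding G_def by (rule block_borel[OF \<phi> T])
    have Gm: "G j \<in> borel_measurable lebesgue" for j by (rule borel_measurable_lebesgueI[OF Gb])
    define g where "g y = (\<Sum>j. G j y) / cc" for y
    have gm: "g \<in> borel_measurable lebesgue" unfolding g_def using Gm by measurable
    obtain a where a: "\<And>j. 0 \<le> a j" "\<And>j. a j \<le> A"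
        "\<And>j. morrey_norm_dist u p (block_dist \<phi> T j) = ennreal (a j * 2 powr - (real j * s))"
        and asum: "\<And>N. (\<Sum>j\<le>N. a j) \<le> A * (real N + 1) powr (1 / q')"
      using weighted_sequence_bounds[OF q A, of s "\<lambda>j. morrey_norm_dist u p (block_dist \<phi> T j)"] le
      unfolding besov_morrey_norm_def Let_def block_dist_def by blast
    have morrey: "morrey_norm u p (G j) \<le> ennreal (a j * 2 powr - (real j * s))" for j
      using morrey_norm_block_le[OF \<phi> T, of u p j] by (simp add: a G_def)
    have Ga: "norm (G j y) \<le> C1 * a j" for j y
    proof -
      have "norm (G j y) \<le> C1 * ((a j * 2 powr - (real j * s)) * 2 powr (real j * s))"
        unfolding G_def by (rule sup[OF T _ morrey[unfolded G_def]]) (simp add: a)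
      then show ?thesis by (simp add: mult.assoc powr_add[symmetric])
    qed
    \<comment> \<open>Normalised so that |G_j| \<le> C1 a_j and the bound on the partial sums of a
      give the hypotheses of \<open>Phi_exp_series_bound\<close> at every point y.\<close>
    define b where "b j y = norm (G j y) / (C1 * A)" for j y
    have b0: "b j y \<ge> 0" for j y using C1 A by (simp add: b_def)
    have bsum: "(\<Sum>j\<le>N. b j y) \<le> (real N + 1) powr (1 / q')" for N y
    proof -
      have "b j y \<le> a j / A" for j
        using Ga[of j y] C1 A by (simp add: b_def field_simps)
      then have "(\<Sum>j\<le>N. b j y) \<le> (\<Sum>j\<le>N. a j) / A" unfolding sum_divide_distrib by (rule sum_mono)
      also have "\<dots> \<le> (A * (real N + 1) powr (1 / q')) / A" using A by (intro divide_right_mono asum) simp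
      finally show ?thesis using A by simp
    qed
    \<comment> \<open>Taken in the extended reals: its integrals over cubes can be computed term by
      term before finiteness is known, and they imply that it is finite almost everywhere.\<close>
    define S where "S y = (\<Sum>j. ennreal (\<theta> ^ j * b j y powr p))" for y
    have tm: "(\<lambda>y. ennreal (\<theta> ^ j * b j y powr p)) \<in> borel_measurable lebesgue" for j
      unfolding b_def by (rule borel_measurable_lebesgueI) (use Gb in measurable)
    have Sm: "S \<in> borel_measurable lebesgue" unfolding S_def using tm by measurable
    have S_cube: "(\<integral>\<^sup>+y. S y * indicator (cube i k) y \<partial>lebesgue) \<le> ennreal (D * measure lebesgue (cube i k) powr (1 - p / u))"
      for i and k :: "int ^ 'n"
    proof -
      let ?I = "\<lambda>y. indicator (cube i k) y :: ennreal"
      have Im: "?I \<in> borel_measurable lebesgue" by (rule borel_measurable_indicator) (simp add: cube_borel)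
      define V where "V = measure lebesgue (cube i k) powr (1 - p / u)"
      have V: "V \<ge> 0" by (simp add: V_def)
      have "(\<integral>\<^sup>+y. S y * ?I y \<partial>lebesgue) = (\<integral>\<^sup>+y. (\<Sum>j. ennreal (\<theta> ^ j * b j y powr p) * ?I y) \<partial>lebesgue)"
        by (simp add: S_def)
      also have "\<dots> = (\<Sum>j. \<integral>\<^sup>+y. ennreal (\<theta> ^ j * b j y powr p) * ?I y \<partial>lebesgue)"
        by (intro nn_integral_suminf borel_measurable_times_ennreal tm Im)
      also have "\<dots> \<le> (\<Sum>j. ennreal (C1 powr (- p) * V * (1 / \<theta>) ^ j))"
      proof (rule suminf_le)
        fix j
        let ?c = "\<theta> ^ j * (C1 * A) powr (- p)"
        have "ennreal (\<theta> ^ j * b j y powr p) * ?I y = ennreal ?c * (ennreal (norm (G j y) powr p) * ?I y)" for y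
        proof -
          have "b j y powr p = (C1 * A) powr (- p) * norm (G j y) powr p"
            unfolding b_def using C1 A by (subst powr_divide) (auto simp: powr_minus_divide)
          then have "\<theta> ^ j * b j y powr p = ?c * norm (G j y) powr p" by (simp only: mult.assoc)
          then have "ennreal (\<theta> ^ j * b j y powr p) = ennreal ?c * ennreal (norm (G j y) powr p)"
            using \<theta> by (simp only:) (rule ennreal_mult; simp)
          then show ?thesis by (simp only: mult.assoc)
        qed
        then have "(\<integral>\<^sup>+y. ennreal (\<theta> ^ j * b j y powr p) * ?I y \<partial>lebesgue) = (\<integral>\<^sup>+y. ennreal ?c * (ennreal (norm (G j y) powr p) * ?I y) \<partial>lebesgue)"
          by simp
        also have "\<dots> = ennreal ?c * (\<integral>\<^sup>+y. ennreal (norm (G j y) powr p) * ?I y \<partial>lebesgue)"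
        proof (intro nn_integral_cmult borel_measurable_times_ennreal Im)
          show "(\<lambda>y. ennreal (norm (G j y) powr p)) \<in> borel_measurable lebesgue"
            by (rule borel_measurable_lebesgueI) (use Gb in measurable)
        qed
        also have "\<dots> \<le> ennreal ?c * ennreal ((a j * 2 powr - (real j * s)) powr p * V)"
          unfolding V_def by (intro mult_left_mono morrey_norm_cube_bound[OF p u0 _ morrey]) (simp_all add: a)
        also have "\<dots> = ennreal (?c * ((a j * 2 powr - (real j * s)) powr p * V))"
          by (rule ennreal_mult[symmetric]) (use \<theta> V in auto)
        also have "\<dots> \<le> ennreal (C1 powr (- p) * V * (1 / \<theta>) ^ j)"
        proof (rule ennreal_leI)
          have "?c * ((a j * 2 powr - (real j * s)) powr p * V) =
             (C1 powr (- p) * V) * (\<theta> ^ j * (2 powr - (real j * s)) powr p) * (A powr (- p) * a j powr p)"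
            using C1 A a(1)[of j] by (simp add: powr_mult mult_ac)
          also have "\<dots> = C1 powr (- p) * V * (1 / \<theta>) ^ j * (A powr (- p) * a j powr p)"
            by (simp only: \<theta>j)
          also have "\<dots> \<le> C1 powr (- p) * V * (1 / \<theta>) ^ j * 1"
          proof (rule mult_left_mono)
            have "A powr (- p) * a j powr p \<le> A powr (- p) * A powr p"
              using a[of j] p by (intro mult_left_mono powr_mono2) auto
            then show "A powr (- p) * a j powr p \<le> 1" using A by (simp add: powr_add[symmetric])
          qed (use V \<theta> in auto)
          finally show "?c * ((a j * 2 powr - (real j * s)) powr p * V) \<le> C1 powr (- p) * V * (1 / \<theta>) ^ j" by simp
        qed
        finally show "(\<integral>\<^sup>+y. ennreal (\<theta> ^ j * b j y powr p) * ?I y \<partial>lebesgue) \<le> ennreal (C1 powr (- p) * V * (1 / \<theta>) ^ j)" .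
      qed auto
      also have "\<dots> = ennreal (\<Sum>j. C1 powr (- p) * V * (1 / \<theta>) ^ j)"
        using \<theta> V by (intro suminf_ennreal2 summable_mult summable_geometric) auto
      also have "(\<Sum>j. C1 powr (- p) * V * (1 / \<theta>) ^ j) = D * V"
      proof -
        have "(\<Sum>j. (1 / \<theta>) ^ j) = 1 / (1 - 1 / \<theta>)" using \<theta> by (intro suminf_geometric) auto
        moreover have "summable (\<lambda>j. (1 / \<theta>) ^ j)" using \<theta> by (intro summable_geometric) auto
        ultimately show ?thesis by (simp add: suminf_mult D_def)
      qed
      finally show ?thesis by (simp add: V_def)
    qed
    have S_cube_fin: "(\<integral>\<^sup>+y. S y * indicator (cube i k) y \<partial>lebesgue) < \<infinity>" for i k
      using S_cube[of i k] by (rule le_less_trans) simp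
    have S_AE: "AE y in lebesgue. S y \<noteq> top"
    proof -
      have "AE y in lebesgue. S y * indicator (cube 0 k) y \<noteq> \<infinity>" for k
      proof (rule nn_integral_PInf_AE)
        show "(\<lambda>y. S y * indicator (cube 0 k) y) \<in> borel_measurable lebesgue"
          by (intro borel_measurable_times_ennreal Sm borel_measurable_indicator) (simp add: cube_borel)
        show "(\<integral>\<^sup>+y. S y * indicator (cube 0 k) y \<partial>lebesgue) \<noteq> \<infinity>" using S_cube_fin[of 0 k] by simp
      qed
      then have "AE y in lebesgue. \<forall>k. S y * indicator (cube 0 k) y \<noteq> \<infinity>" by (simp add: AE_all_countable)
      then show ?thesis
      proof (rule eventually_mono)
        fix y assume "\<forall>k. S y * indicator (cube 0 k) y \<noteq> \<infinity>"
        from this[rule_format, of "vfloor y"] show "S y \<noteq> top" using mem_unit_cube[of y "vfloor y"] by simp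
      qed
    qed
    have good: "summable (\<lambda>j. b j y) \<and> ennreal (Phi_exp p q' ((\<Sum>j. b j y) / l)) \<le> ennreal (1 / D) * S y
        \<and> Phi_exp p q' ((\<Sum>j. b j y) / l) \<le> 1 / D * enn2real (S y)" if "S y \<noteq> top" for y
    proof -
      have nn: "\<And>j. 0 \<le> \<theta> ^ j * b j y powr p" using \<theta> by simp
      have sm: "summable (\<lambda>j. \<theta> ^ j * b j y powr p)"
        by (rule summable_suminf_not_top) (use nn that in \<open>auto simp: S_def\<close>)
      have Sy: "S y = ennreal (\<Sum>j. \<theta> ^ j * b j y powr p)"
        unfolding S_def by (rule suminf_ennreal2[OF nn sm])
      have S0: "(\<Sum>j. \<theta> ^ j * b j y powr p) \<ge> 0" by (rule suminf_nonneg[OF sm nn])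
      have "summable (\<lambda>j. b j y) \<and> Phi_exp p q' ((\<Sum>j. b j y) / l) \<le> 1 / D * (\<Sum>j. \<theta> ^ j * b j y powr p)"
        by (rule series) (use b0 bsum sm in auto)
      moreover from this have "ennreal (Phi_exp p q' ((\<Sum>j. b j y) / l)) \<le> ennreal (1 / D) * S y"
        unfolding Sy using D S0 by (subst ennreal_mult[symmetric]) (auto intro: ennreal_leI)
      ultimately show ?thesis using S0 by (simp add: Sy)
    qed
    have nG: "norm (G j y) = C1 * A * b j y" for j y using C1 A by (simp add: b_def)
    have G_summable: "summable (\<lambda>j. norm (G j y))" and G_suminf: "(\<Sum>j. norm (G j y)) = C1 * A * (\<Sum>j. b j y)"
      if "S y \<noteq> top" for y
      using good[OF that] by (simp_all add: nG summable_mult suminf_mult)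
    \<comment> \<open>Undoes the normalisation of b, the scale l and the divisor cc; it is a fixed
      multiple of A.\<close>
    define \<Lambda> where "\<Lambda> = l * C1 / norm cc * A"
    have \<Lambda>: "\<Lambda> > 0" using l C1 A cc by (simp add: \<Lambda>_def)
    have g_le: "norm (g y) / \<Lambda> \<le> (\<Sum>j. b j y) / l" if "S y \<noteq> top" for y
    proof -
      have "norm (g y) \<le> (\<Sum>j. norm (G j y)) / norm cc"
        unfolding g_def norm_divide by (intro divide_right_mono summable_norm G_summable that) simp
      also have "\<dots> = \<Lambda> * ((\<Sum>j. b j y) / l)" using l by (simp add: G_suminf[OF that] \<Lambda>_def)
      finally show ?thesis using \<Lambda> by (simp add: pos_divide_le_eq mult.commute)
    qed
    have orlicz: "orlicz_morrey_norm (u / p) (Phi_exp p q') g \<le> ennreal \<Lambda>"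
      unfolding orlicz_morrey_norm_def
    proof (rule SUP_least)
      fix Q :: "(real ^ 'n) set" assume "Q \<in> dyadic_cubes"
      then obtain i k where Q: "Q = cube i k" unfolding dyadic_cubes_def dyadic_cube_eq by blast
      define V where "V = measure lebesgue Q"
      have V: "V > 0" unfolding V_def Q by (simp add: measure_cube)
      have "(\<integral>\<^sup>+x\<in>Q. ennreal (Phi_exp p q' (norm (g x) / \<Lambda>)) \<partial>lebesgue) \<le> (\<integral>\<^sup>+x. ennreal (1 / D) * (S x * indicator Q x) \<partial>lebesgue)"
      proof (rule nn_integral_mono_AE, use S_AE in eventually_elim)
        fix x assume Sx: "S x \<noteq> top"
        have "ennreal (Phi_exp p q' (norm (g x) / \<Lambda>)) \<le> ennreal (Phi_exp p q' ((\<Sum>j. b j x) / l))"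
          using g_le[OF Sx] \<Lambda> p q'1 by (intro ennreal_leI Phi_exp_mono) auto
        also have "\<dots> \<le> ennreal (1 / D) * S x" using good[OF Sx] by blast
        finally show "ennreal (Phi_exp p q' (norm (g x) / \<Lambda>)) * indicator Q x \<le> ennreal (1 / D) * (S x * indicator Q x)"
          by (simp add: indicator_def)
      qed
      also have "\<dots> = ennreal (1 / D) * (\<integral>\<^sup>+x. S x * indicator Q x \<partial>lebesgue)"
        by (intro nn_integral_cmult borel_measurable_times_ennreal Sm borel_measurable_indicator) (simp add: Q cube_borel)
      also have "\<dots> \<le> ennreal (1 / D) * ennreal (D * V powr (1 - p / u))"
        unfolding V_def Q by (intro mult_left_mono S_cube) simp
      also have "\<dots> = ennreal (V powr (1 - p / u))"
        using D by (simp add: ennreal_mult[symmetric])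
      finally have I: "(\<integral>\<^sup>+x\<in>Q. ennreal (Phi_exp p q' (norm (g x) / \<Lambda>)) \<partial>lebesgue) \<le> ennreal (V powr (1 - p / u))" .
      have "ennreal (V powr (1 / (u / p) - 1)) * (\<integral>\<^sup>+x\<in>Q. ennreal (Phi_exp p q' (norm (g x) / \<Lambda>)) \<partial>lebesgue)
          \<le> ennreal (V powr (1 / (u / p) - 1)) * ennreal (V powr (1 - p / u))"
        by (rule mult_left_mono[OF I]) simp
      also have "\<dots> = 1" using V by (simp add: ennreal_mult[symmetric] powr_add[symmetric])
      finally have "\<Lambda> \<in> {l::real. l > 0 \<and> ennreal (measure lebesgue Q powr (1 / (u / p) - 1)) *
                 (\<integral>\<^sup>+x\<in>Q. ennreal (Phi_exp p q' (norm (g x) / l)) \<partial>lebesgue) \<le> 1}"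
        using \<Lambda> by (simp add: V_def)
      then show "orlicz_cube_norm (u / p) (Phi_exp p q') Q g \<le> ennreal \<Lambda>"
        unfolding orlicz_cube_norm_def by (rule INF_lower)
    qed
    \<comment> \<open>A majorant of the absolute series, obtained from t \<le> 1 + \<Phi>(t) and the
      bound of \<Phi> by S. It serves both the local integrability of g and the dominated
      convergence of the partial sums.\<close>
    define w where "w y = C1 * A * l * (1 + 1 / D * enn2real (S y))" for y
    have G_le_w: "(\<Sum>j. norm (G j y)) \<le> w y" if "S y \<noteq> top" for y
    proof -
      have "(\<Sum>j. b j y) \<ge> 0" using good[OF that] b0 by (intro suminf_nonneg) auto
      then have "(\<Sum>j. b j y) / l \<le> 1 + Phi_exp p q' ((\<Sum>j. b j y) / l)"
        using p q'1 l by (intro le_one_plus_Phi_exp) auto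
      also have "\<dots> \<le> 1 + 1 / D * enn2real (S y)" using good[OF that] by simp
      finally have "C1 * A * l * ((\<Sum>j. b j y) / l) \<le> w y"
        unfolding w_def using C1 A l by (intro mult_left_mono) auto
      then show ?thesis using l by (simp add: G_suminf[OF that])
    qed
    have w0: "w y \<ge> 0" for y unfolding w_def using C1 A l D by simp
    have wi: "integrable lebesgue (\<lambda>y. w y * indicator K y)" if K: "compact K" for K
    proof -
      have Km: "K \<in> sets lebesgue" using K by (simp add: compact_imp_closed)
      have "integrable lebesgue (\<lambda>y. enn2real (S y) * indicator K y)"
      proof (rule integrableI_bounded)
        show "(\<lambda>y. enn2real (S y) * indicator K y) \<in> borel_measurable lebesgue"
          using Sm Km by measurable
        have "(\<integral>\<^sup>+y. ennreal (norm (enn2real (S y) * indicator K y)) \<partial>lebesgue) \<le> (\<integral>\<^sup>+y. S y * indicator K y \<partial>lebesgue)"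
        proof (rule nn_integral_mono)
          fix y
          have "ennreal (enn2real (S y)) \<le> S y" by (cases "S y" rule: ennreal_cases) auto
          then show "ennreal (norm (enn2real (S y) * indicator K y)) \<le> S y * indicator K y"
            by (auto simp: indicator_def)
        qed
        also have "\<dots> < \<infinity>"
          by (rule nn_integral_compact_finite[OF Sm compact_imp_bounded[OF K] S_cube_fin])
        finally show "(\<integral>\<^sup>+y. ennreal (norm (enn2real (S y) * indicator K y)) \<partial>lebesgue) < \<infinity>" .
      qed
      moreover have "integrable lebesgue (\<lambda>y. indicator K y :: real)"
        using lmeasurable_compact[OF K] by (simp add: lmeasurable_iff_integrable)
      ultimately have "integrable lebesgue (\<lambda>y. C1 * A * l * (indicator K y + 1 / D * (enn2real (S y) * indicator K y)))"
        by (intro integrable_mult_right Bochner_Integration.integrable_add)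
      moreover have "(\<lambda>y. C1 * A * l * (indicator K y + 1 / D * (enn2real (S y) * indicator K y))) = (\<lambda>y. w y * indicator K y)"
        by (rule ext) (simp add: w_def algebra_simps)
      ultimately show ?thesis by (simp only:)
    qed
    have sum_le: "norm (\<Sum>j. G j y) \<le> w y" if "S y \<noteq> top" for y
      using summable_norm[OF G_summable[OF that]] G_le_w[OF that] by linarith
    have sumG_m: "(\<lambda>y. \<Sum>j. G j y) \<in> borel_measurable lebesgue" using Gm by measurable
    have partial_m: "(\<lambda>y. \<Sum>j<N. G j y) \<in> borel_measurable lebesgue" for N using Gm by measurable
    have dist: "distribution_given_by T g"
      unfolding distribution_given_by_def
    proof (intro conjI allI impI ballI)
      fix K :: "(real ^ 'n) set" assume K: "compact K"
      show "set_integrable lebesgue K g"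
        unfolding set_integrable_iff_indicator
      proof (rule Bochner_Integration.integrable_bound)
        show "integrable lebesgue (\<lambda>y. 1 / norm cc * (w y * indicator K y))" by (intro integrable_mult_right wi K)
        show "(\<lambda>y. g y * indicator K y) \<in> borel_measurable lebesgue"
          using gm K by (intro borel_measurable_times borel_measurable_indicator) (auto simp: compact_imp_closed)
        show "AE y in lebesgue. norm (g y * indicator K y) \<le> norm (1 / norm cc * (w y * indicator K y))"
          using S_AE
        proof (rule eventually_mono)
          fix y assume "S y \<noteq> top"
          from sum_le[OF this] show "norm (g y * indicator K y) \<le> norm (1 / norm cc * (w y * indicator K y))"
            using w0[of y] by (auto simp: g_def norm_divide indicator_def divide_right_mono)
        qed
      qed
    next
      fix \<eta> :: "real ^ 'n \<Rightarrow> complex" assume \<eta>: "\<eta> \<in> test_functions"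
      obtain R where R: "\<And>x. norm x > R \<Longrightarrow> \<eta> x = 0" using test_vanish[OF \<eta>] by metis
      obtain M where M: "M \<ge> 0" "\<And>x. norm (\<eta> x) \<le> M" using test_bounded0[OF \<eta>] by metis
      note \<eta>m = borel_measurable_lebesgueI[OF test_borel[OF \<eta>]]
      have "(\<lambda>N. LINT y|lebesgue. \<eta> y * (\<Sum>j<N. G j y)) \<longlonglongrightarrow> (LINT y|lebesgue. \<eta> y * (\<Sum>j. G j y))"
      proof (rule integral_dominated_convergence)
        show "integrable lebesgue (\<lambda>y. M * (w y * indicator (cball 0 R) y))" by (intro integrable_mult_right wi) simp
        show "(\<lambda>y. \<eta> y * (\<Sum>j. G j y)) \<in> borel_measurable lebesgue" by (rule borel_measurable_times[OF \<eta>m sumG_m])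
        show "(\<lambda>y. \<eta> y * (\<Sum>j<N. G j y)) \<in> borel_measurable lebesgue" for N
          by (rule borel_measurable_times[OF \<eta>m partial_m])
        show "AE y in lebesgue. (\<lambda>N. \<eta> y * (\<Sum>j<N. G j y)) \<longlonglongrightarrow> \<eta> y * (\<Sum>j. G j y)"
          using S_AE
        proof (rule eventually_mono)
          fix y assume "S y \<noteq> top"
          then have "summable (\<lambda>j. G j y)" by (rule summable_norm_cancel[OF G_summable])
          then show "(\<lambda>N. \<eta> y * (\<Sum>j<N. G j y)) \<longlonglongrightarrow> \<eta> y * (\<Sum>j. G j y)"
            by (intro tendsto_mult_left summable_LIMSEQ)
        qed
        show "AE y in lebesgue. norm (\<eta> y * (\<Sum>j<N. G j y)) \<le> M * (w y * indicator (cball 0 R) y)" for N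
          using S_AE
        proof (rule eventually_mono)
          fix y assume Sy: "S y \<noteq> top"
          have "norm (\<Sum>j<N. G j y) \<le> (\<Sum>j<N. norm (G j y))" by (rule norm_sum)
          also have "\<dots> \<le> (\<Sum>j. norm (G j y))" by (rule sum_le_suminf[OF G_summable[OF Sy]]) auto
          also have "\<dots> \<le> w y" by (rule G_le_w[OF Sy])
          finally have n: "norm (\<Sum>j<N. G j y) \<le> w y" .
          show "norm (\<eta> y * (\<Sum>j<N. G j y)) \<le> M * (w y * indicator (cball 0 R) y)"
          proof (cases "norm y > R")
            case False
            have "norm (\<eta> y) * norm (\<Sum>j<N. G j y) \<le> M * w y" by (rule mult_mono[OF M(2) n M(1)]) simp
            with False show ?thesis by (simp add: norm_mult)
          qed (simp add: R)
        qed
      qed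
      \<comment> \<open>Shifts the range from j < N to j \<le> N, in which the pieces
        telescope.\<close>
      then have "(\<lambda>N. LINT y|lebesgue. \<eta> y * (\<Sum>j<Suc N. G j y)) \<longlonglongrightarrow> (LINT y|lebesgue. \<eta> y * (\<Sum>j. G j y))"
        by (rule LIMSEQ_Suc)
      moreover have "(LINT y|lebesgue. \<eta> y * (\<Sum>j<Suc N. G j y)) = (\<Sum>j\<le>N. block_dist \<phi> T j \<eta>)" for N
      proof -
        have "(LINT y|lebesgue. \<eta> y * (\<Sum>j<Suc N. G j y)) = (LINT y|lebesgue. (\<Sum>j\<le>N. \<eta> y * block \<phi> T j y))"
          by (simp only: sum_distrib_left lessThan_Suc_atMost G_def)
        also have "\<dots> = (\<Sum>j\<le>N. LINT y|lebesgue. \<eta> y * block \<phi> T j y)"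
          by (rule Bochner_Integration.integral_sum[OF block_dist_eq(2)[OF \<phi> T \<eta>]])
        finally show ?thesis by (simp only: block_dist_eq(1)[OF \<phi> T \<eta>])
      qed
      ultimately have "(\<lambda>N. \<Sum>j\<le>N. block_dist \<phi> T j \<eta>) \<longlonglongrightarrow> (LINT y|lebesgue. \<eta> y * (\<Sum>j. G j y))" by simp
      \<comment> \<open>The same partial sums tend to \<open>cc * T \<eta>\<close> by the
        approximate identity and to the integral by domination.\<close>
      with sum_block_dist_tendsto[OF \<phi> T \<eta>] have "cc * T \<eta> = (LINT y|lebesgue. \<eta> y * (\<Sum>j. G j y))"
        unfolding cc_def by (rule LIMSEQ_unique)
      then have "T \<eta> = 1 / cc * (LINT y|lebesgue. \<eta> y * (\<Sum>j. G j y))" using cc by (simp add: field_simps)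
      also have "\<dots> = (LINT y|lebesgue. 1 / cc * (\<eta> y * (\<Sum>j. G j y)))" by (simp only: integral_mult_right_zero)
      also have "\<dots> = (LINT y|lebesgue. g y * \<eta> y)" by (simp add: g_def mult_ac)
      finally show "T \<eta> = (LINT y|lebesgue. g y * \<eta> y)" .
    qed
    from dist orlicz show ?thesis by (simp add: g_def[abs_def] G_def \<Lambda>_def)
  qed
  have "l * C1 / norm cc \<ge> 0" using l C1 by simp
  then show ?thesis using main unfolding s_def cc_def by blast
qed

theorem theorem4p5:
  fixes \<phi> :: "real ^ 'n::finite \<Rightarrow> complex"
    and p u q' :: real and q :: ennreal
  assumes "resolution_generator \<phi>"
    and "0 < p" and "p \<le> u"
    and "1 < q"
    and "1 / q + 1 / ennreal q' = 1"
  shows "continuously_embedded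
           (besov_morrey_space \<phi> (real CARD('n) / u) u p q)
           (besov_morrey_norm \<phi> (real CARD('n) / u) u p q)
           (orlicz_morrey_space (u / p) (Phi_exp p q'))
           (orlicz_morrey_norm (u / p) (Phi_exp p q'))"
proof -
  let ?B = "besov_morrey_norm \<phi> (real CARD('n) / u) u p q"
  let ?O = "orlicz_morrey_norm (u / p) (Phi_exp p q') :: (real ^ 'n \<Rightarrow> complex) \<Rightarrow> ennreal"
  let ?g = "\<lambda>T y. (\<Sum>j. block \<phi> T j y) / (of_real ((2 * pi) powr - real CARD('n)) * (LINT z|lebesgue. ft \<phi> z))"
  obtain C where C: "C \<ge> 0" and rep: "\<And>T A. T \<in> tempered_distributions \<Longrightarrow> A > 0 \<Longrightarrow> ?B T \<le> ennreal A \<Longrightarrow>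
      distribution_given_by T (?g T) \<and> ?O (?g T) \<le> ennreal (C * A)"
    using besov_block_representation[OF assms] by blast
  have "?g T \<in> orlicz_morrey_space (u / p) (Phi_exp p q') \<and> distribution_given_by T (?g T) \<and> ?O (?g T) \<le> ennreal C * ?B T"
    if "T \<in> besov_morrey_space \<phi> (real CARD('n) / u) u p q" for T
  proof -
    have T: "T \<in> tempered_distributions" and fin: "?B T < \<infinity>"
      using that by (auto simp: besov_morrey_space_def)
    obtain N where N: "?B T = ennreal N" "N \<ge> 0" using fin by (cases "?B T" rule: ennreal_cases) auto
    \<comment> \<open>A norm equal to 0 is covered by using a slightly larger A; dividing by C + 1
      avoids a division by C = 0.\<close>
    have bound: "?O (?g T) \<le> ennreal C * ?B T + ennreal e" if e: "e > 0" for e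
    proof -
      define A where "A = N + e / (C + 1)"
      have "e / (C + 1) > 0" using e C by simp
      then have A: "A > 0" "N \<le> A" using N(2) by (auto simp: A_def)
      have "?O (?g T) \<le> ennreal (C * A)" using rep[OF T A(1)] A(2) N(1) by (simp add: ennreal_leI)
      also have "C * A \<le> C * N + e"
      proof -
        have "C * (e / (C + 1)) \<le> (C + 1) * (e / (C + 1))" using e C by (intro mult_right_mono) auto
        then show ?thesis using C by (simp add: A_def distrib_left)
      qed
      then have "ennreal (C * A) \<le> ennreal (C * N + e)" by (rule ennreal_leI)
      also have "\<dots> = ennreal C * ?B T + ennreal e" using C N e by (simp add: ennreal_plus ennreal_mult)
      finally show ?thesis .
    qed
    have le: "?O (?g T) \<le> ennreal C * ?B T" by (rule ennreal_le_epsilon) (rule bound)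
    also have "\<dots> < \<infinity>" unfolding N(1) by (simp add: ennreal_mult[symmetric] C N(2))
    finally have "?O (?g T) < \<infinity>" .
    moreover have "?g T \<in> borel_measurable lebesgue"
      using borel_measurable_lebesgueI[OF block_borel[OF assms(1) T]] by measurable
    moreover have "distribution_given_by T (?g T)"
      using rep[OF T, of "N + 1"] N by (simp add: ennreal_leI)
    ultimately show ?thesis using le by (simp add: orlicz_morrey_space_def)
  qed
  then show ?thesis unfolding continuously_embedded_def by blast
qed

end
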